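(* (a) Let $R$ be a right $V$-ring. Let $M$ be a finitely generated right $R$-module whose socle is projective. Suppose each cyclic subfactor of $M$ satisfies ( * ). Then $M$ is noetherian, and $M = X\oplus T$, where $X$ is semisimple and $T$ is noetherian with zero socle. In particular, if $R$ is a right $V$-ring such that each cyclic right $R$-module satisfies ( * ), then $R=S\oplus T$ (as rings), where $S$ is a semisimple artinian ring and $T$ is a finite direct sum of simple right noetherian rings with zero right socle. (b) Let $R$ be a right $WV$-ring. Then $R$ is right noetherian if and only if each cyclic right $R$-module satisfies ( * ).
   Context: All rings are associative with identity, and all modules are right modules. A ring $R$ is a right $V$-ring if every simple right $R$-module is injective. A ring $R$ is a right $WV$-ring if every simple right $R$-module is $R/A$-injective for every right ideal $A$ of $R$ such that $R/A\not\cong R$ as right $R$-modules. (For modules $N$, $Q$: $Q$ is $N$-injective if every homomorphism from a submodule of $N$ to $Q$ extends to $N$.) A module is CS if each of its submodules is essential in a direct summand. A module $N$ satisfies ( * ) if $N=A\oplus B$ where $A$ is either a CS module or a noetherian module, and $B$ is a projective module. A subfactor of $M$ is a module $Y/Z$ with $Z\subseteq Y\subseteq M$ submodules; a cyclic subfactor is a subfactor that is a cyclic module. Direct summands and direct sums of rings are allowed to be zero (empty). *)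

theory Defs
  imports "HOL-Algebra.Module" "HOL-Algebra.Chinese_Remainder"
begin

section \<open>Right modules over a possibly noncommutative ring\<close>

text \<open>The library's modules are left modules over commutative rings. As for the library's record
  \<open>module\<close>, only the additive part of the underlying \<open>ring\<close> record is meaningful.\<close>

record ('a, 'm) rmodule = "'m ring" +
  ract :: "'m \<Rightarrow> 'a \<Rightarrow> 'm" (infixl "\<triangleleft>\<index>" 70)

locale right_module = R?: ring R + M?: abelian_group M
  for R :: "('a, 'r) ring_scheme" (structure) and M :: "('a, 'm) rmodule" (structure) +
  assumes ract_closed [simp, intro]:
      "\<lbrakk> x \<in> carrier M; r \<in> carrier R \<rbrakk> \<Longrightarrow> x \<triangleleft>\<^bsub>M\<^esub> r \<in> carrier M"
    and ract_l_distr: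
      "\<lbrakk> x \<in> carrier M; y \<in> carrier M; r \<in> carrier R \<rbrakk> \<Longrightarrow>
       (x \<oplus>\<^bsub>M\<^esub> y) \<triangleleft>\<^bsub>M\<^esub> r = x \<triangleleft>\<^bsub>M\<^esub> r \<oplus>\<^bsub>M\<^esub> y \<triangleleft>\<^bsub>M\<^esub> r"
    and ract_r_distr:
      "\<lbrakk> x \<in> carrier M; r \<in> carrier R; s \<in> carrier R \<rbrakk> \<Longrightarrow>
       x \<triangleleft>\<^bsub>M\<^esub> (r \<oplus>\<^bsub>R\<^esub> s) = x \<triangleleft>\<^bsub>M\<^esub> r \<oplus>\<^bsub>M\<^esub> x \<triangleleft>\<^bsub>M\<^esub> s"
    and ract_assoc:
      "\<lbrakk> x \<in> carrier M; r \<in> carrier R; s \<in> carrier R \<rbrakk> \<Longrightarrow>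
       x \<triangleleft>\<^bsub>M\<^esub> (r \<otimes>\<^bsub>R\<^esub> s) = (x \<triangleleft>\<^bsub>M\<^esub> r) \<triangleleft>\<^bsub>M\<^esub> s"
    and ract_one [simp]: "x \<in> carrier M \<Longrightarrow> x \<triangleleft>\<^bsub>M\<^esub> \<one>\<^bsub>R\<^esub> = x"

definition regular_module :: "('a, 'r) ring_scheme \<Rightarrow> ('a, 'a) rmodule"
  where "regular_module R =
    \<lparr> carrier = carrier R, mult = mult R, one = \<one>\<^bsub>R\<^esub>, zero = \<zero>\<^bsub>R\<^esub>, add = add R, ract = mult R \<rparr>"

definition rsubmodule :: "('a, 'r) ring_scheme \<Rightarrow> ('a, 'm) rmodule \<Rightarrow> 'm set \<Rightarrow> bool"
  where "rsubmodule R M N \<longleftrightarrow> subgroup N (add_monoid M) \<and>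
    (\<forall>x\<in>N. \<forall>r\<in>carrier R. x \<triangleleft>\<^bsub>M\<^esub> r \<in> N)"

definition right_ideal :: "('a, 'r) ring_scheme \<Rightarrow> 'a set \<Rightarrow> bool"
  where "right_ideal R A \<longleftrightarrow> rsubmodule R (regular_module R) A"

definition submod :: "('a, 'm) rmodule \<Rightarrow> 'm set \<Rightarrow> ('a, 'm) rmodule"
  where "submod M N = M\<lparr>carrier := N\<rparr>"

definition quotient_module :: "('a, 'm) rmodule \<Rightarrow> 'm set \<Rightarrow> ('a, 'm set) rmodule"
  where "quotient_module M Z =
    \<lparr> carrier = a_rcosets\<^bsub>M\<^esub> Z, mult = undefined, one = undefined, zero = Z, add = set_add M,
      ract = (\<lambda>X r. \<Union>x\<in>X. Z +>\<^bsub>M\<^esub> (x \<triangleleft>\<^bsub>M\<^esub> r)) \<rparr>"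

definition rmod_hom ::
    "('a, 'r) ring_scheme \<Rightarrow> ('a, 'm) rmodule \<Rightarrow> ('a, 'n) rmodule \<Rightarrow> ('m \<Rightarrow> 'n) set"
  where "rmod_hom R M N = {f. f \<in> carrier M \<rightarrow> carrier N \<and>
    (\<forall>x\<in>carrier M. \<forall>y\<in>carrier M. f (x \<oplus>\<^bsub>M\<^esub> y) = f x \<oplus>\<^bsub>N\<^esub> f y) \<and>
    (\<forall>x\<in>carrier M. \<forall>r\<in>carrier R. f (x \<triangleleft>\<^bsub>M\<^esub> r) = f x \<triangleleft>\<^bsub>N\<^esub> r)}"

definition rmod_isomorphic ::
    "('a, 'r) ring_scheme \<Rightarrow> ('a, 'm) rmodule \<Rightarrow> ('a, 'n) rmodule \<Rightarrow> bool"
  where "rmod_isomorphic R M N \<longleftrightarrow> (\<exists>f\<in>rmod_hom R M N. bij_betw f (carrier M) (carrier N))"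

definition rmod_span :: "('a, 'r) ring_scheme \<Rightarrow> ('a, 'm) rmodule \<Rightarrow> 'm set \<Rightarrow> 'm set"
  where "rmod_span R M X = \<Inter>{N. rsubmodule R M N \<and> X \<subseteq> N}"

definition finitely_generated_module :: "('a, 'r) ring_scheme \<Rightarrow> ('a, 'm) rmodule \<Rightarrow> bool"
  where "finitely_generated_module R M \<longleftrightarrow>
    (\<exists>X. finite X \<and> X \<subseteq> carrier M \<and> rmod_span R M X = carrier M)"

definition cyclic_module :: "('a, 'r) ring_scheme \<Rightarrow> ('a, 'm) rmodule \<Rightarrow> bool"
  where "cyclic_module R M \<longleftrightarrow> (\<exists>x\<in>carrier M. carrier M = (\<lambda>r. x \<triangleleft>\<^bsub>M\<^esub> r) ` carrier R)"

definition simple_module :: "('a, 'r) ring_scheme \<Rightarrow> ('a, 'm) rmodule \<Rightarrow> bool"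
  where "simple_module R M \<longleftrightarrow> carrier M \<noteq> {\<zero>\<^bsub>M\<^esub>} \<and>
    (\<forall>N. rsubmodule R M N \<longrightarrow> N = {\<zero>\<^bsub>M\<^esub>} \<or> N = carrier M)"

text \<open>The sum of all simple submodules.\<close>

definition socle :: "('a, 'r) ring_scheme \<Rightarrow> ('a, 'm) rmodule \<Rightarrow> 'm set"
  where "socle R M = rmod_span R M (\<Union>{S. rsubmodule R M S \<and> simple_module R (submod M S)})"

definition semisimple_module :: "('a, 'r) ring_scheme \<Rightarrow> ('a, 'm) rmodule \<Rightarrow> bool"
  where "semisimple_module R M \<longleftrightarrow> socle R M = carrier M"

definition noetherian_module :: "('a, 'r) ring_scheme \<Rightarrow> ('a, 'm) rmodule \<Rightarrow> bool"
  where "noetherian_module R M \<longleftrightarrow>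
    (\<forall>N :: nat \<Rightarrow> 'm set. (\<forall>n. rsubmodule R M (N n)) \<and> (\<forall>n. N n \<subseteq> N (Suc n)) \<longrightarrow>
      (\<exists>k. \<forall>n\<ge>k. N n = N k))"

definition artinian_module :: "('a, 'r) ring_scheme \<Rightarrow> ('a, 'm) rmodule \<Rightarrow> bool"
  where "artinian_module R M \<longleftrightarrow>
    (\<forall>N :: nat \<Rightarrow> 'm set. (\<forall>n. rsubmodule R M (N n)) \<and> (\<forall>n. N (Suc n) \<subseteq> N n) \<longrightarrow>
      (\<exists>k. \<forall>n\<ge>k. N n = N k))"

definition internal_direct_sum ::
    "('a, 'r) ring_scheme \<Rightarrow> ('a, 'm) rmodule \<Rightarrow> 'm set \<Rightarrow> 'm set \<Rightarrow> bool"
  where "internal_direct_sum R M A B \<longleftrightarrow> rsubmodule R M A \<and> rsubmodule R M B \<and>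
    A <+>\<^bsub>M\<^esub> B = carrier M \<and> A \<inter> B = {\<zero>\<^bsub>M\<^esub>}"

definition direct_summand :: "('a, 'r) ring_scheme \<Rightarrow> ('a, 'm) rmodule \<Rightarrow> 'm set \<Rightarrow> bool"
  where "direct_summand R M A \<longleftrightarrow> (\<exists>B. internal_direct_sum R M A B)"

definition essential_in ::
    "('a, 'r) ring_scheme \<Rightarrow> ('a, 'm) rmodule \<Rightarrow> 'm set \<Rightarrow> 'm set \<Rightarrow> bool"
  where "essential_in R M N D \<longleftrightarrow> N \<subseteq> D \<and>
    (\<forall>U. rsubmodule R M U \<and> U \<subseteq> D \<and> U \<inter> N = {\<zero>\<^bsub>M\<^esub>} \<longrightarrow> U = {\<zero>\<^bsub>M\<^esub>})"

definition CS_module :: "('a, 'r) ring_scheme \<Rightarrow> ('a, 'm) rmodule \<Rightarrow> bool"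
  where "CS_module R M \<longleftrightarrow>
    (\<forall>N. rsubmodule R M N \<longrightarrow> (\<exists>D. direct_summand R M D \<and> essential_in R M N D))"


section \<open>Injectivity and projectivity\<close>

definition relatively_injective ::
    "('a, 'r) ring_scheme \<Rightarrow> ('a, 'n) rmodule \<Rightarrow> ('a, 'q) rmodule \<Rightarrow> bool"
  where "relatively_injective R N Q \<longleftrightarrow>
    (\<forall>U f. rsubmodule R N U \<and> f \<in> rmod_hom R (submod N U) Q \<longrightarrow>
      (\<exists>g\<in>rmod_hom R N Q. \<forall>x\<in>U. g x = f x))"

text \<open>A definition cannot quantify over types, so the test modules in the next two definitions range
  over all modules on one fixed type. That type has room for enough test modules: in
  \<open>injective_module\<close> for the cyclic modules \<open>R/A\<close>, in particular for a copy \<open>R/0\<close> of \<open>R\<close> itself; in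
  \<open>projective_module\<close> for the free module on the set \<open>carrier P\<close>. The lemmas
  \<open>injective_module_universal\<close> and \<open>projective_module_universal\<close> below show that the properties
  then hold for test modules on arbitrary types.\<close>

definition injective_module :: "('a, 'r) ring_scheme \<Rightarrow> ('a, 'q) rmodule \<Rightarrow> bool"
  where "injective_module R Q \<longleftrightarrow>
    (\<forall>N :: ('a, 'a set) rmodule. right_module R N \<longrightarrow> relatively_injective R N Q)"

definition projective_module :: "('a, 'r) ring_scheme \<Rightarrow> ('a, 'p) rmodule \<Rightarrow> bool"
  where "projective_module R P \<longleftrightarrow>
    (\<forall>(N :: ('a, 'p \<Rightarrow> 'a) rmodule) (L :: ('a, 'p) rmodule) g f.
      right_module R N \<and> right_module R L \<and>
      g \<in> rmod_hom R N L \<and> g ` carrier N = carrier L \<and> f \<in> rmod_hom R P L \<longrightarrow>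
      (\<exists>h\<in>rmod_hom R P N. \<forall>x\<in>carrier P. g (h x) = f x))"

text \<open>Every simple (more generally, every cyclic) module is isomorphic to some \<open>R/A\<close> (see
  \<open>cyclic_iso_quotient\<close> below), whose carrier consists of cosets, so it is no restriction to consider simple and cyclic modules on the type
  \<open>'a set\<close> only.\<close>

definition right_V_ring :: "('a, 'r) ring_scheme \<Rightarrow> bool"
  where "right_V_ring R \<longleftrightarrow> ring R \<and>
    (\<forall>Q :: ('a, 'a set) rmodule. right_module R Q \<and> simple_module R Q \<longrightarrow> injective_module R Q)"

definition right_WV_ring :: "('a, 'r) ring_scheme \<Rightarrow> bool"
  where "right_WV_ring R \<longleftrightarrow> ring R \<and>
    (\<forall>Q :: ('a, 'a set) rmodule. right_module R Q \<and> simple_module R Q \<longrightarrow>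
      (\<forall>A. right_ideal R A \<and>
           \<not> rmod_isomorphic R (quotient_module (regular_module R) A) (regular_module R) \<longrightarrow>
        relatively_injective R (quotient_module (regular_module R) A) Q))"

definition property_star :: "('a, 'r) ring_scheme \<Rightarrow> ('a, 'm) rmodule \<Rightarrow> bool"
  where "property_star R N \<longleftrightarrow> (\<exists>A B. internal_direct_sum R N A B \<and>
    (CS_module R (submod N A) \<or> noetherian_module R (submod N A)) \<and>
    projective_module R (submod N B))"

definition every_cyclic_has_star :: "('a, 'r) ring_scheme \<Rightarrow> bool"
  where "every_cyclic_has_star R \<longleftrightarrow>
    (\<forall>N :: ('a, 'a set) rmodule. right_module R N \<and> cyclic_module R N \<longrightarrow> property_star R N)"


section \<open>Rings\<close>

definition right_noetherian_ring :: "('a, 'r) ring_scheme \<Rightarrow> bool"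
  where "right_noetherian_ring R \<longleftrightarrow> ring R \<and> noetherian_module R (regular_module R)"

definition right_artinian_ring :: "('a, 'r) ring_scheme \<Rightarrow> bool"
  where "right_artinian_ring R \<longleftrightarrow> ring R \<and> artinian_module R (regular_module R)"

definition semisimple_artinian_ring :: "('a, 'r) ring_scheme \<Rightarrow> bool"
  where "semisimple_artinian_ring R \<longleftrightarrow>
    semisimple_module R (regular_module R) \<and> right_artinian_ring R"

definition simple_ring :: "('a, 'r) ring_scheme \<Rightarrow> bool"
  where "simple_ring R \<longleftrightarrow> ring R \<and> carrier R \<noteq> {\<zero>\<^bsub>R\<^esub>} \<and>
    (\<forall>I. ideal I R \<longrightarrow> I = {\<zero>\<^bsub>R\<^esub>} \<or> I = carrier R)"

definition right_socle :: "('a, 'r) ring_scheme \<Rightarrow> 'a set"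
  where "right_socle R = socle R (regular_module R)"


section \<open>Independence of the types chosen for test modules\<close>

lemma regular_module_simps [simp]:
  "carrier (regular_module R) = carrier R" "\<zero>\<^bsub>regular_module R\<^esub> = \<zero>\<^bsub>R\<^esub>"
  "x \<oplus>\<^bsub>regular_module R\<^esub> y = x \<oplus>\<^bsub>R\<^esub> y" "x \<triangleleft>\<^bsub>regular_module R\<^esub> r = x \<otimes>\<^bsub>R\<^esub> r"
  by (simp_all add: regular_module_def)

lemma submod_simps [simp]:
  "carrier (submod M N) = N" "\<zero>\<^bsub>submod M N\<^esub> = \<zero>\<^bsub>M\<^esub>"
  "x \<oplus>\<^bsub>submod M N\<^esub> y = x \<oplus>\<^bsub>M\<^esub> y" "x \<triangleleft>\<^bsub>submod M N\<^esub> r = x \<triangleleft>\<^bsub>M\<^esub> r"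
  by (simp_all add: submod_def)

lemma right_moduleI:
  assumes "ring R" "abelian_group M"
    "\<And>x r. \<lbrakk> x \<in> carrier M; r \<in> carrier R \<rbrakk> \<Longrightarrow> x \<triangleleft>\<^bsub>M\<^esub> r \<in> carrier M"
    "\<And>x y r. \<lbrakk> x \<in> carrier M; y \<in> carrier M; r \<in> carrier R \<rbrakk> \<Longrightarrow>
       (x \<oplus>\<^bsub>M\<^esub> y) \<triangleleft>\<^bsub>M\<^esub> r = x \<triangleleft>\<^bsub>M\<^esub> r \<oplus>\<^bsub>M\<^esub> y \<triangleleft>\<^bsub>M\<^esub> r"
    "\<And>x r s. \<lbrakk> x \<in> carrier M; r \<in> carrier R; s \<in> carrier R \<rbrakk> \<Longrightarrow>
       x \<triangleleft>\<^bsub>M\<^esub> (r \<oplus>\<^bsub>R\<^esub> s) = x \<triangleleft>\<^bsub>M\<^esub> r \<oplus>\<^bsub>M\<^esub> x \<triangleleft>\<^bsub>M\<^esub> s"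
    "\<And>x r s. \<lbrakk> x \<in> carrier M; r \<in> carrier R; s \<in> carrier R \<rbrakk> \<Longrightarrow>
       x \<triangleleft>\<^bsub>M\<^esub> (r \<otimes>\<^bsub>R\<^esub> s) = (x \<triangleleft>\<^bsub>M\<^esub> r) \<triangleleft>\<^bsub>M\<^esub> s"
    "\<And>x. x \<in> carrier M \<Longrightarrow> x \<triangleleft>\<^bsub>M\<^esub> \<one>\<^bsub>R\<^esub> = x"
  shows "right_module R M"
proof -
  interpret R: ring R by fact
  interpret M: abelian_group M by fact
  show ?thesis by unfold_locales (use assms in auto)
qed

lemma right_module_regular:
  assumes "ring R"
  shows "right_module R (regular_module R)"
proof -
  interpret ring R by fact
  have "abelian_group (regular_module R)"
  proof (rule abelian_groupI)
    fix x assume "x \<in> carrier (regular_module R)"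
    then show "\<exists>y\<in>carrier (regular_module R). y \<oplus>\<^bsub>regular_module R\<^esub> x = \<zero>\<^bsub>regular_module R\<^esub>"
      by (intro bexI[of _ "\<ominus>\<^bsub>R\<^esub> x"]) (simp_all add: l_neg)
  qed (simp_all add: add.m_ac)
  then show ?thesis
    by (intro right_moduleI) (simp_all add: l_distr r_distr m_assoc assms)
qed

context right_module
begin

lemma ract_r_zero [simp]: "x \<in> carrier M \<Longrightarrow> x \<triangleleft>\<^bsub>M\<^esub> \<zero> = \<zero>\<^bsub>M\<^esub>"
  using ract_r_distr[of x \<zero> \<zero>] ract_closed[of x \<zero>] M.add.r_cancel_one' by fastforce

lemma ract_l_zero [simp]: "r \<in> carrier R \<Longrightarrow> \<zero>\<^bsub>M\<^esub> \<triangleleft>\<^bsub>M\<^esub> r = \<zero>\<^bsub>M\<^esub>"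
  using ract_l_distr[of "\<zero>\<^bsub>M\<^esub>" "\<zero>\<^bsub>M\<^esub>" r] ract_closed[of "\<zero>\<^bsub>M\<^esub>" r] M.add.r_cancel_one' by fastforce

lemma ract_r_minus:
  assumes "x \<in> carrier M" "r \<in> carrier R"
  shows "x \<triangleleft>\<^bsub>M\<^esub> (\<ominus> r) = \<ominus>\<^bsub>M\<^esub> (x \<triangleleft>\<^bsub>M\<^esub> r)"
  by (rule M.minus_equality[symmetric])
    (use assms ract_r_distr[of x "\<ominus> r" r] in \<open>auto simp: R.l_neg\<close>)

lemma minus_ract: "x \<in> carrier M \<Longrightarrow> \<ominus>\<^bsub>M\<^esub> x = x \<triangleleft>\<^bsub>M\<^esub> (\<ominus> \<one>)"
  using ract_r_minus[of x \<one>] by simp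

lemma rsubmodule_subset: "rsubmodule R M N \<Longrightarrow> N \<subseteq> carrier M"
  using subgroup.subset[of N "add_monoid M"] by (simp add: rsubmodule_def)

lemma rsubmoduleI:
  assumes "N \<subseteq> carrier M" "\<zero>\<^bsub>M\<^esub> \<in> N" "\<And>x y. x \<in> N \<Longrightarrow> y \<in> N \<Longrightarrow> x \<oplus>\<^bsub>M\<^esub> y \<in> N"
    "\<And>x r. x \<in> N \<Longrightarrow> r \<in> carrier R \<Longrightarrow> x \<triangleleft>\<^bsub>M\<^esub> r \<in> N"
  shows "rsubmodule R M N"
proof -
  have "\<ominus>\<^bsub>M\<^esub> x \<in> N" if "x \<in> N" for x
    using minus_ract[of x] assms that by auto
  then have "subgroup N (add_monoid M)"
    using assms by (intro M.add.subgroupI) (auto simp: a_inv_def)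
  then show ?thesis using assms by (auto simp: rsubmodule_def)
qed

lemma rsubmoduleD:
  assumes "rsubmodule R M N"
  shows "\<zero>\<^bsub>M\<^esub> \<in> N" "\<And>x y. x \<in> N \<Longrightarrow> y \<in> N \<Longrightarrow> x \<oplus>\<^bsub>M\<^esub> y \<in> N"
    "\<And>x r. x \<in> N \<Longrightarrow> r \<in> carrier R \<Longrightarrow> x \<triangleleft>\<^bsub>M\<^esub> r \<in> N"
    "\<And>x. x \<in> N \<Longrightarrow> \<ominus>\<^bsub>M\<^esub> x \<in> N"
  using assms subgroup.one_closed[of N "add_monoid M"] subgroup.m_closed[of N "add_monoid M"]
    subgroup.m_inv_closed[of N "add_monoid M"]
  by (auto simp: rsubmodule_def a_inv_def)

end

lemma (in right_module) right_module_submod: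
  assumes "rsubmodule R M N"
  shows "right_module R (submod M N)"
proof -
  note D = rsubmoduleD[OF assms] and S = subsetD[OF rsubmodule_subset[OF assms]]
  have "abelian_group (submod M N)"
  proof (rule abelian_groupI)
    fix x assume "x \<in> carrier (submod M N)"
    then show "\<exists>y\<in>carrier (submod M N). y \<oplus>\<^bsub>submod M N\<^esub> x = \<zero>\<^bsub>submod M N\<^esub>"
      by (intro bexI[of _ "\<ominus>\<^bsub>M\<^esub> x"]) (simp_all add: M.l_neg D S)
  qed (simp_all add: M.add.m_ac D S)
  then show ?thesis
    by (intro right_moduleI) (auto simp: D S ract_l_distr ract_r_distr ract_assoc intro: R.ring_axioms)
qed

lemma (in right_module) quotient_ract:
  assumes Z: "rsubmodule R M Z" and "x \<in> carrier M" "r \<in> carrier R"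
  shows "(Z +>\<^bsub>M\<^esub> x) \<triangleleft>\<^bsub>quotient_module M Z\<^esub> r = Z +>\<^bsub>M\<^esub> (x \<triangleleft>\<^bsub>M\<^esub> r)"
proof -
  note D = rsubmoduleD[OF Z] and S = subsetD[OF rsubmodule_subset[OF Z]]
  have sub: "subgroup Z (add_monoid M)" using Z by (simp add: rsubmodule_def)
  have "Z +>\<^bsub>M\<^esub> (y \<triangleleft>\<^bsub>M\<^esub> r) = Z +>\<^bsub>M\<^esub> (x \<triangleleft>\<^bsub>M\<^esub> r)" if y: "y \<in> Z +>\<^bsub>M\<^esub> x" for y
  proof -
    obtain z where z: "z \<in> Z" "y = z \<oplus>\<^bsub>M\<^esub> x" using y
      unfolding a_r_coset_def' by blast
    then have "y \<triangleleft>\<^bsub>M\<^esub> r = z \<triangleleft>\<^bsub>M\<^esub> r \<oplus>\<^bsub>M\<^esub> x \<triangleleft>\<^bsub>M\<^esub> r"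
      using assms S[OF z(1)] by (simp add: ract_l_distr)
    then have "y \<triangleleft>\<^bsub>M\<^esub> r \<in> Z +>\<^bsub>M\<^esub> (x \<triangleleft>\<^bsub>M\<^esub> r)"
      using D(3)[OF z(1) assms(3)] unfolding a_r_coset_def' by blast
    then show ?thesis
      by (rule M.a_repr_independence[symmetric, OF _ ract_closed[OF assms(2,3)] sub])
  qed
  moreover have "x \<in> Z +>\<^bsub>M\<^esub> x"
    using M.add.rcos_self[OF assms(2) sub] by (simp add: a_r_coset_def)
  ultimately have "(\<Union>y \<in> Z +>\<^bsub>M\<^esub> x. Z +>\<^bsub>M\<^esub> (y \<triangleleft>\<^bsub>M\<^esub> r)) = Z +>\<^bsub>M\<^esub> (x \<triangleleft>\<^bsub>M\<^esub> r)"
    by blast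
  then show ?thesis by (simp add: quotient_module_def)
qed

lemma (in right_module) right_module_quotient:
  assumes Z: "rsubmodule R M Z"
  shows "right_module R (quotient_module M Z)"
proof -
  let ?Q = "quotient_module M Z"
  interpret Z: abelian_subgroup Z M
    using Z by (intro abelian_subgroupI3)
      (auto simp: rsubmodule_def additive_subgroup_def intro: M.abelian_group_axioms)
  have car: "carrier ?Q = (\<lambda>x. Z +>\<^bsub>M\<^esub> x) ` carrier M"
    by (auto simp: quotient_module_def A_RCOSETS_def')
  have add: "(Z +>\<^bsub>M\<^esub> x) \<oplus>\<^bsub>?Q\<^esub> (Z +>\<^bsub>M\<^esub> y) = Z +>\<^bsub>M\<^esub> (x \<oplus>\<^bsub>M\<^esub> y)"
    if "x \<in> carrier M" "y \<in> carrier M" for x y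
    using that Z.a_rcos_sum by (simp add: quotient_module_def)
  have zero: "\<zero>\<^bsub>?Q\<^esub> = Z +>\<^bsub>M\<^esub> \<zero>\<^bsub>M\<^esub>"
    using rsubmodule_subset[OF Z] by (simp add: quotient_module_def)
  have ag: "abelian_group ?Q"
  proof (rule abelian_groupI)
    fix X assume "X \<in> carrier ?Q"
    then obtain x where x: "x \<in> carrier M" "X = Z +>\<^bsub>M\<^esub> x" by (auto simp: car)
    then show "\<exists>Y\<in>carrier ?Q. Y \<oplus>\<^bsub>?Q\<^esub> X = \<zero>\<^bsub>?Q\<^esub>"
      by (intro bexI[of _ "Z +>\<^bsub>M\<^esub> (\<ominus>\<^bsub>M\<^esub> x)"]) (simp_all add: car add zero M.l_neg)
  qed (auto simp: car add zero M.add.m_ac)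
  show ?thesis
    by (rule right_moduleI)
      (auto simp: car add quotient_ract[OF Z] ract_l_distr ract_r_distr ract_assoc
        intro: R.ring_axioms ag)
qed

lemma rmod_homD:
  assumes "f \<in> rmod_hom R M N"
  shows "\<And>x. x \<in> carrier M \<Longrightarrow> f x \<in> carrier N"
    "\<And>x y. x \<in> carrier M \<Longrightarrow> y \<in> carrier M \<Longrightarrow> f (x \<oplus>\<^bsub>M\<^esub> y) = f x \<oplus>\<^bsub>N\<^esub> f y"
    "\<And>x r. x \<in> carrier M \<Longrightarrow> r \<in> carrier R \<Longrightarrow> f (x \<triangleleft>\<^bsub>M\<^esub> r) = f x \<triangleleft>\<^bsub>N\<^esub> r"
  using assms by (auto simp: rmod_hom_def)

lemma rmod_hom_zero:
  assumes "right_module R M" "right_module R N" "f \<in> rmod_hom R M N"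
  shows "f \<zero>\<^bsub>M\<^esub> = \<zero>\<^bsub>N\<^esub>"
proof -
  interpret M: right_module R M by fact
  interpret N: right_module R N by fact
  note D = rmod_homD[OF assms(3)]
  have "f \<zero>\<^bsub>M\<^esub> = f (\<zero>\<^bsub>M\<^esub> \<triangleleft>\<^bsub>M\<^esub> \<zero>\<^bsub>R\<^esub>)" by simp
  also have "\<dots> = \<zero>\<^bsub>N\<^esub>" by (simp only: D M.zero_closed M.R.zero_closed N.ract_r_zero)
  finally show ?thesis .
qed

lemma injective_module_regular:
  assumes "ring R" "injective_module R Q"
  shows "relatively_injective R (regular_module R) Q"
proof -
  interpret ring R by fact
  interpret RR: right_module R "regular_module R" by (rule right_module_regular) fact
  let ?N = "\<lparr>carrier = (\<lambda>r. {r}) ` carrier R, mult = undefined, one = undefined, zero = {\<zero>\<^bsub>R\<^esub>},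
    add = \<lambda>X Y. {the_elem X \<oplus>\<^bsub>R\<^esub> the_elem Y}, ract = \<lambda>X r. {the_elem X \<otimes>\<^bsub>R\<^esub> r}\<rparr> :: ('a, 'a set) rmodule"
  have ag: "abelian_group ?N"
  proof (rule abelian_groupI)
    fix X assume "X \<in> carrier ?N"
    then obtain x where x: "x \<in> carrier R" "X = {x}" by auto
    then show "\<exists>Y\<in>carrier ?N. Y \<oplus>\<^bsub>?N\<^esub> X = \<zero>\<^bsub>?N\<^esub>"
      by (intro bexI[of _ "{\<ominus>\<^bsub>R\<^esub> x}"]) (simp_all add: l_neg)
  qed (auto simp: add.m_ac)
  have "right_module R ?N"
    by (rule right_moduleI) (auto simp: l_distr r_distr m_assoc intro: ring_axioms ag)
  then interpret N: right_module R ?N .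
  have inj: "relatively_injective R ?N Q"
    using assms(2) N.right_module_axioms by (simp add: injective_module_def)
  show ?thesis
    unfolding relatively_injective_def
  proof (intro allI impI, elim conjE)
    fix U f
    assume U: "rsubmodule R (regular_module R) U"
      and f: "f \<in> rmod_hom R (submod (regular_module R) U) Q"
    note D = RR.rsubmoduleD[OF U] and S = subsetD[OF RR.rsubmodule_subset[OF U]]
    note fD = rmod_homD[OF f]
    have U': "rsubmodule R ?N ((\<lambda>r. {r}) ` U)"
      by (rule N.rsubmoduleI) (use D S in auto)
    have f': "f \<circ> the_elem \<in> rmod_hom R (submod ?N ((\<lambda>r. {r}) ` U)) Q"
      using fD by (auto simp: rmod_hom_def)
    obtain g where g: "g \<in> rmod_hom R ?N Q" "\<And>x. x \<in> U \<Longrightarrow> g {x} = f x"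
      using inj U' f' unfolding relatively_injective_def by fastforce
    have "(\<lambda>x. g {x}) \<in> rmod_hom R (regular_module R) Q"
      using rmod_homD(1)[OF g(1)] rmod_homD(2)[OF g(1), of "{_}" "{_}"]
        rmod_homD(3)[OF g(1), of "{_}"] by (simp add: rmod_hom_def)
    then show "\<exists>g\<in>rmod_hom R (regular_module R) Q. \<forall>x\<in>U. g x = f x"
      by (rule bexI[rotated]) (simp add: g(2))
  qed
qed

text \<open>Baer's criterion.\<close>

lemma injective_module_universal:
  fixes N :: "('a, 'n) rmodule" and Q :: "('a, 'q) rmodule"
  assumes "right_module R Q" "injective_module R Q" "right_module R N"
  shows "relatively_injective R N Q"
  unfolding relatively_injective_def
proof (intro allI impI, elim conjE)
  note ringR = right_module.axioms(1)[OF assms(1)]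
  interpret R: ring R by (rule ringR)
  interpret Q: right_module R Q by fact
  interpret N: right_module R N by fact
  interpret RR: right_module R "regular_module R" by (rule right_module_regular) (rule ringR)
  fix U f assume U: "rsubmodule R N U" and f: "f \<in> rmod_hom R (submod N U) Q"
  note D = N.rsubmoduleD[OF U] and S = subsetD[OF N.rsubmodule_subset[OF U]]
  note fD = rmod_homD[OF f, simplified]
  let ?f = "(\<lambda>x. (x, f x)) ` U"
  define \<Phi> where "\<Phi> = {G. G \<subseteq> carrier N \<times> carrier Q \<and> ?f \<subseteq> G \<and>
    (\<forall>x q y p. (x, q) \<in> G \<longrightarrow> (y, p) \<in> G \<longrightarrow> (x \<oplus>\<^bsub>N\<^esub> y, q \<oplus>\<^bsub>Q\<^esub> p) \<in> G) \<and>
    (\<forall>x q. \<forall>r\<in>carrier R. (x, q) \<in> G \<longrightarrow> (x \<triangleleft>\<^bsub>N\<^esub> r, q \<triangleleft>\<^bsub>Q\<^esub> r) \<in> G) \<and>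
    (\<forall>x q p. (x, q) \<in> G \<longrightarrow> (x, p) \<in> G \<longrightarrow> q = p)}"
  have "?f \<in> \<Phi>" using fD D S by (auto simp: \<Phi>_def)
  moreover have "\<Union>C \<in> \<Phi>" if C: "C \<noteq> {}" "subset.chain \<Phi> C" for C
  proof -
    have sub: "C \<subseteq> \<Phi>" using C(2) by (simp add: subset_chain_def)
    have two: "\<exists>G\<in>C. a \<in> G \<and> b \<in> G" if "a \<in> \<Union>C" "b \<in> \<Union>C" for a b
      using that C(2) unfolding subset_chain_def by blast
    have 1: "\<Union>C \<subseteq> carrier N \<times> carrier Q" using sub unfolding \<Phi>_def by blast
    have 2: "?f \<subseteq> \<Union>C" using sub C(1) unfolding \<Phi>_def by blast
    have 3: "(x \<oplus>\<^bsub>N\<^esub> y, q \<oplus>\<^bsub>Q\<^esub> p) \<in> \<Union>C" if "(x, q) \<in> \<Union>C" "(y, p) \<in> \<Union>C" for x q y p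
      using two[OF that] sub unfolding \<Phi>_def by blast
    have 4: "(x \<triangleleft>\<^bsub>N\<^esub> r, q \<triangleleft>\<^bsub>Q\<^esub> r) \<in> \<Union>C" if "r \<in> carrier R" "(x, q) \<in> \<Union>C" for x q r
      using that sub unfolding \<Phi>_def by blast
    have 5: "q = p" if "(x, q) \<in> \<Union>C" "(x, p) \<in> \<Union>C" for x q p
      using two[OF that] sub unfolding \<Phi>_def by blast
    show ?thesis unfolding \<Phi>_def mem_Collect_eq
      by (intro conjI allI ballI impI) (rule 1, rule 2, erule (1) 3, erule (1) 4, erule (1) 5)
  qed
  ultimately obtain G where GP: "G \<in> \<Phi>" and max: "\<And>X. X \<in> \<Phi> \<Longrightarrow> G \<subseteq> X \<Longrightarrow> X = G"
    using subset_Zorn_nonempty[of \<Phi>] by blast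
  note c = GP[unfolded \<Phi>_def mem_Collect_eq]
  note G = conjunct1[OF c] c[THEN conjunct2, THEN conjunct1]
    c[THEN conjunct2, THEN conjunct2, THEN conjunct1]
    c[THEN conjunct2, THEN conjunct2, THEN conjunct2, THEN conjunct1]
    c[THEN conjunct2, THEN conjunct2, THEN conjunct2, THEN conjunct2]
  have G1: "\<And>x q. (x, q) \<in> G \<Longrightarrow> x \<in> carrier N" "\<And>x q. (x, q) \<in> G \<Longrightarrow> q \<in> carrier Q"
    and G2: "\<And>x. x \<in> U \<Longrightarrow> (x, f x) \<in> G"
    using G(1,2) by blast+
  note G3 = G(3)[rule_format] and G4 = G(4)[rule_format, rotated] and G5 = G(5)[rule_format]
  have G0: "(\<zero>\<^bsub>N\<^esub>, \<zero>\<^bsub>Q\<^esub>) \<in> G"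
    using G4[OF G2[OF D(1)], of "\<zero>\<^bsub>R\<^esub>"] G1[OF G2[OF D(1)]] by simp
  have total: "\<exists>q. (x, q) \<in> G" if x: "x \<in> carrier N" for x
  proof -
    define A where "A = {r \<in> carrier R. \<exists>q. (x \<triangleleft>\<^bsub>N\<^esub> r, q) \<in> G}"
    define \<phi> where "\<phi> r = (THE q. (x \<triangleleft>\<^bsub>N\<^esub> r, q) \<in> G)" for r
    have \<phi>: "\<phi> r = q" if "(x \<triangleleft>\<^bsub>N\<^esub> r, q) \<in> G" for r q
      unfolding \<phi>_def using that G5 by blast
    have A: "rsubmodule R (regular_module R) A"
    proof (rule RR.rsubmoduleI)
      show "\<zero>\<^bsub>regular_module R\<^esub> \<in> A" using G0 x by (auto simp: A_def)
      show "a \<oplus>\<^bsub>regular_module R\<^esub> b \<in> A" if "a \<in> A" "b \<in> A" for a b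
        using that G3 x by (fastforce simp: A_def N.ract_r_distr)
      show "a \<triangleleft>\<^bsub>regular_module R\<^esub> r \<in> A" if "a \<in> A" "r \<in> carrier R" for a r
        using that G4 x by (fastforce simp: A_def N.ract_assoc)
    qed (auto simp: A_def)
    have "\<phi> \<in> rmod_hom R (submod (regular_module R) A) Q"
      unfolding rmod_hom_def mem_Collect_eq
    proof (intro conjI ballI funcsetI)
      fix a assume "a \<in> carrier (submod (regular_module R) A)"
      then obtain q where a: "a \<in> carrier R" "(x \<triangleleft>\<^bsub>N\<^esub> a, q) \<in> G" by (auto simp: A_def)
      show "\<phi> a \<in> carrier Q" using \<phi>[OF a(2)] G1 a by auto
      show "\<phi> (a \<triangleleft>\<^bsub>submod (regular_module R) A\<^esub> r) = \<phi> a \<triangleleft>\<^bsub>Q\<^esub> r" if "r \<in> carrier R" for r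
        using \<phi>[OF a(2)] G4[OF a(2) that] \<phi>[of "a \<otimes>\<^bsub>R\<^esub> r"] a x that by (auto simp: N.ract_assoc)
      fix b assume "b \<in> carrier (submod (regular_module R) A)"
      then obtain p where b: "b \<in> carrier R" "(x \<triangleleft>\<^bsub>N\<^esub> b, p) \<in> G" by (auto simp: A_def)
      show "\<phi> (a \<oplus>\<^bsub>submod (regular_module R) A\<^esub> b) = \<phi> a \<oplus>\<^bsub>Q\<^esub> \<phi> b"
        using \<phi>[OF a(2)] \<phi>[OF b(2)] G3[OF a(2) b(2)] \<phi>[of "a \<oplus>\<^bsub>R\<^esub> b"] a b x
        by (auto simp: N.ract_r_distr)
    qed
    then obtain \<psi> where \<psi>: "\<psi> \<in> rmod_hom R (regular_module R) Q" "\<And>r. r \<in> A \<Longrightarrow> \<psi> r = \<phi> r"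
      using injective_module_regular[OF ringR assms(2)] A
      unfolding relatively_injective_def by blast
    define q0 where "q0 = \<psi> \<one>\<^bsub>R\<^esub>"
    have q0: "q0 \<in> carrier Q" using rmod_homD(1)[OF \<psi>(1)] by (simp add: q0_def)
    have \<psi>q: "\<psi> r = q0 \<triangleleft>\<^bsub>Q\<^esub> r" if "r \<in> carrier R" for r
      using rmod_homD(3)[OF \<psi>(1), of "\<one>\<^bsub>R\<^esub>" r] that by (simp add: q0_def)
    have key: "p = q0 \<triangleleft>\<^bsub>Q\<^esub> r" if "r \<in> carrier R" "(x \<triangleleft>\<^bsub>N\<^esub> r, p) \<in> G" for r p
    proof -
      have "r \<in> A" using that by (auto simp: A_def)
      then show ?thesis using \<phi>[OF that(2)] \<psi>(2)[of r] \<psi>q[OF that(1)] by simp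
    qed
    define G' where "G' = {(y \<oplus>\<^bsub>N\<^esub> x \<triangleleft>\<^bsub>N\<^esub> r, q \<oplus>\<^bsub>Q\<^esub> q0 \<triangleleft>\<^bsub>Q\<^esub> r) | y q r. (y, q) \<in> G \<and> r \<in> carrier R}"
    have "G' \<in> \<Phi>"
      unfolding \<Phi>_def mem_Collect_eq
    proof (intro conjI allI impI ballI)
      show "G' \<subseteq> carrier N \<times> carrier Q" using G1 x q0 by (auto simp: G'_def)
      show GG: "?f \<subseteq> G'"
      proof
        fix z assume "z \<in> ?f"
        then obtain u where "u \<in> U" "z = (u, f u)" by auto
        then show "z \<in> G'" using G2[of u] G1[OF G2[of u]] x q0
          unfolding G'_def by (force intro!: exI[of _ u] exI[of _ "f u"] exI[of _ "\<zero>\<^bsub>R\<^esub>"])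
      qed
    next
      fix a p b q assume "(a, p) \<in> G'" "(b, q) \<in> G'"
      then obtain y u r z v s where *: "(y, u) \<in> G" "r \<in> carrier R" "(z, v) \<in> G" "s \<in> carrier R"
        "a = y \<oplus>\<^bsub>N\<^esub> x \<triangleleft>\<^bsub>N\<^esub> r" "p = u \<oplus>\<^bsub>Q\<^esub> q0 \<triangleleft>\<^bsub>Q\<^esub> r"
        "b = z \<oplus>\<^bsub>N\<^esub> x \<triangleleft>\<^bsub>N\<^esub> s" "q = v \<oplus>\<^bsub>Q\<^esub> q0 \<triangleleft>\<^bsub>Q\<^esub> s"
        by (auto simp: G'_def)
      then have "a \<oplus>\<^bsub>N\<^esub> b = (y \<oplus>\<^bsub>N\<^esub> z) \<oplus>\<^bsub>N\<^esub> x \<triangleleft>\<^bsub>N\<^esub> (r \<oplus>\<^bsub>R\<^esub> s)"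
        "p \<oplus>\<^bsub>Q\<^esub> q = (u \<oplus>\<^bsub>Q\<^esub> v) \<oplus>\<^bsub>Q\<^esub> q0 \<triangleleft>\<^bsub>Q\<^esub> (r \<oplus>\<^bsub>R\<^esub> s)"
        using G1 x q0 by (simp_all add: N.ract_r_distr Q.ract_r_distr N.M.add.m_ac Q.M.add.m_ac)
      then show "(a \<oplus>\<^bsub>N\<^esub> b, p \<oplus>\<^bsub>Q\<^esub> q) \<in> G'"
        using * G3[OF *(1) *(3)] unfolding G'_def by blast
    next
      fix a p t assume "(a, p) \<in> G'" and t: "t \<in> carrier R"
      then obtain y u r where *: "(y, u) \<in> G" "r \<in> carrier R"
        "a = y \<oplus>\<^bsub>N\<^esub> x \<triangleleft>\<^bsub>N\<^esub> r" "p = u \<oplus>\<^bsub>Q\<^esub> q0 \<triangleleft>\<^bsub>Q\<^esub> r"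
        by (auto simp: G'_def)
      then have "a \<triangleleft>\<^bsub>N\<^esub> t = y \<triangleleft>\<^bsub>N\<^esub> t \<oplus>\<^bsub>N\<^esub> x \<triangleleft>\<^bsub>N\<^esub> (r \<otimes>\<^bsub>R\<^esub> t)"
        "p \<triangleleft>\<^bsub>Q\<^esub> t = u \<triangleleft>\<^bsub>Q\<^esub> t \<oplus>\<^bsub>Q\<^esub> q0 \<triangleleft>\<^bsub>Q\<^esub> (r \<otimes>\<^bsub>R\<^esub> t)"
        using G1 x q0 t by (simp_all add: N.ract_l_distr Q.ract_l_distr N.ract_assoc Q.ract_assoc)
      then show "(a \<triangleleft>\<^bsub>N\<^esub> t, p \<triangleleft>\<^bsub>Q\<^esub> t) \<in> G'"
        using * t G4[OF *(1) t] unfolding G'_def by blast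
    next
      fix a p q assume "(a, p) \<in> G'" "(a, q) \<in> G'"
      then obtain y u r z v s where *: "(y, u) \<in> G" "r \<in> carrier R" "(z, v) \<in> G" "s \<in> carrier R"
        "a = y \<oplus>\<^bsub>N\<^esub> x \<triangleleft>\<^bsub>N\<^esub> r" "p = u \<oplus>\<^bsub>Q\<^esub> q0 \<triangleleft>\<^bsub>Q\<^esub> r"
        "a = z \<oplus>\<^bsub>N\<^esub> x \<triangleleft>\<^bsub>N\<^esub> s" "q = v \<oplus>\<^bsub>Q\<^esub> q0 \<triangleleft>\<^bsub>Q\<^esub> s"
        by (auto simp: G'_def)
      note c = G1[OF *(1)] G1[OF *(3)] *(2,4) x q0
      let ?d = "r \<oplus>\<^bsub>R\<^esub> (\<ominus>\<^bsub>R\<^esub> s)"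
      have e1: "x \<triangleleft>\<^bsub>N\<^esub> ?d = z \<oplus>\<^bsub>N\<^esub> y \<triangleleft>\<^bsub>N\<^esub> (\<ominus>\<^bsub>R\<^esub> \<one>\<^bsub>R\<^esub>)"
      proof -
        have "x \<triangleleft>\<^bsub>N\<^esub> r = (\<ominus>\<^bsub>N\<^esub> y) \<oplus>\<^bsub>N\<^esub> (y \<oplus>\<^bsub>N\<^esub> x \<triangleleft>\<^bsub>N\<^esub> r)" using c by (simp add: N.r_neg1)
        also have "\<dots> = (\<ominus>\<^bsub>N\<^esub> y) \<oplus>\<^bsub>N\<^esub> (z \<oplus>\<^bsub>N\<^esub> x \<triangleleft>\<^bsub>N\<^esub> s)" using *(5,7) by simp
        finally have "x \<triangleleft>\<^bsub>N\<^esub> ?d = ((\<ominus>\<^bsub>N\<^esub> y) \<oplus>\<^bsub>N\<^esub> (z \<oplus>\<^bsub>N\<^esub> x \<triangleleft>\<^bsub>N\<^esub> s)) \<oplus>\<^bsub>N\<^esub> (\<ominus>\<^bsub>N\<^esub> (x \<triangleleft>\<^bsub>N\<^esub> s))"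
          using c by (simp add: N.ract_r_distr N.ract_r_minus)
        also have "\<dots> = (z \<oplus>\<^bsub>N\<^esub> (\<ominus>\<^bsub>N\<^esub> y)) \<oplus>\<^bsub>N\<^esub> (x \<triangleleft>\<^bsub>N\<^esub> s \<oplus>\<^bsub>N\<^esub> (\<ominus>\<^bsub>N\<^esub> (x \<triangleleft>\<^bsub>N\<^esub> s)))"
          using c by (simp only: N.M.add.m_ac N.M.a_inv_closed N.ract_closed N.M.add.m_closed)
        finally show ?thesis using c by (simp add: N.minus_ract[symmetric] N.M.r_neg)
      qed
      have "(x \<triangleleft>\<^bsub>N\<^esub> ?d, v \<oplus>\<^bsub>Q\<^esub> u \<triangleleft>\<^bsub>Q\<^esub> (\<ominus>\<^bsub>R\<^esub> \<one>\<^bsub>R\<^esub>)) \<in> G"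
        unfolding e1 using G3[OF *(3) G4[OF *(1)]] by simp
      then have "v \<oplus>\<^bsub>Q\<^esub> u \<triangleleft>\<^bsub>Q\<^esub> (\<ominus>\<^bsub>R\<^esub> \<one>\<^bsub>R\<^esub>) = q0 \<triangleleft>\<^bsub>Q\<^esub> ?d"
        using key[of ?d] c by simp
      then have e2: "v \<oplus>\<^bsub>Q\<^esub> (\<ominus>\<^bsub>Q\<^esub> u) = q0 \<triangleleft>\<^bsub>Q\<^esub> r \<oplus>\<^bsub>Q\<^esub> (\<ominus>\<^bsub>Q\<^esub> (q0 \<triangleleft>\<^bsub>Q\<^esub> s))"
        using c by (simp add: Q.ract_r_distr Q.ract_r_minus Q.minus_ract[symmetric])
      have "p = u \<oplus>\<^bsub>Q\<^esub> ((q0 \<triangleleft>\<^bsub>Q\<^esub> r \<oplus>\<^bsub>Q\<^esub> (\<ominus>\<^bsub>Q\<^esub> (q0 \<triangleleft>\<^bsub>Q\<^esub> s))) \<oplus>\<^bsub>Q\<^esub> q0 \<triangleleft>\<^bsub>Q\<^esub> s)"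
        using c by (simp add: * Q.M.add.m_assoc Q.M.l_neg)
      also have "\<dots> = u \<oplus>\<^bsub>Q\<^esub> ((v \<oplus>\<^bsub>Q\<^esub> (\<ominus>\<^bsub>Q\<^esub> u)) \<oplus>\<^bsub>Q\<^esub> q0 \<triangleleft>\<^bsub>Q\<^esub> s)" by (simp add: e2)
      also have "\<dots> = (u \<oplus>\<^bsub>Q\<^esub> (\<ominus>\<^bsub>Q\<^esub> u)) \<oplus>\<^bsub>Q\<^esub> (v \<oplus>\<^bsub>Q\<^esub> q0 \<triangleleft>\<^bsub>Q\<^esub> s)"
        using c by (simp only: Q.M.add.m_ac Q.M.a_inv_closed Q.ract_closed Q.M.add.m_closed)
      also have "\<dots> = q" using c by (simp add: * Q.M.r_neg)
      finally show "p = q" .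
    qed
    moreover have "G \<subseteq> G'"
    proof
      fix z assume z: "z \<in> G"
      obtain y q where "z = (y, q)" by (cases z)
      then show "z \<in> G'" using z G1[of y q] x q0
        unfolding G'_def by (force intro!: exI[of _ y] exI[of _ q] exI[of _ "\<zero>\<^bsub>R\<^esub>"])
    qed
    ultimately have "G' = G" by (rule max)
    moreover have "(\<zero>\<^bsub>N\<^esub> \<oplus>\<^bsub>N\<^esub> x \<triangleleft>\<^bsub>N\<^esub> \<one>\<^bsub>R\<^esub>, \<zero>\<^bsub>Q\<^esub> \<oplus>\<^bsub>Q\<^esub> q0 \<triangleleft>\<^bsub>Q\<^esub> \<one>\<^bsub>R\<^esub>) \<in> G'"
      using G0 unfolding G'_def by blast
    ultimately show ?thesis using x q0 by auto
  qed
  define g where "g x = (THE q. (x, q) \<in> G)" for x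
  have g: "g x = q" if "(x, q) \<in> G" for x q
    unfolding g_def using that G5 by blast
  have gG: "(x, g x) \<in> G" if "x \<in> carrier N" for x
    using total[OF that] g by auto
  have "g \<in> rmod_hom R N Q"
    unfolding rmod_hom_def using gG G1 g[OF G3[OF gG gG]] g[OF G4[OF gG]] by blast
  moreover have "\<forall>x\<in>U. g x = f x" using g G2 by blast
  ultimately show "\<exists>g\<in>rmod_hom R N Q. \<forall>x\<in>U. g x = f x" by blast
qed

lemma rmod_hom_finsum:
  assumes "right_module R M" "right_module R N" "f \<in> rmod_hom R M N"
    "finite I" "\<And>i. i \<in> I \<Longrightarrow> u i \<in> carrier M"
  shows "f (finsum M u I) = finsum N (\<lambda>i. f (u i)) I"
proof -
  interpret M: right_module R M by fact
  interpret N: right_module R N by fact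
  note D = rmod_homD[OF assms(3)]
  show ?thesis using assms(4,5)
  proof (induction I)
    case empty
    then show ?case using rmod_hom_zero[OF assms(1-3)] by simp
  next
    case (insert i I)
    then have c: "u \<in> I \<rightarrow> carrier M" "u i \<in> carrier M" "(\<lambda>i. f (u i)) \<in> I \<rightarrow> carrier N" "f (u i) \<in> carrier N"
      using D by auto
    show ?case using insert c D by (simp add: M.M.finsum_insert N.M.finsum_insert M.M.finsum_closed)
  qed
qed

definition free_module :: "('a, 'r) ring_scheme \<Rightarrow> 'p set \<Rightarrow> ('a, 'p \<Rightarrow> 'a) rmodule"
  where "free_module R B =
    \<lparr> carrier = {a. (\<forall>p. a p \<in> carrier R) \<and> {p. a p \<noteq> \<zero>\<^bsub>R\<^esub>} \<subseteq> B \<and> finite {p. a p \<noteq> \<zero>\<^bsub>R\<^esub>}},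
      mult = undefined, one = undefined, zero = (\<lambda>_. \<zero>\<^bsub>R\<^esub>), add = (\<lambda>a b p. a p \<oplus>\<^bsub>R\<^esub> b p),
      ract = (\<lambda>a r p. a p \<otimes>\<^bsub>R\<^esub> r) \<rparr>"

lemma right_module_free:
  assumes "ring R" shows "right_module R (free_module R B)"
proof -
  interpret ring R by fact
  let ?F = "free_module R B"
  have add: "(\<lambda>p. a p \<oplus>\<^bsub>R\<^esub> b p) \<in> carrier ?F" if "a \<in> carrier ?F" "b \<in> carrier ?F" for a b
  proof -
    have sub: "{p. a p \<oplus>\<^bsub>R\<^esub> b p \<noteq> \<zero>\<^bsub>R\<^esub>} \<subseteq> {p. a p \<noteq> \<zero>\<^bsub>R\<^esub>} \<union> {p. b p \<noteq> \<zero>\<^bsub>R\<^esub>}" by auto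
    then have "finite {p. a p \<oplus>\<^bsub>R\<^esub> b p \<noteq> \<zero>\<^bsub>R\<^esub>}"
      by (rule finite_subset) (use that in \<open>simp add: free_module_def\<close>)
    moreover have "{p. a p \<noteq> \<zero>\<^bsub>R\<^esub>} \<union> {p. b p \<noteq> \<zero>\<^bsub>R\<^esub>} \<subseteq> B" using that by (simp add: free_module_def)
    ultimately have "{p. a p \<oplus>\<^bsub>R\<^esub> b p \<noteq> \<zero>\<^bsub>R\<^esub>} \<subseteq> B" "finite {p. a p \<oplus>\<^bsub>R\<^esub> b p \<noteq> \<zero>\<^bsub>R\<^esub>}"
      using sub by (blast, simp)
    then show ?thesis using that by (simp add: free_module_def)
  qed
  have act: "(\<lambda>p. a p \<otimes>\<^bsub>R\<^esub> r) \<in> carrier ?F" if "a \<in> carrier ?F" "r \<in> carrier R" for a r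
  proof -
    have "{p. a p \<otimes>\<^bsub>R\<^esub> r \<noteq> \<zero>\<^bsub>R\<^esub>} \<subseteq> {p. a p \<noteq> \<zero>\<^bsub>R\<^esub>}" using that by auto
    then have "finite {p. a p \<otimes>\<^bsub>R\<^esub> r \<noteq> \<zero>\<^bsub>R\<^esub>}"
      by (rule finite_subset) (use that in \<open>simp add: free_module_def\<close>)
    moreover have "{p. a p \<otimes>\<^bsub>R\<^esub> r \<noteq> \<zero>\<^bsub>R\<^esub>} \<subseteq> B" using that by (auto simp: free_module_def)
    ultimately show ?thesis using that by (simp add: free_module_def)
  qed
  have mem: "a p \<in> carrier R" if "a \<in> carrier ?F" for a p
    using that by (simp add: free_module_def)
  have S: "a \<oplus>\<^bsub>?F\<^esub> b = (\<lambda>p. a p \<oplus>\<^bsub>R\<^esub> b p)" "a \<triangleleft>\<^bsub>?F\<^esub> r = (\<lambda>p. a p \<otimes>\<^bsub>R\<^esub> r)" "\<zero>\<^bsub>?F\<^esub> = (\<lambda>p. \<zero>\<^bsub>R\<^esub>)"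
    for a b r by (simp_all add: free_module_def)
  have ag: "abelian_group ?F"
  proof (rule abelian_groupI)
    show "\<zero>\<^bsub>?F\<^esub> \<in> carrier ?F" by (simp add: free_module_def)
    fix a assume a: "a \<in> carrier ?F"
    then show "\<exists>b\<in>carrier ?F. b \<oplus>\<^bsub>?F\<^esub> a = \<zero>\<^bsub>?F\<^esub>"
      using act[OF a, of "\<ominus>\<^bsub>R\<^esub> \<one>\<^bsub>R\<^esub>"] mem[OF a]
      by (intro bexI[of _ "\<lambda>p. a p \<otimes>\<^bsub>R\<^esub> (\<ominus>\<^bsub>R\<^esub> \<one>\<^bsub>R\<^esub>)"]) (simp_all add: S r_minus l_neg)
  qed (simp_all add: S add mem add.m_ac)
  show ?thesis
    by (rule right_moduleI)
      (simp_all add: S act mem l_distr r_distr m_assoc ag assms)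
qed

definition free_extension ::
    "('a, 'r) ring_scheme \<Rightarrow> ('a, 'm) rmodule \<Rightarrow> ('p \<Rightarrow> 'm) \<Rightarrow> ('p \<Rightarrow> 'a) \<Rightarrow> 'm"
  where "free_extension R M k a = finsum M (\<lambda>p. k p \<triangleleft>\<^bsub>M\<^esub> a p) {p. a p \<noteq> \<zero>\<^bsub>R\<^esub>}"

lemma free_extension_hom:
  assumes "right_module R M" "\<And>p. p \<in> B \<Longrightarrow> k p \<in> carrier M"
  shows "free_extension R M k \<in> rmod_hom R (free_module R B) M"
proof -
  interpret right_module R M by fact
  let ?F = "free_module R B"
  interpret F: right_module R ?F by (rule right_module_free) (rule R.ring_axioms)
  let ?s = "\<lambda>a. {p. a p \<noteq> \<zero>\<^bsub>R\<^esub>}"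
  have mem: "a p \<in> carrier R" if "a \<in> carrier ?F" for a p
    using that by (simp add: free_module_def)
  have sub: "?s a \<subseteq> B" "finite (?s a)" if "a \<in> carrier ?F" for a
    using that by (simp_all add: free_module_def)
  have big: "free_extension R M k a = finsum M (\<lambda>p. k p \<triangleleft>\<^bsub>M\<^esub> a p) I"
    if "a \<in> carrier ?F" "finite I" "?s a \<subseteq> I" "I \<subseteq> B" for a I
    unfolding free_extension_def
    by (rule M.add.finprod_mono_neutral_cong_left)
      (use that assms(2) mem[OF that(1)] in \<open>auto\<close>)
  have S: "a \<oplus>\<^bsub>?F\<^esub> b = (\<lambda>p. a p \<oplus>\<^bsub>R\<^esub> b p)" "a \<triangleleft>\<^bsub>?F\<^esub> r = (\<lambda>p. a p \<otimes>\<^bsub>R\<^esub> r)" for a b r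
    by (simp_all add: free_module_def)
  show ?thesis
    unfolding rmod_hom_def mem_Collect_eq
  proof (intro conjI ballI funcsetI)
    fix a assume a: "a \<in> carrier ?F"
    have cl: "(\<lambda>p. k p \<triangleleft>\<^bsub>M\<^esub> a p) \<in> ?s a \<rightarrow> carrier M" using sub[OF a] mem[OF a] assms(2) by auto
    show "free_extension R M k a \<in> carrier M"
      unfolding free_extension_def by (rule M.finsum_closed[OF cl])
    show "free_extension R M k (a \<triangleleft>\<^bsub>?F\<^esub> r) = free_extension R M k a \<triangleleft>\<^bsub>M\<^esub> r" if r: "r \<in> carrier R" for r
    proof -
      have h: "(\<lambda>x. x \<triangleleft>\<^bsub>M\<^esub> r) (finsum M u I) = finsum M (\<lambda>i. u i \<triangleleft>\<^bsub>M\<^esub> r) I"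
        if "finite I" "u \<in> I \<rightarrow> carrier M" for I u
        using that
      proof (induction I)
        case (insert i I)
        then have "(\<lambda>i. u i \<triangleleft>\<^bsub>M\<^esub> r) \<in> I \<rightarrow> carrier M" "u \<in> I \<rightarrow> carrier M" "u i \<in> carrier M" using r by auto
        then show ?case using insert r by (simp add: ract_l_distr)
      qed (simp add: r)
      have "free_extension R M k (a \<triangleleft>\<^bsub>?F\<^esub> r) = finsum M (\<lambda>p. k p \<triangleleft>\<^bsub>M\<^esub> (a p \<otimes>\<^bsub>R\<^esub> r)) (?s a)"
        using big[OF F.ract_closed[OF a r] sub(2)[OF a] _ sub(1)[OF a]] mem[OF a] r
        by (force simp: S)
      also have "\<dots> = finsum M (\<lambda>p. (k p \<triangleleft>\<^bsub>M\<^esub> a p) \<triangleleft>\<^bsub>M\<^esub> r) (?s a)"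
        by (rule M.finsum_cong') (use sub[OF a] assms(2) mem[OF a] r in \<open>auto simp: ract_assoc\<close>)
      also have "\<dots> = free_extension R M k a \<triangleleft>\<^bsub>M\<^esub> r"
        unfolding free_extension_def using h[OF sub(2)[OF a] cl] by simp
      finally show ?thesis .
    qed
    fix b assume b: "b \<in> carrier ?F"
    let ?I = "?s a \<union> ?s b"
    have I: "finite ?I" "?I \<subseteq> B" using sub a b by auto
    have "free_extension R M k (a \<oplus>\<^bsub>?F\<^esub> b) = finsum M (\<lambda>p. k p \<triangleleft>\<^bsub>M\<^esub> (a p \<oplus>\<^bsub>R\<^esub> b p)) ?I"
    proof -
      have "?s (\<lambda>p. a p \<oplus>\<^bsub>R\<^esub> b p) \<subseteq> ?I" by auto
      then show ?thesis using big[OF F.M.add.m_closed[simplified, OF a b] I(1) _ I(2)] by (simp only: S)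
    qed
    also have "\<dots> = finsum M (\<lambda>p. k p \<triangleleft>\<^bsub>M\<^esub> a p \<oplus>\<^bsub>M\<^esub> k p \<triangleleft>\<^bsub>M\<^esub> b p) ?I"
      by (rule M.finsum_cong') (use I(2) assms(2) mem[OF a] mem[OF b] in \<open>auto simp: ract_r_distr\<close>)
    also have "\<dots> = finsum M (\<lambda>p. k p \<triangleleft>\<^bsub>M\<^esub> a p) ?I \<oplus>\<^bsub>M\<^esub> finsum M (\<lambda>p. k p \<triangleleft>\<^bsub>M\<^esub> b p) ?I"
      by (rule M.finsum_addf) (use I(2) assms(2) mem[OF a] mem[OF b] in auto)
    also have "\<dots> = free_extension R M k a \<oplus>\<^bsub>M\<^esub> free_extension R M k b"
      using big[OF a I(1) _ I(2)] big[OF b I(1) _ I(2)] by auto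
    finally show "free_extension R M k (a \<oplus>\<^bsub>?F\<^esub> b) = free_extension R M k a \<oplus>\<^bsub>M\<^esub> free_extension R M k b" .
  qed
qed

lemma projective_module_universal:
  fixes P :: "('a, 'p) rmodule" and N :: "('a, 'n) rmodule" and L :: "('a, 'l) rmodule"
  assumes "right_module R P" "projective_module R P" "right_module R N" "right_module R L"
    and g: "g \<in> rmod_hom R N L" "g ` carrier N = carrier L" and f: "f \<in> rmod_hom R P L"
  shows "\<exists>h\<in>rmod_hom R P N. \<forall>x\<in>carrier P. g (h x) = f x"
proof -
  note ringR = right_module.axioms(1)[OF assms(1)]
  interpret R: ring R by (rule ringR)
  interpret P: right_module R P by fact
  interpret N: right_module R N by fact
  interpret L: right_module R L by fact
  let ?F = "free_module R (carrier P)"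
  interpret F: right_module R ?F by (rule right_module_free) (rule ringR)
  note gD = rmod_homD[OF g(1)] and fD = rmod_homD[OF f]
  let ?\<pi> = "free_extension R P (\<lambda>x. x)"
  have \<pi>: "?\<pi> \<in> rmod_hom R ?F P" by (rule free_extension_hom[OF assms(1)])
  have "x \<in> ?\<pi> ` carrier ?F" if x: "x \<in> carrier P" for x
  proof (cases "\<one>\<^bsub>R\<^esub> = \<zero>\<^bsub>R\<^esub>")
    case True
    then have "x = \<zero>\<^bsub>P\<^esub>" using P.ract_one[OF x] P.ract_r_zero[OF x] by simp
    then show ?thesis using rmod_hom_zero[OF F.right_module_axioms assms(1) \<pi>] F.M.zero_closed
      by (metis image_eqI)
  next
    case False
    let ?d = "\<lambda>p. if p = x then \<one>\<^bsub>R\<^esub> else \<zero>\<^bsub>R\<^esub>"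
    have s: "{p. ?d p \<noteq> \<zero>\<^bsub>R\<^esub>} = {x}" using False by auto
    have "?d \<in> carrier ?F" using x by (auto simp: free_module_def)
    moreover have "?\<pi> ?d = x" unfolding free_extension_def s using x by simp
    ultimately show ?thesis by (metis image_eqI)
  qed
  then have surj: "?\<pi> ` carrier ?F = carrier P" using rmod_homD(1)[OF \<pi>] by auto
  have "(\<lambda>x. x) \<in> rmod_hom R P P" by (simp add: rmod_hom_def)
  then obtain \<sigma> where \<sigma>: "\<sigma> \<in> rmod_hom R P ?F" "\<And>x. x \<in> carrier P \<Longrightarrow> ?\<pi> (\<sigma> x) = x"
    using assms(2) surj \<pi> assms(1) F.right_module_axioms unfolding projective_module_def by blast
  have "\<forall>p\<in>carrier P. \<exists>y\<in>carrier N. g y = f p"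
  proof
    fix p assume "p \<in> carrier P"
    then have "f p \<in> g ` carrier N" using fD(1) g(2) by simp
    then show "\<exists>y\<in>carrier N. g y = f p" by (metis imageE)
  qed
  then obtain k where k: "\<And>p. p \<in> carrier P \<Longrightarrow> k p \<in> carrier N" "\<And>p. p \<in> carrier P \<Longrightarrow> g (k p) = f p"
    by metis
  have K: "free_extension R N k \<in> rmod_hom R ?F N" by (rule free_extension_hom[OF assms(3) k(1)])
  have eq: "g (free_extension R N k a) = f (?\<pi> a)" if a: "a \<in> carrier ?F" for a
  proof -
    let ?s = "{p. a p \<noteq> \<zero>\<^bsub>R\<^esub>}"
    have A: "?s \<subseteq> carrier P" "finite ?s" "\<And>p. a p \<in> carrier R" using a by (auto simp: free_module_def)
    have "g (free_extension R N k a) = finsum L (\<lambda>p. g (k p \<triangleleft>\<^bsub>N\<^esub> a p)) ?s"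
      unfolding free_extension_def using A k
      by (intro rmod_hom_finsum[OF assms(3,4) g(1)]) auto
    also have "\<dots> = finsum L (\<lambda>p. f (p \<triangleleft>\<^bsub>P\<^esub> a p)) ?s"
      by (rule L.M.finsum_cong') (use A k gD fD in auto)
    also have "\<dots> = f (?\<pi> a)"
      unfolding free_extension_def using A
      by (intro rmod_hom_finsum[OF assms(1,4) f, symmetric]) auto
    finally show ?thesis .
  qed
  have "(\<lambda>x. free_extension R N k (\<sigma> x)) \<in> rmod_hom R P N"
    using rmod_homD[OF K] rmod_homD[OF \<sigma>(1)] by (simp add: rmod_hom_def)
  moreover have "\<forall>x\<in>carrier P. g (free_extension R N k (\<sigma> x)) = f x"
    using eq \<sigma> rmod_homD(1)[OF \<sigma>(1)] by simp
  ultimately show ?thesis by (intro bexI[of _ "\<lambda>x. free_extension R N k (\<sigma> x)"])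
qed

lemma cyclic_iso_quotient:
  assumes "right_module R M" "cyclic_module R M"
  shows "\<exists>A. right_ideal R A \<and> rmod_isomorphic R (quotient_module (regular_module R) A) M"
proof -
  note ringR = right_module.axioms(1)[OF assms(1)]
  interpret R: ring R by (rule ringR)
  interpret M: right_module R M by fact
  let ?R = "regular_module R"
  interpret RR: right_module R ?R by (rule right_module_regular) (rule ringR)
  obtain x where x: "x \<in> carrier M" "carrier M = (\<lambda>r. x \<triangleleft>\<^bsub>M\<^esub> r) ` carrier R"
    using assms(2) by (auto simp: cyclic_module_def)
  define A where "A = {r \<in> carrier R. x \<triangleleft>\<^bsub>M\<^esub> r = \<zero>\<^bsub>M\<^esub>}"
  have A: "rsubmodule R ?R A"
    by (rule RR.rsubmoduleI) (use x(1) in \<open>auto simp: A_def M.ract_r_distr M.ract_assoc\<close>)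
  let ?Q = "quotient_module ?R A"
  let ?f = "\<lambda>X. the_elem ((\<lambda>r. x \<triangleleft>\<^bsub>M\<^esub> r) ` X)"
  have car: "carrier ?Q = (\<lambda>r. A +>\<^bsub>?R\<^esub> r) ` carrier R"
    by (auto simp: quotient_module_def A_RCOSETS_def')
  have cos: "A +>\<^bsub>?R\<^esub> r = {a \<oplus>\<^bsub>R\<^esub> r | a. a \<in> A}" for r
    by (auto simp: a_r_coset_def')
  have sub: "subgroup A (add_monoid ?R)" using A by (simp add: rsubmodule_def)
  have val: "?f (A +>\<^bsub>?R\<^esub> r) = x \<triangleleft>\<^bsub>M\<^esub> r" if r: "r \<in> carrier R" for r
  proof -
    have "(\<lambda>r. x \<triangleleft>\<^bsub>M\<^esub> r) ` (A +>\<^bsub>?R\<^esub> r) = {x \<triangleleft>\<^bsub>M\<^esub> r}"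
    proof -
      have e: "x \<triangleleft>\<^bsub>M\<^esub> (a \<oplus>\<^bsub>R\<^esub> r) = x \<triangleleft>\<^bsub>M\<^esub> r" if "a \<in> A" for a
        using that r x(1) by (simp add: A_def M.ract_r_distr)
      have z: "\<zero>\<^bsub>R\<^esub> \<in> A" using RR.rsubmoduleD(1)[OF A] by simp
      have "(\<lambda>r. x \<triangleleft>\<^bsub>M\<^esub> r) ` (A +>\<^bsub>?R\<^esub> r) = (\<lambda>a. x \<triangleleft>\<^bsub>M\<^esub> (a \<oplus>\<^bsub>R\<^esub> r)) ` A" unfolding cos by auto
      also have "\<dots> = (\<lambda>a. x \<triangleleft>\<^bsub>M\<^esub> r) ` A" using e by (rule image_cong[OF refl])
      also have "\<dots> = {x \<triangleleft>\<^bsub>M\<^esub> r}" using z by auto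
      finally show ?thesis .
    qed
    then show ?thesis by simp
  qed
  interpret Z: abelian_subgroup A ?R
    using sub by (intro abelian_subgroupI3)
      (auto simp: additive_subgroup_def intro: RR.M.abelian_group_axioms)
  have add: "(A +>\<^bsub>?R\<^esub> r) \<oplus>\<^bsub>?Q\<^esub> (A +>\<^bsub>?R\<^esub> s) = A +>\<^bsub>?R\<^esub> (r \<oplus>\<^bsub>R\<^esub> s)"
    if "r \<in> carrier R" "s \<in> carrier R" for r s
    using that Z.a_rcos_sum[of r s] by (simp add: quotient_module_def)
  have act: "(A +>\<^bsub>?R\<^esub> r) \<triangleleft>\<^bsub>?Q\<^esub> s = A +>\<^bsub>?R\<^esub> (r \<otimes>\<^bsub>R\<^esub> s)"
    if "r \<in> carrier R" "s \<in> carrier R" for r s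
    using RR.quotient_ract[OF A, of r s] that by simp
  have "?f \<in> rmod_hom R ?Q M"
    unfolding rmod_hom_def mem_Collect_eq
  proof (intro conjI ballI funcsetI)
    fix X assume "X \<in> carrier ?Q"
    then obtain r where r: "r \<in> carrier R" "X = A +>\<^bsub>?R\<^esub> r" by (auto simp: car)
    show "?f X \<in> carrier M" using r x(1) by (simp add: val)
    show "?f (X \<triangleleft>\<^bsub>?Q\<^esub> s) = ?f X \<triangleleft>\<^bsub>M\<^esub> s" if "s \<in> carrier R" for s
      using r x(1) that by (simp add: val act M.ract_assoc)
    fix Y assume "Y \<in> carrier ?Q"
    then obtain s where s: "s \<in> carrier R" "Y = A +>\<^bsub>?R\<^esub> s" by (auto simp: car)
    show "?f (X \<oplus>\<^bsub>?Q\<^esub> Y) = ?f X \<oplus>\<^bsub>M\<^esub> ?f Y"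
      using r s x(1) by (simp add: val add M.ract_r_distr)
  qed
  moreover have "bij_betw ?f (carrier ?Q) (carrier M)"
  proof (rule bij_betwI')
    fix X Y assume "X \<in> carrier ?Q" "Y \<in> carrier ?Q"
    then obtain r s where rs: "r \<in> carrier R" "X = A +>\<^bsub>?R\<^esub> r" "s \<in> carrier R" "Y = A +>\<^bsub>?R\<^esub> s"
      by (auto simp: car)
    have "X = Y" if e: "x \<triangleleft>\<^bsub>M\<^esub> r = x \<triangleleft>\<^bsub>M\<^esub> s"
    proof -
      have "r \<oplus>\<^bsub>R\<^esub> (\<ominus>\<^bsub>R\<^esub> s) \<in> A"
        using rs x(1) e by (simp add: A_def M.ract_r_distr M.ract_r_minus M.M.r_neg)
      moreover have "r = (r \<oplus>\<^bsub>R\<^esub> (\<ominus>\<^bsub>R\<^esub> s)) \<oplus>\<^bsub>R\<^esub> s" using rs by (simp add: R.a_assoc R.l_neg)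
      ultimately have "r \<in> A +>\<^bsub>?R\<^esub> s" unfolding cos by blast
      then have "A +>\<^bsub>?R\<^esub> s = A +>\<^bsub>?R\<^esub> r"
        by (rule RR.M.a_repr_independence) (use rs sub in auto)
      then show ?thesis using rs by simp
    qed
    moreover have "?f X = x \<triangleleft>\<^bsub>M\<^esub> r" "?f Y = x \<triangleleft>\<^bsub>M\<^esub> s"
      using val[OF rs(1)] val[OF rs(3)] by (simp_all only: rs(2,4))
    ultimately show "(?f X = ?f Y) = (X = Y)" by metis
  next
    fix X assume "X \<in> carrier ?Q"
    then show "?f X \<in> carrier M" using x(1) by (auto simp: car val)
  next
    fix y assume "y \<in> carrier M"
    then show "\<exists>X\<in>carrier ?Q. y = ?f X" using x(2) val by (auto simp: car)
  qed
  ultimately have "rmod_isomorphic R ?Q M" unfolding rmod_isomorphic_def by (intro bexI[of _ ?f])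
  then show ?thesis using A by (auto simp: right_ideal_def)
qed

end

theory Submission
  imports Defs "HOL-Library.Nat_Bijection"
begin

text \<open>Over a V-ring the simple submodules of a quotient of \<open>M\<close> split off. If \<open>M\<close> is not noetherian, a
  strictly increasing sequence of submodules therefore yields maximal submodules whose intersection \<open>K\<close>
  has an infinite direct sum of simple modules in \<open>M/K\<close>. An argument of Osofsky and Smith excludes this
  when \<open>M\<close> is cyclic and its cyclic subfactors are CS or noetherian. Under the weaker condition
  \<open>property_star\<close> it still applies to quotients by essential submodules, since projective modules split off,
  and shows that \<open>M\<close> is noetherian modulo its socle. If the socle were infinite, a cyclic subfactor that is
  uniform modulo its infinite socle would be decomposed too far by \<open>property_star\<close>.

  For the ring decomposition, \<open>a \<in> a(RaR)\<close> holds for all \<open>a\<close> in a V-ring. If \<open>R\<close> is also right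
  noetherian, then it is right nonsingular, an ideal with zero right annihilator contains \<open>1\<close>, and every
  ideal is a direct factor of the ring. A WV-ring \<open>R\<close> either is not uniform, and then simple submodules of
  its quotients split off as well, or it is uniform, and then the Osofsky--Smith argument applies to \<open>R/A\<close> for
  all nonzero right ideals \<open>A\<close>.\<close>

section \<open>The lattice of submodules\<close>

text \<open>Quotients of quotients would live on ever larger types of cosets. Working with the
  interval between two submodules keeps all subfactors in one modular lattice, where the third
  isomorphism theorem is invisible and the second one is the isomorphism of the intervals
  \<open>[A \<inter> B, A]\<close> and \<open>[B, A \<boxplus> B]\<close>. Injectivity of simple
  modules enters only through \<open>simples_split_above\<close>, projectivity only through
  \<open>rel_star\<close>. The base \<open>Zb\<close> is a parameter because over a uniform WV-ring
  simple subfactors are shown to split only above nonzero right ideals. The obstacle is the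
  projective summand in \<open>property_star\<close>. It disappears for \<open>Y/Z\<close> with
  \<open>Z\<close> essential in \<open>Y\<close>, but enlarging a submodule \<open>K\<close> to an
  essential one \<open>K \<boxplus> C\<close> can swallow the simple modules over \<open>K\<close>,
  since \<open>C\<close> may contain copies of them. This is excluded when \<open>K\<close> contains
  the socle, which is why the chain condition is reached first modulo the socle and the finiteness
  of the socle needs its own argument.\<close>

context right_module
begin

abbreviation sub :: "'m set \<Rightarrow> bool"
  where "sub N \<equiv> rsubmodule R M N"

abbreviation sum_sub :: "'m set \<Rightarrow> 'm set \<Rightarrow> 'm set" (infixl "\<boxplus>" 65)
  where "A \<boxplus> B \<equiv> A <+>\<^bsub>M\<^esub> B"

lemma sum_memI: "a \<in> A \<Longrightarrow> b \<in> B \<Longrightarrow> a \<oplus>\<^bsub>M\<^esub> b \<in> A \<boxplus> B"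
  by (auto simp: set_add_def')

lemma sum_memE:
  assumes "x \<in> A \<boxplus> B"
  obtains a b where "a \<in> A" "b \<in> B" "x = a \<oplus>\<^bsub>M\<^esub> b"
  using assms by (auto simp: set_add_def')

lemma sub_carrier [simp]: "sub (carrier M)"
  by (rule rsubmoduleI) auto

lemma sub_zero [simp]: "sub {\<zero>\<^bsub>M\<^esub>}"
  by (rule rsubmoduleI) auto

lemma sub_mem: "sub N \<Longrightarrow> x \<in> N \<Longrightarrow> x \<in> carrier M"
  using rsubmodule_subset by blast

lemma sub_zero_le: "sub N \<Longrightarrow> {\<zero>\<^bsub>M\<^esub>} \<subseteq> N"
  using rsubmoduleD(1) by blast

lemma sub_Inter: "\<F> \<noteq> {} \<Longrightarrow> (\<And>N. N \<in> \<F> \<Longrightarrow> sub N) \<Longrightarrow> sub (\<Inter>\<F>)"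
  by (rule rsubmoduleI) (fastforce dest: rsubmodule_subset intro: rsubmoduleD)+

lemma sub_Int [simp]: "sub A \<Longrightarrow> sub B \<Longrightarrow> sub (A \<inter> B)"
  using sub_Inter[of "{A, B}"] by auto

lemma sub_chain_Union:
  assumes "\<F> \<noteq> {}" "\<And>N. N \<in> \<F> \<Longrightarrow> sub N" "\<And>A B. A \<in> \<F> \<Longrightarrow> B \<in> \<F> \<Longrightarrow> A \<subseteq> B \<or> B \<subseteq> A"
  shows "sub (\<Union>\<F>)"
proof (rule rsubmoduleI)
  fix x y assume "x \<in> \<Union>\<F>" "y \<in> \<Union>\<F>"
  then obtain A B where AB: "A \<in> \<F>" "B \<in> \<F>" "x \<in> A" "y \<in> B" by blast
  then have "\<exists>C\<in>\<F>. x \<in> C \<and> y \<in> C" using assms(3) by blast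
  then show "x \<oplus>\<^bsub>M\<^esub> y \<in> \<Union>\<F>" using assms(2) rsubmoduleD(2) by blast
next
  show "\<Union>\<F> \<subseteq> carrier M" using assms(2) rsubmodule_subset by blast
  show "\<zero>\<^bsub>M\<^esub> \<in> \<Union>\<F>" using assms(1,2) rsubmoduleD(1) by blast
  show "x \<triangleleft>\<^bsub>M\<^esub> r \<in> \<Union>\<F>" if "x \<in> \<Union>\<F>" "r \<in> carrier R" for x r
    using that assms(2) rsubmoduleD(3) by blast
qed

lemma sub_incseq_Union:
  fixes N :: "nat \<Rightarrow> 'm set"
  assumes "\<And>n. sub (N n)" "mono N"
  shows "sub (\<Union>n. N n)"
proof -
  have "N a \<subseteq> N b \<or> N b \<subseteq> N a" for a b
    using assms(2) by (metis monoD nat_le_linear)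
  then show ?thesis by (intro sub_chain_Union) (use assms in auto)
qed

lemma sub_sum [simp]:
  assumes A: "sub A" and B: "sub B"
  shows "sub (A \<boxplus> B)"
proof (rule rsubmoduleI)
  note a = rsubmoduleD[OF A] sub_mem[OF A] and b = rsubmoduleD[OF B] sub_mem[OF B]
  show "A \<boxplus> B \<subseteq> carrier M" using a b by (auto elim!: sum_memE)
  show "\<zero>\<^bsub>M\<^esub> \<in> A \<boxplus> B" using sum_memI[OF a(1) b(1)] by simp
  show "x \<triangleleft>\<^bsub>M\<^esub> r \<in> A \<boxplus> B" if "x \<in> A \<boxplus> B" "r \<in> carrier R" for x r
    using that a b by (auto elim!: sum_memE simp: ract_l_distr intro!: sum_memI)
  fix x y assume "x \<in> A \<boxplus> B" "y \<in> A \<boxplus> B"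
  then obtain c d e f where *: "c \<in> A" "d \<in> B" "x = c \<oplus>\<^bsub>M\<^esub> d" "e \<in> A" "f \<in> B" "y = e \<oplus>\<^bsub>M\<^esub> f"
    by (auto elim!: sum_memE)
  then have "x \<oplus>\<^bsub>M\<^esub> y = (c \<oplus>\<^bsub>M\<^esub> e) \<oplus>\<^bsub>M\<^esub> (d \<oplus>\<^bsub>M\<^esub> f)"
    using a b by (simp add: M.add.m_ac)
  then show "x \<oplus>\<^bsub>M\<^esub> y \<in> A \<boxplus> B" using * a b by (auto intro!: sum_memI)
qed

lemma sum_comm: "sub A \<Longrightarrow> sub B \<Longrightarrow> A \<boxplus> B = B \<boxplus> A"
  by (auto elim!: sum_memE) (metis M.a_comm sub_mem sum_memI)+

lemma sum_upper1: "sub A \<Longrightarrow> sub B \<Longrightarrow> A \<subseteq> A \<boxplus> B"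
proof
  fix x assume "sub A" "sub B" "x \<in> A"
  then show "x \<in> A \<boxplus> B" using sum_memI[of x A "\<zero>\<^bsub>M\<^esub>" B] by (simp add: rsubmoduleD sub_mem)
qed

lemma sum_upper2: "sub A \<Longrightarrow> sub B \<Longrightarrow> B \<subseteq> A \<boxplus> B"
  using sum_upper1 sum_comm by metis

lemma sum_least: "sub C \<Longrightarrow> A \<subseteq> C \<Longrightarrow> B \<subseteq> C \<Longrightarrow> A \<boxplus> B \<subseteq> C"
  by (auto elim!: sum_memE intro: rsubmoduleD)

lemma sum_le_iff: "sub A \<Longrightarrow> sub B \<Longrightarrow> sub C \<Longrightarrow> A \<boxplus> B \<subseteq> C \<longleftrightarrow> A \<subseteq> C \<and> B \<subseteq> C"
  by (meson sum_least sum_upper1 sum_upper2 subset_trans)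

lemma sum_mono: "A \<subseteq> A' \<Longrightarrow> B \<subseteq> B' \<Longrightarrow> A \<boxplus> B \<subseteq> A' \<boxplus> B'"
  by (auto elim!: sum_memE intro: sum_memI)

lemma le_sumI1: "N \<subseteq> A \<Longrightarrow> sub A \<Longrightarrow> sub B \<Longrightarrow> N \<subseteq> A \<boxplus> B"
  by (meson sum_upper1 subset_trans)

lemma le_sumI2: "N \<subseteq> B \<Longrightarrow> sub A \<Longrightarrow> sub B \<Longrightarrow> N \<subseteq> A \<boxplus> B"
  by (meson sum_upper2 subset_trans)

lemma sum_absorb: "sub A \<Longrightarrow> sub B \<Longrightarrow> A \<subseteq> B \<Longrightarrow> A \<boxplus> B = B"
  by (meson order_refl sum_least sum_upper2 subset_antisym)

lemma sum_absorb2: "sub A \<Longrightarrow> sub B \<Longrightarrow> B \<subseteq> A \<Longrightarrow> A \<boxplus> B = A"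
  by (meson order_refl sum_least sum_upper1 subset_antisym)

lemma sum_assoc: "sub A \<Longrightarrow> sub B \<Longrightarrow> sub C \<Longrightarrow> (A \<boxplus> B) \<boxplus> C = A \<boxplus> (B \<boxplus> C)"
  by (rule subset_antisym) (simp_all add: sum_le_iff, (meson sub_sum sum_upper1 sum_upper2 subset_trans)+)

lemma modular:
  assumes "sub A" "sub B" "sub C" "A \<subseteq> C"
  shows "(A \<boxplus> B) \<inter> C = A \<boxplus> (B \<inter> C)"
proof
  show "(A \<boxplus> B) \<inter> C \<subseteq> A \<boxplus> (B \<inter> C)"
  proof
    fix x assume "x \<in> (A \<boxplus> B) \<inter> C"
    then obtain a b where ab: "a \<in> A" "b \<in> B" "x = a \<oplus>\<^bsub>M\<^esub> b" "x \<in> C" by (auto elim!: sum_memE)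
    have c: "a \<in> carrier M" "b \<in> carrier M" using ab sub_mem[OF assms(1)] sub_mem[OF assms(2)] by auto
    have "b = (\<ominus>\<^bsub>M\<^esub> a) \<oplus>\<^bsub>M\<^esub> x" using c ab(3) by (simp add: M.r_neg1)
    also have "\<dots> \<in> C" using ab assms by (intro rsubmoduleD(2,4)) auto
    finally show "x \<in> A \<boxplus> (B \<inter> C)" using ab by (auto intro!: sum_memI)
  qed
  show "A \<boxplus> (B \<inter> C) \<subseteq> (A \<boxplus> B) \<inter> C"
    using assms by (simp add: sum_least sum_mono)
qed

definition cyc :: "'m \<Rightarrow> 'm set"
  where "cyc x = (\<lambda>r. x \<triangleleft>\<^bsub>M\<^esub> r) ` carrier R"

lemma sub_cyc [simp]: "x \<in> carrier M \<Longrightarrow> sub (cyc x)"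
proof (rule rsubmoduleI)
  assume x: "x \<in> carrier M"
  show "\<zero>\<^bsub>M\<^esub> \<in> cyc x" using x by (auto simp: cyc_def intro!: image_eqI[of _ _ "\<zero>\<^bsub>R\<^esub>"])
  show "a \<oplus>\<^bsub>M\<^esub> b \<in> cyc x" if "a \<in> cyc x" "b \<in> cyc x" for a b
    using that x by (auto simp: cyc_def ract_r_distr[symmetric])
  show "a \<triangleleft>\<^bsub>M\<^esub> r \<in> cyc x" if "a \<in> cyc x" "r \<in> carrier R" for a r
    using that x by (auto simp: cyc_def ract_assoc[symmetric])
qed (auto simp: cyc_def)

lemma cyc_self: "x \<in> carrier M \<Longrightarrow> x \<in> cyc x"
  by (auto simp: cyc_def intro!: image_eqI[of _ _ "\<one>\<^bsub>R\<^esub>"])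

lemma cyc_least: "sub N \<Longrightarrow> x \<in> N \<Longrightarrow> cyc x \<subseteq> N"
  by (auto simp: cyc_def rsubmoduleD)

text \<open>Subfactors are handled inside the lattice of submodules of \<open>M\<close>: the notions \<open>rel_\<dots> Z Y\<close> below
  express the corresponding property of the module \<open>Y/Z\<close> for submodules \<open>Z \<subseteq> Y\<close>.\<close>

definition rel_cyclic :: "'m set \<Rightarrow> 'm set \<Rightarrow> bool"
  where "rel_cyclic Z Y \<longleftrightarrow> sub Z \<and> (\<exists>y\<in>carrier M. Y = cyc y \<boxplus> Z)"

definition rel_ess :: "'m set \<Rightarrow> 'm set \<Rightarrow> 'm set \<Rightarrow> bool"
  where "rel_ess Z N D \<longleftrightarrow> (\<forall>U. sub U \<and> Z \<subseteq> U \<and> U \<subseteq> D \<and> U \<inter> N \<subseteq> Z \<longrightarrow> U = Z)"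

definition rel_compl :: "'m set \<Rightarrow> 'm set \<Rightarrow> 'm set \<Rightarrow> 'm set \<Rightarrow> bool"
  where "rel_compl Z Y A B \<longleftrightarrow> sub A \<and> sub B \<and> A \<boxplus> B = Y \<and> A \<inter> B = Z"

definition rel_CS :: "'m set \<Rightarrow> 'm set \<Rightarrow> bool"
  where "rel_CS Z Y \<longleftrightarrow> (\<forall>N. sub N \<and> Z \<subseteq> N \<and> N \<subseteq> Y \<longrightarrow>
    (\<exists>D D'. rel_compl Z Y D D' \<and> N \<subseteq> D \<and> rel_ess Z N D))"

definition rel_noeth :: "'m set \<Rightarrow> 'm set \<Rightarrow> bool"
  where "rel_noeth Z Y \<longleftrightarrow> (\<forall>N :: nat \<Rightarrow> 'm set. (\<forall>n. sub (N n) \<and> Z \<subseteq> N n \<and> N n \<subseteq> Y) \<and>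
    (\<forall>n. N n \<subseteq> N (Suc n)) \<longrightarrow> (\<exists>k. \<forall>n\<ge>k. N n = N k))"

definition covers :: "'m set \<Rightarrow> 'm set \<Rightarrow> bool"
  where "covers Z V \<longleftrightarrow> sub Z \<and> sub V \<and> Z \<subset> V \<and>
    (\<forall>N. sub N \<and> Z \<subseteq> N \<and> N \<subseteq> V \<longrightarrow> N = Z \<or> N = V)"

text \<open>The quotient \<open>T/Z\<close> is the sum of its simple submodules.\<close>

definition rel_ss :: "'m set \<Rightarrow> 'm set \<Rightarrow> bool"
  where "rel_ss Z T \<longleftrightarrow> sub Z \<and> sub T \<and> Z \<subseteq> T \<and>
    (\<forall>W. sub W \<and> Z \<subseteq> W \<and> W \<subseteq> T \<and> (\<forall>V. covers Z V \<and> V \<subseteq> T \<longrightarrow> V \<subseteq> W) \<longrightarrow> W = T)"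

lemma rel_cyclicD:
  assumes "rel_cyclic Z Y"
  shows "sub Z" "sub Y" "Z \<subseteq> Y"
  using assms sum_upper2[OF sub_cyc, of _ Z] by (auto simp only: rel_cyclic_def sub_sum sub_cyc)

lemma rel_cyclic_mono:
  assumes "rel_cyclic Z Y" "sub Z'" "Z \<subseteq> Z'" "Z' \<subseteq> Y"
  shows "rel_cyclic Z' Y"
proof -
  obtain y where y: "y \<in> carrier M" "Y = cyc y \<boxplus> Z" "sub Z" using assms(1) by (auto simp: rel_cyclic_def)
  have "Y = cyc y \<boxplus> Z'"
    using y assms sum_mono[of "cyc y" "cyc y" Z Z'] sum_least[of Y "cyc y" Z'] sum_upper1[of "cyc y" Z]
    by auto
  then show ?thesis using y assms(2) by (auto simp: rel_cyclic_def)
qed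

lemma rel_cyclic_obtain:
  assumes "rel_cyclic Z Y"
  obtains y where "y \<in> Y" "y \<in> carrier M" "Y = cyc y \<boxplus> Z"
proof -
  obtain y where y: "y \<in> carrier M" "Y = cyc y \<boxplus> Z" "sub Z" using assms by (auto simp: rel_cyclic_def)
  then have "y \<in> Y" using cyc_self[of y] sum_upper1[of "cyc y" Z] by auto
  then show thesis using that y by blast
qed

lemma rel_cyclicI: "sub Z \<Longrightarrow> y \<in> carrier M \<Longrightarrow> rel_cyclic Z (cyc y \<boxplus> Z)"
  by (auto simp: rel_cyclic_def)

text \<open>A generator of \<open>Y\<close> over \<open>Z\<close> lies in one member of the family,
  which then contains all of \<open>Y\<close>. For chains this is the compactness of cyclic
  modules.\<close>

lemma rel_cyclic_le:
  assumes "rel_cyclic Z Y" "\<And>y. y \<in> Y \<Longrightarrow> \<exists>N\<in>\<F>. y \<in> N" "\<And>N. N \<in> \<F> \<Longrightarrow> sub N \<and> Z \<subseteq> N"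
  shows "\<exists>N\<in>\<F>. Y \<subseteq> N"
proof -
  obtain y where y: "y \<in> Y" "y \<in> carrier M" "Y = cyc y \<boxplus> Z" by (rule rel_cyclic_obtain[OF assms(1)])
  obtain N where "N \<in> \<F>" "y \<in> N" using assms(2) y by blast
  then show ?thesis using assms(3)[of N] y cyc_least sum_least by metis
qed

lemma rel_complD:
  assumes "rel_compl Z Y A B"
  shows "sub A" "sub B" "sub Y" "sub Z" "A \<boxplus> B = Y" "A \<inter> B = Z" "Z \<subseteq> A" "Z \<subseteq> B" "A \<subseteq> Y" "B \<subseteq> Y" "Z \<subseteq> Y"
  using assms sum_upper1[of A B] sum_upper2[of A B] by (auto simp: rel_compl_def)

lemma rel_compl_sym: "rel_compl Z Y A B \<Longrightarrow> rel_compl Z Y B A"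
  by (auto simp: rel_compl_def sum_comm)

text \<open>The component \<open>a\<close> of a generator generates \<open>A\<close>: for
  \<open>x\<close> in \<open>A\<close>, what remains of \<open>x\<close> after removing a multiple
  of \<open>a\<close> lies in both \<open>A\<close> and \<open>B\<close>, hence in
  \<open>Z\<close>.\<close>

lemma rel_cyclic_summand:
  assumes c: "rel_compl Z Y A B" and "rel_cyclic Z Y"
  shows "rel_cyclic Z A"
proof -
  note C = rel_complD[OF c]
  obtain y where y: "y \<in> Y" "y \<in> carrier M" "Y = cyc y \<boxplus> Z" by (rule rel_cyclic_obtain[OF assms(2)])
  have "y \<in> A \<boxplus> B" using y(1) C(5) by simp
  then obtain a b where ab: "a \<in> A" "b \<in> B" "y = a \<oplus>\<^bsub>M\<^esub> b" by (rule sum_memE)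
  have [simp]: "a \<in> carrier M" "b \<in> carrier M" using ab sub_mem[OF C(1)] sub_mem[OF C(2)] by auto
  have "x \<in> cyc a \<boxplus> Z" if x: "x \<in> A" for x
  proof -
    have "x \<in> cyc y \<boxplus> Z" using x C y(3) by blast
    then obtain r z where r: "r \<in> carrier R" "z \<in> Z" "x = y \<triangleleft>\<^bsub>M\<^esub> r \<oplus>\<^bsub>M\<^esub> z"
      by (auto elim!: sum_memE simp: cyc_def)
    have cz: "z \<in> carrier M" "x \<in> carrier M" using r x sub_mem[OF C(1)] C(7) by auto
    have eq: "x = a \<triangleleft>\<^bsub>M\<^esub> r \<oplus>\<^bsub>M\<^esub> (b \<triangleleft>\<^bsub>M\<^esub> r \<oplus>\<^bsub>M\<^esub> z)"
      using r cz by (simp add: ab ract_l_distr M.a_assoc)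
    have B: "b \<triangleleft>\<^bsub>M\<^esub> r \<oplus>\<^bsub>M\<^esub> z \<in> B" using ab r C by (intro rsubmoduleD(2,3)) auto
    have "b \<triangleleft>\<^bsub>M\<^esub> r \<oplus>\<^bsub>M\<^esub> z = (\<ominus>\<^bsub>M\<^esub> (a \<triangleleft>\<^bsub>M\<^esub> r)) \<oplus>\<^bsub>M\<^esub> x"
      by (subst eq, rule M.r_neg1[symmetric]) (use r cz in simp_all)
    also have "\<dots> \<in> A" using ab r x C(1) by (intro rsubmoduleD(2,3,4)) auto
    finally have "b \<triangleleft>\<^bsub>M\<^esub> r \<oplus>\<^bsub>M\<^esub> z \<in> Z" using B C(6) by blast
    then show ?thesis unfolding cyc_def by (subst eq) (use r in \<open>auto intro!: sum_memI\<close>)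
  qed
  moreover have "cyc a \<boxplus> Z \<subseteq> A" using C ab by (simp add: sum_least cyc_least)
  ultimately have "A = cyc a \<boxplus> Z" by blast
  then show ?thesis using C by (auto simp: rel_cyclic_def)
qed

section \<open>Ascending chains in intervals\<close>

lemma rel_noethD:
  assumes "rel_noeth Z Y" "\<And>n. sub (N n)" "\<And>n. Z \<subseteq> N n" "\<And>n. N n \<subseteq> Y" "\<And>n. N n \<subseteq> N (Suc n)"
  shows "\<exists>k. \<forall>n\<ge>k. N n = N k"
  using assms unfolding rel_noeth_def by blast

lemma rel_noeth_mono: "rel_noeth Z Y \<Longrightarrow> Z \<subseteq> Z' \<Longrightarrow> Y' \<subseteq> Y \<Longrightarrow> rel_noeth Z' Y'"
  unfolding rel_noeth_def by (meson subset_trans)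

text \<open>Cancellation in a modular lattice. It allows a chain to be tested on the two factors of
  an extension.\<close>

lemma sub_eqI:
  assumes "sub A" "sub B" "sub Y" "A \<subseteq> B" "A \<inter> Y = B \<inter> Y" "A \<boxplus> Y = B \<boxplus> Y"
  shows "A = B"
proof -
  have "B = (A \<boxplus> Y) \<inter> B" using assms sum_upper1[of B Y] by auto
  also have "\<dots> = A \<boxplus> (B \<inter> Y)" using modular[of A Y B] assms by (simp add: Int_commute)
  also have "\<dots> = A \<boxplus> (A \<inter> Y)" by (simp only: assms(5))
  also have "\<dots> = A" using assms(1,3) by (intro sum_absorb2) auto
  finally show ?thesis by simp
qed

lemma rel_noeth_trans:
  assumes "rel_noeth Z Y" "rel_noeth Y X" "sub Y" "sub X" "Z \<subseteq> Y" "Y \<subseteq> X"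
  shows "rel_noeth Z X"
  unfolding rel_noeth_def
proof (intro allI impI, elim conjE)
  fix N :: "nat \<Rightarrow> 'm set"
  assume N: "\<forall>n. sub (N n) \<and> Z \<subseteq> N n \<and> N n \<subseteq> X" and inc: "\<forall>n. N n \<subseteq> N (Suc n)"
  have mono: "N a \<subseteq> N b" if "a \<le> b" for a b using lift_Suc_mono_le[of N] inc that by blast
  have "\<exists>k. \<forall>n\<ge>k. N n \<inter> Y = N k \<inter> Y"
    by (rule rel_noethD[OF assms(1), of "\<lambda>n. N n \<inter> Y"]) (use N inc assms(3,5) in \<open>simp_all, blast\<close>)
  then obtain k where k: "\<And>n. n \<ge> k \<Longrightarrow> N n \<inter> Y = N k \<inter> Y" by blast
  have "\<exists>k. \<forall>n\<ge>k. N n \<boxplus> Y = N k \<boxplus> Y"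
    by (rule rel_noethD[OF assms(2), of "\<lambda>n. N n \<boxplus> Y"])
      (use N inc assms(3-) in \<open>simp_all add: sum_upper2 sum_le_iff le_sumI1\<close>)
  then obtain l where l: "\<And>n. n \<ge> l \<Longrightarrow> N n \<boxplus> Y = N l \<boxplus> Y" by blast
  have "N (max k l) = N n" if n: "n \<ge> max k l" for n
  proof (rule sub_eqI[of _ _ Y])
    show "N (max k l) \<inter> Y = N n \<inter> Y" using k[of n] k[of "max k l"] n by simp
    show "N (max k l) \<boxplus> Y = N n \<boxplus> Y" using l[of n] l[of "max k l"] n by simp
  qed (use N assms mono n in auto)
  then show "\<exists>k. \<forall>n\<ge>k. N n = N k" by metis
qed

text \<open>The second isomorphism theorem for \<open>A/(A \<inter> B)\<close> and
  \<open>(A \<boxplus> B)/B\<close>, whose lattices of submodules correspond by intersecting with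
  \<open>A\<close> and adding \<open>B\<close>. The other direction is
  \<open>rel_noeth_sumD\<close>.\<close>

lemma rel_noeth_sumI:
  assumes "sub A" "sub B" "rel_noeth (A \<inter> B) A"
  shows "rel_noeth B (A \<boxplus> B)"
  unfolding rel_noeth_def
proof (intro allI impI, elim conjE)
  fix N :: "nat \<Rightarrow> 'm set"
  assume N: "\<forall>n. sub (N n) \<and> B \<subseteq> N n \<and> N n \<subseteq> A \<boxplus> B" and inc: "\<forall>n. N n \<subseteq> N (Suc n)"
  have "\<exists>k. \<forall>n\<ge>k. N n \<inter> A = N k \<inter> A"
    by (rule rel_noethD[OF assms(3), of "\<lambda>n. N n \<inter> A"]) (use N inc assms(1,2) in \<open>simp_all, blast+\<close>)
  then obtain k where k: "\<And>n. n \<ge> k \<Longrightarrow> N n \<inter> A = N k \<inter> A" by blast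
  have "N n = B \<boxplus> (N n \<inter> A)" for n
  proof -
    have "B \<boxplus> (A \<inter> N n) = (B \<boxplus> A) \<inter> N n" using modular[of B A "N n"] N assms by simp
    moreover have "(B \<boxplus> A) \<inter> N n = N n" using N[rule_format, of n] sum_comm[OF assms(1,2)] by auto
    ultimately show ?thesis by (simp add: Int_commute)
  qed
  then show "\<exists>k. \<forall>n\<ge>k. N n = N k" using k by metis
qed

lemma rel_noeth_sumD:
  assumes "sub A" "sub B" "rel_noeth B (A \<boxplus> B)"
  shows "rel_noeth (A \<inter> B) A"
  unfolding rel_noeth_def
proof (intro allI impI, elim conjE)
  fix N :: "nat \<Rightarrow> 'm set"
  assume N: "\<forall>n. sub (N n) \<and> A \<inter> B \<subseteq> N n \<and> N n \<subseteq> A" and inc: "\<forall>n. N n \<subseteq> N (Suc n)"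
  have "\<exists>k. \<forall>n\<ge>k. N n \<boxplus> B = N k \<boxplus> B"
    by (rule rel_noethD[OF assms(3), of "\<lambda>n. N n \<boxplus> B"])
      (use N inc assms(1,2) in \<open>simp_all add: sum_mono sum_upper2\<close>)
  then obtain k where k: "\<And>n. n \<ge> k \<Longrightarrow> N n \<boxplus> B = N k \<boxplus> B" by blast
  have "N n = (N n \<boxplus> B) \<inter> A" for n
    using modular[of "N n" B A] sum_absorb2[of "N n" "B \<inter> A"] N assms(1,2) by (simp add: Int_commute)
  then show "\<exists>k. \<forall>n\<ge>k. N n = N k" using k by metis
qed

lemma rel_noeth_sum:
  assumes "sub A" "sub B" "sub Z" "Z \<subseteq> A" "Z \<subseteq> B" "rel_noeth Z A" "rel_noeth Z B"
  shows "rel_noeth Z (A \<boxplus> B)"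
proof (rule rel_noeth_trans[of Z B])
  show "rel_noeth B (A \<boxplus> B)"
    by (rule rel_noeth_sumI) (use assms rel_noeth_mono[OF assms(6), of "A \<inter> B" A] in auto)
qed (use assms sum_upper2 in auto)

lemma rel_noeth_max:
  assumes "rel_noeth Z Y" "\<And>N. N \<in> \<F> \<Longrightarrow> sub N \<and> Z \<subseteq> N \<and> N \<subseteq> Y" "\<F> \<noteq> {}"
  shows "\<exists>N\<in>\<F>. \<forall>N'\<in>\<F>. N \<subseteq> N' \<longrightarrow> N' = N"
proof (rule ccontr)
  assume "\<not> ?thesis"
  then have step: "\<And>N. N \<in> \<F> \<Longrightarrow> \<exists>N'\<in>\<F>. N \<subset> N'" by blast
  obtain N0 where N0: "N0 \<in> \<F>" using assms(3) by blast
  obtain N where N: "\<And>n. N n \<in> \<F>" "\<And>n. N n \<subset> N (Suc n)"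
    using dependent_nat_choice[of "\<lambda>_ N. N \<in> \<F>" "\<lambda>_ N N'. N \<subset> N'"] N0 step by metis
  then have "\<exists>k. \<forall>n\<ge>k. N n = N k" using assms(1,2) unfolding rel_noeth_def by (metis psubset_imp_subset)
  then show False using N(2) by (metis le_SucI order_refl psubset_eq)
qed

lemma not_rel_noethE:
  assumes "\<not> rel_noeth Z Y"
  obtains N :: "nat \<Rightarrow> 'm set" where "\<And>n. sub (N n)" "\<And>n. Z \<subseteq> N n" "\<And>n. N n \<subseteq> Y" "\<And>n. N n \<subset> N (Suc n)"
proof -
  obtain N :: "nat \<Rightarrow> 'm set" where N': "\<forall>n. sub (N n) \<and> Z \<subseteq> N n \<and> N n \<subseteq> Y" "\<forall>n. N n \<subseteq> N (Suc n)"
    and no': "\<not> (\<exists>k. \<forall>n\<ge>k. N n = N k)"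
    using assms unfolding rel_noeth_def by (simp only: not_all not_imp) (elim exE conjE)
  have N: "sub (N n)" "Z \<subseteq> N n" "N n \<subseteq> Y" "N n \<subseteq> N (Suc n)" for n using N' by simp_all
  have no: "\<exists>n\<ge>k. N n \<noteq> N k" for k using no' by blast
  have mono: "N a \<subseteq> N b" if "a \<le> b" for a b using lift_Suc_mono_le[of N] N(4) that by blast
  have "\<exists>n. N k \<subset> N n" for k using no[of k] mono by blast
  then obtain s where s: "\<And>k. N k \<subset> N (s k)" by metis
  \<comment> \<open>Iterating \<open>s\<close> passes to a strictly increasing subsequence.\<close>
  show ?thesis
    by (rule that[of "\<lambda>n. N ((s ^^ n) 0)"]) (use N s in auto)
qed

section \<open>Maximal submodules and pseudo-complements\<close>

lemma sub_Zorn: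
  assumes "A \<in> \<F>" "\<And>N. N \<in> \<F> \<Longrightarrow> sub N"
    and "\<And>C. C \<noteq> {} \<Longrightarrow> C \<subseteq> \<F> \<Longrightarrow> sub (\<Union>C) \<Longrightarrow> subset.chain \<F> C \<Longrightarrow> \<Union>C \<in> \<F>"
  shows "\<exists>N\<in>\<F>. \<forall>N'\<in>\<F>. N \<subseteq> N' \<longrightarrow> N' = N"
proof (rule subset_Zorn_nonempty)
  show "\<F> \<noteq> {}" using assms(1) by blast
  fix C assume C: "C \<noteq> {}" "subset.chain \<F> C"
  then have "C \<subseteq> \<F>" "\<And>A B. A \<in> C \<Longrightarrow> B \<in> C \<Longrightarrow> A \<subseteq> B \<or> B \<subseteq> A" by (auto simp: subset_chain_def)
  then show "\<Union>C \<in> \<F>" using assms(2,3) C sub_chain_Union[of C] by blast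
qed

lemma rel_pseudo_compl:
  assumes "sub Z" "sub W" "sub Y" "Z \<subseteq> W" "Z \<subseteq> Y"
  obtains C where "sub C" "Z \<subseteq> C" "C \<subseteq> Y" "C \<inter> W = Z"
    "\<And>C'. sub C' \<Longrightarrow> C \<subseteq> C' \<Longrightarrow> C' \<subseteq> Y \<Longrightarrow> C' \<inter> W \<subseteq> Z \<Longrightarrow> C' = C"
proof -
  let ?F = "{C. sub C \<and> Z \<subseteq> C \<and> C \<subseteq> Y \<and> C \<inter> W \<subseteq> Z}"
  have "\<exists>N\<in>?F. \<forall>N'\<in>?F. N \<subseteq> N' \<longrightarrow> N' = N"
    by (rule sub_Zorn[of Z]) (use assms in \<open>auto, blast+\<close>)
  then obtain C where C: "C \<in> ?F" and max: "\<forall>C'\<in>?F. C \<subseteq> C' \<longrightarrow> C' = C" by (elim bexE)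
  have "C' = C" if "sub C'" "C \<subseteq> C'" "C' \<subseteq> Y" "C' \<inter> W \<subseteq> Z" for C'
    using C max[rule_format, of C'] that by auto
  moreover have "C \<inter> W = Z" using C assms(4) by auto
  ultimately show ?thesis using C by (intro that[of C]) simp_all
qed

text \<open>If \<open>U\<close> meets \<open>W \<boxplus> C\<close> only in \<open>Z\<close>, then
  by the modular law \<open>C \<boxplus> U\<close> still meets \<open>W\<close> only in
  \<open>Z\<close>, so maximality of \<open>C\<close> gives \<open>U \<subseteq> C\<close>.\<close>

lemma rel_pseudo_compl_ess:
  assumes "sub C" "sub W" "sub Y" "W \<subseteq> Y" "C \<subseteq> Y" "C \<inter> W = Z" "sub Z"
    and max: "\<And>C'. sub C' \<Longrightarrow> C \<subseteq> C' \<Longrightarrow> C' \<subseteq> Y \<Longrightarrow> C' \<inter> W \<subseteq> Z \<Longrightarrow> C' = C"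
  shows "rel_ess Z (W \<boxplus> C) Y"
  unfolding rel_ess_def
proof (intro allI impI, elim conjE)
  fix U assume U: "sub U" "Z \<subseteq> U" "U \<subseteq> Y" "U \<inter> (W \<boxplus> C) \<subseteq> Z"
  have ZC: "Z \<subseteq> C" using assms(6) by blast
  have "(C \<boxplus> U) \<inter> (C \<boxplus> W) = C \<boxplus> (U \<inter> (C \<boxplus> W))"
    by (rule modular) (use assms(1,2) U(1) sum_upper1 in simp_all)
  also have "\<dots> \<subseteq> C \<boxplus> Z" using U(4) sum_comm[OF assms(1,2)] by (simp add: sum_mono)
  also have "\<dots> = C" by (rule sum_absorb2[OF assms(1,7) ZC])
  finally have "(C \<boxplus> U) \<inter> W \<subseteq> C" using sum_upper2[OF assms(1,2)] by blast
  then have *: "(C \<boxplus> U) \<inter> W \<subseteq> Z" using assms(6) by blast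
  have "C \<boxplus> U = C"
    by (rule max) (simp_all add: U assms(1) sum_upper1 sum_least[OF assms(3,5) U(3)] *)
  then have "U \<subseteq> C" using sum_upper2[OF assms(1) U(1)] by simp
  then have "U \<subseteq> Z" using U(4) sum_upper2[OF assms(2,1)] by blast
  then show "U = Z" using U(2) by blast
qed

lemma rel_essD: "rel_ess Z N D \<Longrightarrow> sub U \<Longrightarrow> Z \<subseteq> U \<Longrightarrow> U \<subseteq> D \<Longrightarrow> U \<inter> N \<subseteq> Z \<Longrightarrow> U = Z"
  unfolding rel_ess_def by blast

text \<open>Since \<open>y\<close> generates \<open>Y\<close> over \<open>Z\<close>, a submodule
  between \<open>Z\<close> and \<open>Y\<close> is proper exactly when it avoids \<open>y\<close>,
  and this condition passes to unions of chains.\<close>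

lemma maximal_avoiding:
  assumes "sub Z" "sub Y" "Z \<subseteq> Y" "y \<in> Y" "y \<notin> Z" "Y = cyc y \<boxplus> Z" "y \<in> carrier M"
  obtains Q where "covers Q Y" "Z \<subseteq> Q"
proof -
  let ?F = "{Q. sub Q \<and> Z \<subseteq> Q \<and> Q \<subseteq> Y \<and> y \<notin> Q}"
  have "\<exists>N\<in>?F. \<forall>N'\<in>?F. N \<subseteq> N' \<longrightarrow> N' = N"
    by (rule sub_Zorn[of Z]) (use assms in \<open>auto\<close>)
  then obtain Q where Q: "Q \<in> ?F" and max: "\<forall>Q'\<in>?F. Q \<subseteq> Q' \<longrightarrow> Q' = Q" by (elim bexE)
  have "N = Q \<or> N = Y" if N: "sub N" "Q \<subseteq> N" "N \<subseteq> Y" for N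
  proof (cases "y \<in> N")
    case True
    then have "cyc y \<boxplus> Z \<subseteq> N" using N Q(1) by (intro sum_least cyc_least) auto
    then have "Y \<subseteq> N" using assms(6) by simp
    then show ?thesis using N by blast
  next
    case False
    then show ?thesis using Q N max[rule_format, of N] by auto
  qed
  then show ?thesis using Q(1) assms by (intro that[of Q]) (auto simp: covers_def)
qed


section \<open>Simple subfactors\<close>

lemma between_sum_eq:
  assumes "sub A" "sub B" "sub N" "B \<subseteq> N" "N \<subseteq> A \<boxplus> B"
  shows "N = (N \<inter> A) \<boxplus> B"
proof -
  have "(B \<boxplus> A) \<inter> N = B \<boxplus> (A \<inter> N)" by (rule modular) (use assms in simp_all)
  moreover have "(B \<boxplus> A) \<inter> N = N" using assms(5) sum_comm[OF assms(1,2)] by auto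
  ultimately show ?thesis using sum_comm[of B "A \<inter> N"] assms(1-3) by (simp add: Int_commute)
qed

text \<open>Together with \<open>between_sum_eq\<close> this is the diamond isomorphism of modular
  lattices, between the intervals \<open>[A \<inter> B, A]\<close> and
  \<open>[B, A \<boxplus> B]\<close>.\<close>

lemma between_Int_eq:
  assumes "sub A" "sub B" "sub N" "A \<inter> B \<subseteq> N" "N \<subseteq> A"
  shows "N = (N \<boxplus> B) \<inter> A"
  using modular[of N B A] sum_absorb2[of N "B \<inter> A"] assms by (simp add: Int_commute)

lemma coversD:
  assumes "covers Z V"
  shows "sub Z" "sub V" "Z \<subseteq> V" "Z \<noteq> V" "\<And>N. sub N \<Longrightarrow> Z \<subseteq> N \<Longrightarrow> N \<subseteq> V \<Longrightarrow> N \<noteq> V \<Longrightarrow> N = Z"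
  using assms by (auto simp: covers_def)

lemma coversI:
  assumes "sub Z" "sub V" "Z \<subseteq> V" "Z \<noteq> V" "\<And>N. sub N \<Longrightarrow> Z \<subseteq> N \<Longrightarrow> N \<subseteq> V \<Longrightarrow> N \<noteq> V \<Longrightarrow> N = Z"
  shows "covers Z V"
  using assms by (auto simp: covers_def)

lemma covers_Int:
  assumes "covers Z V" "sub B" "Z \<subseteq> B" "\<not> V \<subseteq> B"
  shows "V \<inter> B = Z"
  by (rule coversD(5)[OF assms(1)]) (use assms coversD[OF assms(1)] in auto)

lemma covers_sumI:
  assumes c: "covers (A \<inter> B) A" and "sub B"
  shows "covers B (A \<boxplus> B)"
proof (rule coversI)
  note C = coversD[OF c]
  show "B \<noteq> A \<boxplus> B" using C(3,4) sum_upper1[OF C(2) assms(2)] by auto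
  show "B \<subseteq> A \<boxplus> B" by (rule sum_upper2[OF C(2) assms(2)])
  fix N assume N: "sub N" "B \<subseteq> N" "N \<subseteq> A \<boxplus> B" "N \<noteq> A \<boxplus> B"
  have eq: "N = (N \<inter> A) \<boxplus> B" by (rule between_sum_eq) (use C N assms in simp_all)
  have "N \<inter> A = A \<inter> B"
    by (rule C(5)) (use C N assms eq in auto)
  then show "N = B" using eq C assms(2) by (simp add: sum_absorb)
qed (use coversD[OF c] assms in simp_all)

lemma covers_sumD:
  assumes c: "covers B (A \<boxplus> B)" and "sub A"
  shows "covers (A \<inter> B) A"
proof (rule coversI)
  note C = coversD[OF c]
  show "A \<inter> B \<noteq> A" using C(4) sum_absorb[OF assms(2) C(1)] by auto
  fix N assume N: "sub N" "A \<inter> B \<subseteq> N" "N \<subseteq> A" "N \<noteq> A"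
  have eq: "N = (N \<boxplus> B) \<inter> A" by (rule between_Int_eq) (use C N assms in simp_all)
  have "N \<boxplus> B = B"
  proof (rule C(5))
    show "N \<boxplus> B \<noteq> A \<boxplus> B"
    proof
      assume "N \<boxplus> B = A \<boxplus> B"
      then have "N = A" using eq sum_upper1[OF assms(2) C(1)] by blast
      then show False using N by simp
    qed
  qed (use C N assms in \<open>simp_all add: sum_mono sum_upper2\<close>)
  then show "N = A \<inter> B" using eq by auto
qed (use coversD[OF c] assms in simp_all)

lemma covers_noeth: "covers Z V \<Longrightarrow> rel_noeth Z V"
  unfolding rel_noeth_def
proof (intro allI impI, elim conjE)
  fix N :: "nat \<Rightarrow> 'm set"
  assume c: "covers Z V" and N: "\<forall>n. sub (N n) \<and> Z \<subseteq> N n \<and> N n \<subseteq> V" and inc: "\<forall>n. N n \<subseteq> N (Suc n)"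
  have mono: "N a \<subseteq> N b" if "a \<le> b" for a b using lift_Suc_mono_le[of N] inc that by blast
  have two: "N n = Z \<or> N n = V" for n using coversD(5)[OF c, of "N n"] N by blast
  show "\<exists>k. \<forall>n\<ge>k. N n = N k"
  proof (cases "\<exists>k. N k = V")
    case True
    then obtain k where "N k = V" by blast
    then have "\<forall>n\<ge>k. N n = N k" using mono N by blast
    then show ?thesis by blast
  qed (use two in auto)
qed

text \<open>\<open>(V \<boxplus> D) \<inter> A\<close> is the image of \<open>V\<close> under the
  projection onto \<open>A\<close> along \<open>D\<close>. As \<open>V\<close> meets
  \<open>D\<close> only in \<open>Z\<close>, the projection is injective on \<open>V/Z\<close>, and
  the image is again simple.\<close>

lemma covers_project:
  assumes V: "covers Z V" and c: "rel_compl Z Y A D" and "V \<subseteq> Y" "\<not> V \<subseteq> D"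
  shows "covers Z ((V \<boxplus> D) \<inter> A)" "((V \<boxplus> D) \<inter> A) \<boxplus> D = V \<boxplus> D"
proof -
  note C = rel_complD[OF c] and W = coversD[OF V]
  have VD: "V \<inter> D = Z" by (rule covers_Int) (use assms C in simp_all)
  have le: "V \<boxplus> D \<subseteq> A \<boxplus> D" using assms(3) C by (simp add: sum_least)
  show eq: "((V \<boxplus> D) \<inter> A) \<boxplus> D = V \<boxplus> D"
    by (rule between_sum_eq[symmetric]) (use C W le sum_upper2 in simp_all)
  have "covers D (V \<boxplus> D)" by (rule covers_sumI) (use V VD C in simp_all)
  then have "covers D (((V \<boxplus> D) \<inter> A) \<boxplus> D)" by (simp only: eq)
  then have "covers (((V \<boxplus> D) \<inter> A) \<inter> D) ((V \<boxplus> D) \<inter> A)" by (rule covers_sumD) (use C W in simp)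
  moreover have "((V \<boxplus> D) \<inter> A) \<inter> D = Z" using sum_upper2[OF W(2) C(2)] C(6) by blast
  ultimately show "covers Z ((V \<boxplus> D) \<inter> A)" by simp
qed

section \<open>Semisimple intervals\<close>

lemma rel_ssD:
  assumes "rel_ss Z T"
  shows "sub Z" "sub T" "Z \<subseteq> T"
  using assms by (auto simp: rel_ss_def)

lemma rel_ssI:
  assumes "sub Z" "sub T" "Z \<subseteq> T"
    "\<And>W. sub W \<Longrightarrow> Z \<subseteq> W \<Longrightarrow> W \<subseteq> T \<Longrightarrow> (\<And>V. covers Z V \<Longrightarrow> V \<subseteq> T \<Longrightarrow> V \<subseteq> W) \<Longrightarrow> T \<subseteq> W"
  shows "rel_ss Z T"
  using assms unfolding rel_ss_def by (metis subset_antisym)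

lemma rel_ss_le:
  assumes "rel_ss Z T" "sub W" "Z \<subseteq> W" "\<And>V. covers Z V \<Longrightarrow> V \<subseteq> T \<Longrightarrow> V \<subseteq> W"
  shows "T \<subseteq> W"
proof -
  note D = rel_ssD[OF assms(1)]
  have "\<forall>V. covers Z V \<and> V \<subseteq> T \<longrightarrow> V \<subseteq> W \<inter> T" using assms(4) by simp
  moreover have "sub (W \<inter> T)" "Z \<subseteq> W \<inter> T" using D assms by simp_all
  ultimately have "W \<inter> T = T" using assms(1) unfolding rel_ss_def by simp
  then show ?thesis by blast
qed

text \<open>Each simple submodule of \<open>N/Z\<close> projects along \<open>D\<close> to zero or
  to a simple submodule of \<open>A/Z\<close>, and the latter lie in \<open>P\<close>.\<close>

lemma rel_ss_project:
  assumes ss: "rel_ss Z N" and c: "rel_compl Z Y A D" and "N \<subseteq> Y"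
    and P: "sub P" "Z \<subseteq> P" "\<And>V. covers Z V \<Longrightarrow> V \<subseteq> A \<Longrightarrow> V \<subseteq> P"
  shows "N \<subseteq> P \<boxplus> D"
proof (rule rel_ss_le[OF ss])
  note C = rel_complD[OF c]
  show "sub (P \<boxplus> D)" "Z \<subseteq> P \<boxplus> D" using C P by (simp_all add: le_sumI1)
  fix V assume V: "covers Z V" "V \<subseteq> N"
  show "V \<subseteq> P \<boxplus> D"
  proof (cases "V \<subseteq> D")
    case True
    then show ?thesis using C P by (simp add: le_sumI2)
  next
    case False
    have *: "covers Z ((V \<boxplus> D) \<inter> A)" "((V \<boxplus> D) \<inter> A) \<boxplus> D = V \<boxplus> D"
      using covers_project[OF V(1) c _ False] V assms(3) by auto
    have "V \<subseteq> V \<boxplus> D" by (rule sum_upper1) (use V coversD C in simp_all)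
    also have "\<dots> = ((V \<boxplus> D) \<inter> A) \<boxplus> D" using * by simp
    also have "\<dots> \<subseteq> P \<boxplus> D" by (rule sum_mono) (use P(3)[OF *(1)] in simp_all)
    finally show ?thesis .
  qed
qed

text \<open>The decomposition of \<open>Y\<close> stays direct modulo \<open>N\<close>: as
  \<open>N \<subseteq> P \<boxplus> D\<close>, the part of \<open>D \<boxplus> N\<close> inside
  \<open>A\<close> is contained in \<open>P\<close>, hence in \<open>N\<close>.\<close>

lemma rel_ss_disjoint:
  assumes ss: "rel_ss Z N" and c: "rel_compl Z Y A D" and N: "N \<subseteq> Y"
    and P: "sub P" "Z \<subseteq> P" "P \<subseteq> A" "P \<subseteq> N" "\<And>V. covers Z V \<Longrightarrow> V \<subseteq> A \<Longrightarrow> V \<subseteq> P"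
  shows "(A \<boxplus> N) \<inter> (D \<boxplus> N) = N"
proof
  note C = rel_complD[OF c] and S = rel_ssD[OF ss]
  have "N \<subseteq> P \<boxplus> D" by (rule rel_ss_project[OF ss c N]) (use P in auto)
  then have le: "D \<boxplus> N \<subseteq> P \<boxplus> D" using C P by (simp add: sum_least sum_upper2)
  have "A \<inter> (P \<boxplus> D) = P \<boxplus> (D \<inter> A)" using modular[of P D A] C P by (simp add: Int_commute)
  also have "\<dots> = P" using C P by (simp add: Int_commute sum_absorb2)
  finally have *: "A \<inter> (D \<boxplus> N) \<subseteq> N" using le P(4) by blast
  have "(N \<boxplus> A) \<inter> (D \<boxplus> N) = N \<boxplus> (A \<inter> (D \<boxplus> N))" by (rule modular) (use C S sum_upper2 in simp_all)
  also have "\<dots> = N" using * C S by (simp add: sum_absorb2)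
  finally show "(A \<boxplus> N) \<inter> (D \<boxplus> N) \<subseteq> N" using sum_comm[of A N] C S by simp
  show "N \<subseteq> (A \<boxplus> N) \<inter> (D \<boxplus> N)" using C S by (simp add: sum_upper2)
qed

lemma rel_ss_quotient:
  assumes ss: "rel_ss Z T" and "sub Z'" "Z \<subseteq> Z'"
  shows "rel_ss Z' (T \<boxplus> Z')"
proof (rule rel_ssI)
  note S = rel_ssD[OF ss]
  show "sub Z'" "sub (T \<boxplus> Z')" "Z' \<subseteq> T \<boxplus> Z'" using S assms by (simp_all add: sum_upper2)
  fix W assume W: "sub W" "Z' \<subseteq> W" "W \<subseteq> T \<boxplus> Z'" "\<And>V. covers Z' V \<Longrightarrow> V \<subseteq> T \<boxplus> Z' \<Longrightarrow> V \<subseteq> W"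
  have "T \<subseteq> W"
  proof (rule rel_ss_le[OF ss W(1)])
    fix V assume V: "covers Z V" "V \<subseteq> T"
    show "V \<subseteq> W"
    proof (cases "V \<subseteq> Z'")
      case False
      have "V \<inter> Z' = Z" by (rule covers_Int[OF V(1) assms(2,3) False])
      then have "covers Z' (V \<boxplus> Z')" using covers_sumI[of V Z'] V assms(2) by simp
      then have "V \<boxplus> Z' \<subseteq> W" by (rule W(4)) (simp add: V sum_mono)
      then show ?thesis using sum_upper1[of V Z'] coversD[OF V(1)] assms by auto
    qed (use W in auto)
  qed (use W assms in auto)
  then show "T \<boxplus> Z' \<subseteq> W" using W by (simp add: sum_least)
qed

text \<open>\<open>W\<close> together with a pseudo-complement is essential in \<open>T\<close>,
  hence contains every simple submodule of \<open>T/Z\<close>, hence is \<open>T\<close>.\<close>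

lemma rel_ss_compl:
  assumes ss: "rel_ss Z T" and W: "sub W" "Z \<subseteq> W" "W \<subseteq> T"
  obtains C where "rel_compl Z T W C"
proof -
  note S = rel_ssD[OF ss]
  obtain C where C: "sub C" "Z \<subseteq> C" "C \<subseteq> T" "C \<inter> W = Z"
    and max: "\<And>C'. sub C' \<Longrightarrow> C \<subseteq> C' \<Longrightarrow> C' \<subseteq> T \<Longrightarrow> C' \<inter> W \<subseteq> Z \<Longrightarrow> C' = C"
    by (rule rel_pseudo_compl[OF S(1) W(1) S(2) W(2) S(3)]) blast
  have ess: "rel_ess Z (W \<boxplus> C) T"
    by (rule rel_pseudo_compl_ess[OF C(1) W(1) S(2) W(3) C(3,4) S(1) max])
  have "T \<subseteq> W \<boxplus> C"
  proof (rule rel_ss_le[OF ss])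
    fix V assume V: "covers Z V" "V \<subseteq> T"
    note v = coversD[OF V(1)]
    show "V \<subseteq> W \<boxplus> C"
    proof (rule ccontr)
      assume "\<not> V \<subseteq> W \<boxplus> C"
      then have "V \<inter> (W \<boxplus> C) = Z" by (intro covers_Int[OF V(1)]) (use W C in \<open>simp_all add: le_sumI1\<close>)
      then have "V = Z" using rel_essD[OF ess v(2,3) V(2)] by simp
      then show False using v(4) by simp
    qed
  qed (use W C in \<open>simp_all add: le_sumI1\<close>)
  then have "W \<boxplus> C = T" using sum_least[OF S(2) W(3) C(3)] by simp
  then have "rel_compl Z T W C" using W C S by (simp add: rel_compl_def Int_commute)
  then show thesis by (rule that)
qed

text \<open>\<open>T\<close> projects onto \<open>W\<close> along a complement, and the simple
  submodules of \<open>T/Z\<close> go to zero or to simple submodules of \<open>W/Z\<close>.\<close>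

lemma rel_ss_mono:
  assumes ss: "rel_ss Z T" and W: "sub W" "Z \<subseteq> W" "W \<subseteq> T"
  shows "rel_ss Z W"
proof (rule rel_ssI)
  note S = rel_ssD[OF ss]
  obtain C where c: "rel_compl Z T W C" by (rule rel_ss_compl[OF assms])
  note D = rel_complD[OF c]
  fix P assume P: "sub P" "Z \<subseteq> P" "P \<subseteq> W" "\<And>V. covers Z V \<Longrightarrow> V \<subseteq> W \<Longrightarrow> V \<subseteq> P"
  have "T \<subseteq> P \<boxplus> C" by (rule rel_ss_project[OF ss c order_refl P(1,2,4)])
  then have "W \<subseteq> (P \<boxplus> C) \<inter> W" using W by blast
  also have "\<dots> = P \<boxplus> (C \<inter> W)" by (rule modular) (use P D in simp_all)
  also have "\<dots> = P" using D P by (simp add: Int_commute sum_absorb2)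
  finally show "W \<subseteq> P" .
qed (use assms rel_ssD in blast)+

lemma cyc_add_subset:
  assumes "x \<in> carrier M" "y \<in> carrier M"
  shows "cyc (x \<oplus>\<^bsub>M\<^esub> y) \<subseteq> cyc x \<boxplus> cyc y"
  by (rule cyc_least) (use assms in \<open>simp_all add: sum_memI cyc_self\<close>)

text \<open>The elements that generate a noetherian module over \<open>Z\<close> form a submodule.
  It contains all simple submodules of \<open>N/Z\<close>, hence \<open>N\<close>, so no generator
  has to be written as a finite sum of elements of simple modules.\<close>

lemma rel_ss_cyclic_noeth:
  assumes ss: "rel_ss Z N" and "rel_cyclic Z A" "A \<subseteq> N"
  shows "rel_noeth Z A"
proof -
  note S = rel_ssD[OF ss]
  define W where "W = {x \<in> N. rel_noeth Z (cyc x \<boxplus> Z)}"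
  have mem: "x \<in> carrier M" if "x \<in> W" for x using that sub_mem[OF S(2)] by (simp add: W_def)
  have VW: "V \<subseteq> W" if V: "rel_noeth Z V" "sub V" "Z \<subseteq> V" "V \<subseteq> N" for V
  proof
    fix x assume x: "x \<in> V"
    then have "cyc x \<boxplus> Z \<subseteq> V" using V by (simp add: sum_least cyc_least)
    then show "x \<in> W" using x V rel_noeth_mono[OF V(1) order_refl] by (auto simp: W_def)
  qed
  have "rel_noeth Z Z" unfolding rel_noeth_def by blast
  then have ZW: "Z \<subseteq> W" using S by (intro VW) simp_all
  have "sub W"
  proof (rule rsubmoduleI)
    show "W \<subseteq> carrier M" using mem by blast
    show "\<zero>\<^bsub>M\<^esub> \<in> W" using ZW rsubmoduleD(1)[OF S(1)] by blast
    fix x assume x: "x \<in> W"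
    show "x \<triangleleft>\<^bsub>M\<^esub> r \<in> W" if r: "r \<in> carrier R" for r
    proof -
      have "cyc (x \<triangleleft>\<^bsub>M\<^esub> r) \<boxplus> Z \<subseteq> cyc x \<boxplus> Z"
        by (intro sum_mono cyc_least) (use r mem[OF x] rsubmoduleD(3)[OF sub_cyc] cyc_self in simp_all)
      then show ?thesis using x r rsubmoduleD(3)[OF S(2)] rel_noeth_mono[OF _ order_refl] by (auto simp: W_def)
    qed
    fix y assume y: "y \<in> W"
    have m: "x \<in> carrier M" "y \<in> carrier M" using x y mem by simp_all
    have "rel_noeth Z ((cyc x \<boxplus> Z) \<boxplus> (cyc y \<boxplus> Z))"
      by (rule rel_noeth_sum) (use x y m S in \<open>simp_all add: W_def sum_upper2\<close>)
    moreover have "cyc (x \<oplus>\<^bsub>M\<^esub> y) \<boxplus> Z \<subseteq> (cyc x \<boxplus> Z) \<boxplus> (cyc y \<boxplus> Z)"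
    proof (rule sum_least)
      have "cyc x \<boxplus> cyc y \<subseteq> (cyc x \<boxplus> Z) \<boxplus> (cyc y \<boxplus> Z)"
        using m S by (intro sum_mono) (simp_all add: sum_upper1)
      then show "cyc (x \<oplus>\<^bsub>M\<^esub> y) \<subseteq> (cyc x \<boxplus> Z) \<boxplus> (cyc y \<boxplus> Z)" using cyc_add_subset[OF m] by blast
    qed (use m S in \<open>simp_all add: sum_upper2 le_sumI1\<close>)
    ultimately show "x \<oplus>\<^bsub>M\<^esub> y \<in> W"
      using x y rsubmoduleD(2)[OF S(2)] rel_noeth_mono[OF _ order_refl] by (auto simp: W_def)
  qed
  then have "N \<subseteq> W" by (rule rel_ss_le[OF ss]) (use ZW VW covers_noeth coversD in auto)
  obtain a where "a \<in> A" "A = cyc a \<boxplus> Z" by (rule rel_cyclic_obtain[OF assms(2)])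
  then show ?thesis using \<open>N \<subseteq> W\<close> assms(3) by (auto simp: W_def)
qed

section \<open>Simple subfactors that split off\<close>

text \<open>Over a V-ring every simple submodule of a quotient is injective and hence a direct summand.
  Only this consequence for the quotients by submodules above \<open>Z\<^sub>b\<close> is used.\<close>

definition simples_split_above :: "'m set \<Rightarrow> bool"
  where "simples_split_above Zb \<longleftrightarrow>
    (\<forall>Z V. covers Z V \<and> Zb \<subseteq> Z \<longrightarrow> (\<exists>D. rel_compl Z (carrier M) V D))"

lemma simples_split_above_mono: "simples_split_above Zb \<Longrightarrow> Zb \<subseteq> Z \<Longrightarrow> simples_split_above Z"
  unfolding simples_split_above_def by (meson subset_trans)

lemma simple_split:
  assumes "simples_split_above Zb" "covers Z V" "Zb \<subseteq> Z" "V \<subseteq> Y" "sub Y"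
  obtains D where "rel_compl Z Y V D"
proof -
  obtain D where c: "rel_compl Z (carrier M) V D"
    using assms unfolding simples_split_above_def by blast
  note C = rel_complD[OF c] and v = coversD[OF assms(2)]
  have "(V \<boxplus> D) \<inter> Y = V \<boxplus> (D \<inter> Y)" by (rule modular) (use C assms in simp_all)
  then have "V \<boxplus> (D \<inter> Y) = Y" using C(5) rsubmodule_subset[OF assms(5)] by auto
  moreover have "V \<inter> (D \<inter> Y) = Z" using C(6) v(3) assms(4) by blast
  ultimately have "rel_compl Z Y V (D \<inter> Y)" using C assms by (simp add: rel_compl_def)
  then show thesis by (rule that)
qed

text \<open>Take a largest submodule \<open>W\<close> of \<open>T\<close> that splits off from
  \<open>Y\<close>. A simple module outside \<open>W\<close> projects isomorphically into the
  complement of \<open>W\<close> and splits off there, so \<open>W\<close> could be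
  enlarged.\<close>

lemma noeth_ss_split:
  assumes v: "simples_split_above Zb" "Zb \<subseteq> Z" and ss: "rel_ss Z T" "rel_noeth Z T" and Y: "T \<subseteq> Y" "sub Y"
  obtains D where "rel_compl Z Y T D"
proof -
  note S = rel_ssD[OF ss(1)]
  let ?F = "{W. sub W \<and> Z \<subseteq> W \<and> W \<subseteq> T \<and> (\<exists>D. rel_compl Z Y W D)}"
  have "rel_compl Z Y Z Y" using S Y by (auto simp: rel_compl_def sum_absorb)
  then have "Z \<in> ?F" using S by auto
  then have "\<exists>W\<in>?F. \<forall>W'\<in>?F. W \<subseteq> W' \<longrightarrow> W' = W"
    by (intro rel_noeth_max[OF ss(2)]) auto
  then obtain W where W: "W \<in> ?F" and max: "\<forall>W'\<in>?F. W \<subseteq> W' \<longrightarrow> W' = W" by (elim bexE)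
  obtain D where c: "rel_compl Z Y W D" using W by blast
  note C = rel_complD[OF c]
  have "T \<subseteq> W"
  proof (rule rel_ss_le[OF ss(1)])
    fix V assume V: "covers Z V" "V \<subseteq> T"
    note vv = coversD[OF V(1)]
    show "V \<subseteq> W"
    proof (rule ccontr)
      assume n: "\<not> V \<subseteq> W"
      let ?V = "(V \<boxplus> W) \<inter> D"
      have *: "covers Z ?V" "?V \<boxplus> W = V \<boxplus> W"
        using covers_project[OF V(1) rel_compl_sym[OF c] _ n] V Y by auto
      obtain D' where d: "rel_compl Z D ?V D'" by (rule simple_split[OF v(1) *(1) v(2) _ C(2)]) auto
      note d' = rel_complD[OF d]
      have "(V \<boxplus> W) \<boxplus> D' = W \<boxplus> (?V \<boxplus> D')"
        using *(2) sum_comm[of ?V W] sum_assoc[of W ?V D'] d' C by simp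
      also have "\<dots> = Y" using d' C by simp
      finally have Y': "(V \<boxplus> W) \<boxplus> D' = Y" .
      have "(V \<boxplus> W) \<inter> D' = ?V \<inter> D'" using d'(10) by blast
      then have "rel_compl Z Y (V \<boxplus> W) D'" using Y' d' C vv by (simp add: rel_compl_def)
      moreover have "V \<boxplus> W \<subseteq> T" "Z \<subseteq> V \<boxplus> W" "sub (V \<boxplus> W)"
        using V W S vv by (simp_all add: sum_least le_sumI1)
      ultimately have "V \<boxplus> W = W" using max[rule_format, of "V \<boxplus> W"] sum_upper2[OF vv(2) C(1)] by blast
      then show False using n sum_upper1[OF vv(2) C(1)] by simp
    qed
  qed (use W in auto)
  then have "W = T" using W by blast
  then show thesis using c that by blast
qed


section \<open>Infinite sums of simple modules\<close>

definition psum :: "'m set \<Rightarrow> (nat \<Rightarrow> 'm set) \<Rightarrow> nat set \<Rightarrow> 'm set"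
  where "psum K V J = rmod_span R M (K \<union> (\<Union>i\<in>J. V i))"

text \<open>Independence is stated for two arbitrary disjoint index sets because the family is
  regrouped into infinite blocks later. The construction in \<open>not_noeth_indep\<close> yields it
  in this form.\<close>

definition indep :: "'m set \<Rightarrow> (nat \<Rightarrow> 'm set) \<Rightarrow> bool"
  where "indep K V \<longleftrightarrow> (\<forall>i. covers K (V i)) \<and> (\<forall>J J'. J \<inter> J' = {} \<longrightarrow> psum K V J \<inter> psum K V J' = K)"

lemma sub_span: "X \<subseteq> carrier M \<Longrightarrow> sub (rmod_span R M X)"
  unfolding rmod_span_def by (rule sub_Inter) (auto intro: exI[of _ "carrier M"])

lemma span_least: "sub N \<Longrightarrow> X \<subseteq> N \<Longrightarrow> rmod_span R M X \<subseteq> N"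
  unfolding rmod_span_def by auto

lemma span_superset: "X \<subseteq> rmod_span R M X"
  unfolding rmod_span_def by auto

lemma mono_chain:
  fixes N :: "nat \<Rightarrow> 'm set"
  assumes "\<And>n. N n \<subseteq> N (Suc n)" "a \<le> b"
  shows "N a \<subseteq> N b"
  using lift_Suc_mono_le[of N] assms by blast

text \<open>The maximal submodules \<open>Q n\<close> of \<open>Y\<close> contain \<open>N n\<close>
  but not \<open>N (Suc n)\<close>. The simple modules are the intersections \<open>V n\<close> of
  all \<open>Q m\<close> with \<open>m \<noteq> n\<close>, taken modulo the intersection
  \<open>K\<close> of all of them.\<close>

lemma not_noeth_indep:
  assumes v: "simples_split_above Zb" and nn: "\<not> rel_noeth Zb Y" and Y: "sub Y"
  obtains K V where "Zb \<subseteq> K" "indep K V" "\<And>i. V i \<subseteq> Y"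
proof -
  obtain N :: "nat \<Rightarrow> 'm set" where N: "\<And>n. sub (N n)" "\<And>n. Zb \<subseteq> N n" "\<And>n. N n \<subseteq> Y" "\<And>n. N n \<subset> N (Suc n)"
    by (rule not_rel_noethE[OF nn]) blast
  have mono: "a \<le> b \<Longrightarrow> N a \<subseteq> N b" for a b using mono_chain[of N] N(4) by blast
  have "\<exists>Q. covers Q Y \<and> N n \<subseteq> Q \<and> \<not> N (Suc n) \<subseteq> Q" for n
  proof -
    obtain x where x: "x \<in> N (Suc n)" "x \<notin> N n" using N(4)[of n] by blast
    have xc: "x \<in> carrier M" using sub_mem[OF N(1) x(1)] .
    have xx: "x \<in> cyc x \<boxplus> N n" using sum_upper1[OF sub_cyc[OF xc] N(1)] cyc_self[OF xc] by blast
    obtain Q where Q: "covers Q (cyc x \<boxplus> N n)" "N n \<subseteq> Q"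
      by (rule maximal_avoiding[of "N n" "cyc x \<boxplus> N n" x]) (use N(1) xc x xx sum_upper2 in simp_all)
    note q = coversD[OF Q(1)]
    have xY: "cyc x \<boxplus> N n \<subseteq> Y" using cyc_least[OF Y, of x] N(3)[of n] N(3)[of "Suc n"] x(1) by (intro sum_least[OF Y]) auto
    obtain D where d: "rel_compl Q Y (cyc x \<boxplus> N n) D"
      by (rule simple_split[OF v Q(1) _ xY Y]) (use N(2) Q(2) in auto)
    note D = rel_complD[OF d]
    \<comment> \<open>The complement \<open>D\<close> is maximal in \<open>Y\<close>, because
      \<open>Y/D\<close> is isomorphic to the simple module that was split off.\<close>
    have "covers D ((cyc x \<boxplus> N n) \<boxplus> D)" by (rule covers_sumI) (use D Q in simp_all)
    then have "covers D Y" using D(5) by simp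
    moreover have "x \<notin> D"
    proof
      assume "x \<in> D"
      then have "x \<in> Q" using D(6) xx by blast
      then have "cyc x \<boxplus> N n \<subseteq> Q" using q(1) Q(2) by (simp add: sum_least cyc_least)
      then show False using q(3,4) by blast
    qed
    moreover have "N n \<subseteq> D" using D(8) Q(2) by auto
    ultimately have "covers D Y \<and> N n \<subseteq> D \<and> \<not> N (Suc n) \<subseteq> D" using x(1) by auto
    then show ?thesis by (rule exI)
  qed
  then obtain Q where Q: "\<And>n. covers (Q n) Y" "\<And>n. N n \<subseteq> Q n" "\<And>n. \<not> N (Suc n) \<subseteq> Q n" by metis
  have sQ: "sub (Q n)" for n using coversD(1)[OF Q(1)] .
  define W where "W I = (\<Inter>m\<in>I. Q m)" for I
  have sW: "I \<noteq> {} \<Longrightarrow> sub (W I)" for I unfolding W_def by (rule sub_Inter) (use sQ in auto)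
  have WY: "I \<noteq> {} \<Longrightarrow> W I \<subseteq> Y" for I using coversD(3)[OF Q(1)] by (auto simp: W_def)
  define K where "K = W UNIV"
  define V where "V n = W (- {n})" for n
  have ne: "- {n} \<noteq> {}" for n :: nat by (metis ComplI empty_iff n_not_Suc_n singletonD)
  have sV: "sub (V n)" for n unfolding V_def by (rule sW[OF ne])
  have sK: "sub K" unfolding K_def by (rule sW) simp
  \<comment> \<open>This is the crucial point: it makes \<open>V n\<close> strictly larger than
    \<open>K\<close>, although infinitely many submodules are intersected.\<close>
  have Vn: "\<not> V n \<subseteq> Q n" for n
  proof (induction n rule: less_induct)
    case (less n)
    \<comment> \<open>All later \<open>Q m\<close> are treated at once, since they contain
      \<open>N (Suc n)\<close>. The earlier ones are adjoined one at a time, using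
      \<open>V k \<boxplus> Q k = Y\<close> from the induction hypothesis and the modular
      law.\<close>
    have "\<not> W ({..<k} \<union> {n<..}) \<subseteq> Q n" if "k \<le> n" for k
      using that
    proof (induction k)
      case 0
      have "N (Suc n) \<subseteq> Q m" if "m > n" for m using mono[of "Suc n" m] Q(2)[of m] that by auto
      then have "N (Suc n) \<subseteq> W ({..<0} \<union> {n<..})" by (auto simp: W_def)
      then show ?case using Q(3)[of n] by auto
    next
      case (Suc k)
      let ?I = "{..<k} \<union> {n<..}"
      have kn: "k < n" using Suc by simp
      have VkW: "V k \<subseteq> W ?I" using kn by (auto simp: V_def W_def)
      have Vkn: "V k \<subseteq> Q n" using kn by (auto simp: V_def W_def)
      have sI: "sub (W ?I)" "W ?I \<subseteq> Y" by (rule sW, blast, rule WY, blast)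
      have "V k \<boxplus> Q k = Y"
      proof (rule ccontr)
        assume "V k \<boxplus> Q k \<noteq> Y"
        moreover have "V k \<boxplus> Q k \<subseteq> Y" using VkW sI coversD(3)[OF Q(1)] Y by (intro sum_least) auto
        ultimately have "V k \<boxplus> Q k = Q k" using coversD(5)[OF Q(1)] sV sQ by (simp add: sum_upper2)
        then show False using less(1)[OF kn] sum_upper1[OF sV[of k] sQ[of k]] by simp
      qed
      then have "W ?I = V k \<boxplus> (Q k \<inter> W ?I)" using modular[OF sV sQ sI(1) VkW] sI(2) by auto
      moreover have "Q k \<inter> W ?I = W ({..<Suc k} \<union> {n<..})" by (auto simp: W_def less_Suc_eq)
      ultimately have "W ({..<Suc k} \<union> {n<..}) \<subseteq> Q n \<Longrightarrow> W ?I \<subseteq> Q n"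
        using Vkn sQ sum_least by metis
      then show ?case using Suc by auto
    qed
    moreover have "{..<n} \<union> {n<..} = - {n}" by auto
    ultimately show ?case unfolding V_def by (metis order_refl)
  qed
  have KV: "K \<subseteq> V n" for n by (auto simp: K_def V_def W_def)
  have VK: "V n \<inter> Q n = K" for n by (auto simp: K_def V_def W_def)
  have cov: "covers K (V n)" for n
  proof -
    have "V n \<boxplus> Q n = Y"
    proof (rule ccontr)
      assume "V n \<boxplus> Q n \<noteq> Y"
      moreover have "V n \<boxplus> Q n \<subseteq> Y" using WY[OF ne] coversD(3)[OF Q(1)] Y by (intro sum_least) (auto simp: V_def)
      ultimately have "V n \<boxplus> Q n = Q n" using coversD(5)[OF Q(1)] sV sQ by (simp add: sum_upper2)
      then show False using Vn[of n] sum_upper1[OF sV[of n] sQ[of n]] by simp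
    qed
    then have "covers (Q n) (V n \<boxplus> Q n)" using Q(1) by simp
    then show ?thesis using covers_sumD[of "Q n" "V n"] sV VK by simp
  qed
  \<comment> \<open>The maximal submodules separate the family: a sum that omits the index
    \<open>m\<close> lies in \<open>Q m\<close>. For disjoint index sets every \<open>m\<close> is
    omitted by one of the two sums.\<close>
  have le: "psum K V J \<subseteq> Q m" if "m \<notin> J" for J m
    unfolding psum_def using that by (intro span_least) (auto simp: sQ K_def V_def W_def)
  have "psum K V J \<inter> psum K V J' = K" if "J \<inter> J' = {}" for J J'
  proof
    have "psum K V J \<inter> psum K V J' \<subseteq> Q m" for m using le[of m J] le[of m J'] that by blast
    then show "psum K V J \<inter> psum K V J' \<subseteq> K" by (auto simp: K_def W_def)
    show "K \<subseteq> psum K V J \<inter> psum K V J'"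
      using span_superset[of "K \<union> (\<Union>i\<in>J. V i)"] span_superset[of "K \<union> (\<Union>i\<in>J'. V i)"] by (simp add: psum_def)
  qed
  then have "indep K V" using cov by (simp add: indep_def)
  moreover have "V i \<subseteq> Y" for i using WY[OF ne] by (simp add: V_def)
  moreover have "Zb \<subseteq> Q m" for m using N(2)[of m] Q(2)[of m] by simp
  then have "Zb \<subseteq> K" by (auto simp: K_def W_def)
  ultimately show thesis by (intro that)
qed

section \<open>Sums over subsets of an independent family\<close>

context
  fixes K V
  assumes ind: "indep K V"
begin

abbreviation "\<P> J \<equiv> psum K V J"

lemma indep_covers: "covers K (V i)"
  using ind by (simp add: indep_def)

lemmas indep_sub = coversD(1)[OF indep_covers] coversD(2)[OF indep_covers]

lemma psum_Int: "J \<inter> J' = {} \<Longrightarrow> \<P> J \<inter> \<P> J' = K"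
  using ind by (simp add: indep_def)

lemma sub_psum [simp]: "sub (\<P> J)"
  unfolding psum_def by (rule sub_span) (use rsubmodule_subset[OF indep_sub(1)] rsubmodule_subset[OF indep_sub(2)] in blast)

lemma psum_base: "K \<subseteq> \<P> J"
  using span_superset[of "K \<union> (\<Union>i\<in>J. V i)"] by (auto simp: psum_def)

lemma psum_member: "i \<in> J \<Longrightarrow> V i \<subseteq> \<P> J"
  using span_superset[of "K \<union> (\<Union>i\<in>J. V i)"] by (auto simp: psum_def)

lemma psum_least: "sub X \<Longrightarrow> K \<subseteq> X \<Longrightarrow> (\<And>i. i \<in> J \<Longrightarrow> V i \<subseteq> X) \<Longrightarrow> \<P> J \<subseteq> X"
  unfolding psum_def by (rule span_least) auto

lemma psum_mono: "J \<subseteq> J' \<Longrightarrow> \<P> J \<subseteq> \<P> J'"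
  by (rule psum_least) (simp_all add: psum_base psum_member subsetD)

lemma psum_empty: "\<P> {} = K"
  by (rule subset_antisym[OF psum_least psum_base]) (use indep_sub in auto)

lemma psum_Un: "\<P> (J \<union> J') = \<P> J \<boxplus> \<P> J'"
proof
  show "\<P> (J \<union> J') \<subseteq> \<P> J \<boxplus> \<P> J'"
  proof (rule psum_least)
    fix i assume "i \<in> J \<union> J'"
    then show "V i \<subseteq> \<P> J \<boxplus> \<P> J'"
      by (elim UnE) (simp_all add: le_sumI1 le_sumI2 psum_member)
  qed (simp_all add: le_sumI1 psum_base)
  show "\<P> J \<boxplus> \<P> J' \<subseteq> \<P> (J \<union> J')" by (rule sum_least) (simp_all add: psum_mono)
qed

lemma psum_single: "\<P> {i} = V i"
  by (rule subset_antisym[OF psum_least psum_member]) (use indep_sub coversD[OF indep_covers] in auto)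

lemma psum_chain:
  assumes "mono F" "J \<subseteq> (\<Union>n::nat. F n)"
  shows "\<P> J \<subseteq> (\<Union>n. \<P> (F n))"
proof (rule psum_least)
  show "sub (\<Union>n. \<P> (F n))"
    by (rule sub_incseq_Union) (use assms psum_mono in \<open>simp_all add: mono_def\<close>)
  show "K \<subseteq> (\<Union>n. \<P> (F n))" using psum_base by blast
  show "V i \<subseteq> (\<Union>n. \<P> (F n))" if "i \<in> J" for i
    using that assms(2) psum_member by blast
qed

lemma rel_ss_psum: "rel_ss K (\<P> J)"
  by (rule rel_ssI) (use indep_sub psum_base psum_least psum_member indep_covers in simp_all)

lemma rel_noeth_psum: "finite J \<Longrightarrow> rel_noeth K (\<P> J)"
proof (induction J rule: finite_induct)
  case empty
  then show ?case by (simp add: psum_empty rel_noeth_def) (metis subset_antisym)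
next
  case (insert i J)
  have "\<P> (insert i J) = V i \<boxplus> \<P> J" using psum_Un[of "{i}" J] by (simp add: psum_single)
  moreover have "rel_noeth K (V i \<boxplus> \<P> J)"
    by (rule rel_noeth_sum)
      (use indep_sub coversD(3)[OF indep_covers] psum_base insert covers_noeth[OF indep_covers] in simp_all)
  ultimately show ?case by simp
qed

lemma psum_disjoint_le:
  assumes "i \<notin> J" shows "\<not> V i \<subseteq> \<P> J"
proof
  assume "V i \<subseteq> \<P> J"
  then have "V i = K" using psum_Int[of "{i}" J] assms coversD(3)[OF indep_covers] by (auto simp: psum_single)
  then show False using coversD(4)[OF indep_covers] by blast
qed

lemma not_noeth_psum:
  assumes "infinite J" shows "\<not> rel_noeth K (\<P> J)"
proof
  assume "rel_noeth K (\<P> J)"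
  then have "\<exists>k. \<forall>n\<ge>k. \<P> (J \<inter> {..<n}) = \<P> (J \<inter> {..<k})"
    by (rule rel_noethD) (auto simp: psum_base intro!: psum_mono)
  then obtain k where k: "\<And>n. n \<ge> k \<Longrightarrow> \<P> (J \<inter> {..<n}) = \<P> (J \<inter> {..<k})" by blast
  obtain i where i: "i \<in> J" "i \<ge> k" using assms finite_nat_set_iff_bounded[of J] by (metis linorder_not_less)
  have "V i \<subseteq> \<P> (J \<inter> {..<Suc i})" by (rule psum_member) (use i in simp)
  also have "\<dots> = \<P> (J \<inter> {..<k})" using k[of "Suc i"] i by simp
  finally show False using psum_disjoint_le[of i "J \<inter> {..<k}"] i by simp
qed

end

section \<open>Direct sums of essential extensions\<close>

lemma rel_ess_subset: "rel_ess Z N D \<Longrightarrow> D' \<subseteq> D \<Longrightarrow> rel_ess Z N D'"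
  unfolding rel_ess_def by (meson subset_trans)

lemma rel_ess_Int:
  assumes A: "rel_ess Z A A'" and s: "sub A" "sub A'" "sub B" "sub Z" "Z \<subseteq> A" "A \<subseteq> A'" "Z \<subseteq> B" "A \<inter> B = Z"
  shows "A' \<inter> B = Z"
  by (rule rel_essD[OF A]) (use s in auto)

text \<open>An element of \<open>A' \<boxplus> B'\<close> outside \<open>Z\<close> is multiplied
  into \<open>A \<boxplus> B\<close> one component at a time. That \<open>A'\<close> and
  \<open>B'\<close> meet only in \<open>Z\<close> keeps the first multiple outside \<open>Z\<close>,
  and \<open>A \<inter> B = Z\<close> does so for the second.\<close>

lemma rel_ess_sum:
  assumes A: "rel_ess Z A A'" "sub A" "sub A'" "Z \<subseteq> A" "A \<subseteq> A'"
    and B: "rel_ess Z B B'" "sub B" "sub B'" "Z \<subseteq> B" "B \<subseteq> B'"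
    and d: "A \<inter> B = Z" "sub Z"
  shows "A' \<inter> B' = Z" "rel_ess Z (A \<boxplus> B) (A' \<boxplus> B')"
proof -
  have "A' \<inter> B = Z" by (rule rel_ess_Int) (use A B d in simp_all)
  then show dis: "A' \<inter> B' = Z" using rel_ess_Int[of Z B B' A'] A B d by (simp add: Int_commute)
  \<comment> \<open>Essentiality in terms of elements.\<close>
  have key: "\<exists>r\<in>carrier R. x \<triangleleft>\<^bsub>M\<^esub> r \<in> C \<and> x \<triangleleft>\<^bsub>M\<^esub> r \<notin> Z"
    if "rel_ess Z C C'" "sub C" "sub C'" "Z \<subseteq> C" "C \<subseteq> C'" "x \<in> C'" "x \<notin> Z" for C C' x
  proof (rule ccontr)
    assume n: "\<not> ?thesis"
    have x: "x \<in> carrier M" using sub_mem that by blast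
    have "cyc x \<boxplus> Z = Z"
    proof (rule rel_essD[OF that(1)])
      show "(cyc x \<boxplus> Z) \<inter> C \<subseteq> Z"
      proof
        fix y assume y: "y \<in> (cyc x \<boxplus> Z) \<inter> C"
        then obtain r z where r: "r \<in> carrier R" "z \<in> Z" "y = x \<triangleleft>\<^bsub>M\<^esub> r \<oplus>\<^bsub>M\<^esub> z"
          by (auto simp: cyc_def elim!: sum_memE)
        have zc: "z \<in> carrier M" using sub_mem[OF d(2) r(2)] .
        have "y \<oplus>\<^bsub>M\<^esub> (\<ominus>\<^bsub>M\<^esub> z) \<in> C"
          using y r that(4) by (intro rsubmoduleD(2,4)[OF that(2)]) auto
        moreover have "y \<oplus>\<^bsub>M\<^esub> (\<ominus>\<^bsub>M\<^esub> z) = x \<triangleleft>\<^bsub>M\<^esub> r" using r x zc by (simp add: M.a_assoc M.r_neg)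
        ultimately have "x \<triangleleft>\<^bsub>M\<^esub> r \<in> Z" using n r by auto
        then show "y \<in> Z" using r rsubmoduleD(2)[OF d(2)] by simp
      qed
      show "cyc x \<boxplus> Z \<subseteq> C'" using that by (intro sum_least cyc_least) auto
    qed (use x d in \<open>simp_all add: sum_upper2\<close>)
    then show False using that(7) cyc_self[OF x] sum_upper1[OF sub_cyc[OF x] d(2)] by blast
  qed
  show "rel_ess Z (A \<boxplus> B) (A' \<boxplus> B')"
    unfolding rel_ess_def
  proof (intro allI impI, elim conjE)
    fix U assume U: "sub U" "Z \<subseteq> U" "U \<subseteq> A' \<boxplus> B'" "U \<inter> (A \<boxplus> B) \<subseteq> Z"
    have "x \<in> Z" if x: "x \<in> U" for x
    proof (rule ccontr)
      assume xZ: "x \<notin> Z"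
      have "\<exists>y\<in>U. y \<notin> Z \<and> y \<in> A \<boxplus> B'"
      proof -
        have "x \<in> A' \<boxplus> B'" using x U by blast
        then obtain a b where ab: "a \<in> A'" "b \<in> B'" "x = a \<oplus>\<^bsub>M\<^esub> b" by (rule sum_memE)
        have c: "a \<in> carrier M" "b \<in> carrier M" using ab sub_mem A(3) B(3) by blast+
        show ?thesis
        proof (cases "a \<in> Z")
          case True
          then have "x \<in> A \<boxplus> B'" using ab A by (auto intro: sum_memI)
          then show ?thesis using x xZ by blast
        next
          case False
          then obtain r where r: "r \<in> carrier R" "a \<triangleleft>\<^bsub>M\<^esub> r \<in> A" "a \<triangleleft>\<^bsub>M\<^esub> r \<notin> Z"
            using key[OF A(1,2,3,4,5) ab(1)] by blast
          have eq: "x \<triangleleft>\<^bsub>M\<^esub> r = a \<triangleleft>\<^bsub>M\<^esub> r \<oplus>\<^bsub>M\<^esub> b \<triangleleft>\<^bsub>M\<^esub> r" using r c ab by (simp add: ract_l_distr)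
          have bB: "b \<triangleleft>\<^bsub>M\<^esub> r \<in> B'" using rsubmoduleD(3)[OF B(3)] ab r by blast
          have "x \<triangleleft>\<^bsub>M\<^esub> r \<notin> Z"
          proof
            assume "x \<triangleleft>\<^bsub>M\<^esub> r \<in> Z"
            then have "x \<triangleleft>\<^bsub>M\<^esub> r \<oplus>\<^bsub>M\<^esub> (\<ominus>\<^bsub>M\<^esub> (b \<triangleleft>\<^bsub>M\<^esub> r)) \<in> B'"
              using bB B by (intro rsubmoduleD(2,4)[OF B(3)]) auto
            moreover have "x \<triangleleft>\<^bsub>M\<^esub> r \<oplus>\<^bsub>M\<^esub> (\<ominus>\<^bsub>M\<^esub> (b \<triangleleft>\<^bsub>M\<^esub> r)) = a \<triangleleft>\<^bsub>M\<^esub> r"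
              using eq c r by (simp add: M.a_assoc M.r_neg)
            ultimately have "a \<triangleleft>\<^bsub>M\<^esub> r \<in> A' \<inter> B'" using r A by auto
            then show False using dis r by blast
          qed
          moreover have "x \<triangleleft>\<^bsub>M\<^esub> r \<in> U" using rsubmoduleD(3)[OF U(1) x r(1)] .
          moreover have "x \<triangleleft>\<^bsub>M\<^esub> r \<in> A \<boxplus> B'" using eq r bB by (auto intro: sum_memI)
          ultimately show ?thesis by blast
        qed
      qed
      then obtain y where y: "y \<in> U" "y \<notin> Z" "y \<in> A \<boxplus> B'" by blast
      obtain a b where ab: "a \<in> A" "b \<in> B'" "y = a \<oplus>\<^bsub>M\<^esub> b" using y(3) by (rule sum_memE)
      have c: "a \<in> carrier M" "b \<in> carrier M" using ab sub_mem A(2) B(3) by blast+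
      show False
      proof (cases "b \<in> Z")
        case True
        then have "y \<in> A \<boxplus> B" using ab B by (auto intro: sum_memI)
        then show False using y U by blast
      next
        case False
        then obtain r where r: "r \<in> carrier R" "b \<triangleleft>\<^bsub>M\<^esub> r \<in> B" "b \<triangleleft>\<^bsub>M\<^esub> r \<notin> Z"
          using key[OF B(1,2,3,4,5) ab(2)] by blast
        have eq: "y \<triangleleft>\<^bsub>M\<^esub> r = a \<triangleleft>\<^bsub>M\<^esub> r \<oplus>\<^bsub>M\<^esub> b \<triangleleft>\<^bsub>M\<^esub> r" using r c ab by (simp add: ract_l_distr)
        have aA: "a \<triangleleft>\<^bsub>M\<^esub> r \<in> A" using rsubmoduleD(3)[OF A(2)] ab r by blast
        have yU: "y \<triangleleft>\<^bsub>M\<^esub> r \<in> U" using rsubmoduleD(3)[OF U(1) y(1) r(1)] .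
        moreover have "y \<triangleleft>\<^bsub>M\<^esub> r \<in> A \<boxplus> B" using eq r aA by (auto intro: sum_memI)
        ultimately have "y \<triangleleft>\<^bsub>M\<^esub> r \<in> Z" using U(4) by blast
        then have "(\<ominus>\<^bsub>M\<^esub> (a \<triangleleft>\<^bsub>M\<^esub> r)) \<oplus>\<^bsub>M\<^esub> y \<triangleleft>\<^bsub>M\<^esub> r \<in> A"
          using aA A by (intro rsubmoduleD(2,4)[OF A(2)]) auto
        moreover have "(\<ominus>\<^bsub>M\<^esub> (a \<triangleleft>\<^bsub>M\<^esub> r)) \<oplus>\<^bsub>M\<^esub> y \<triangleleft>\<^bsub>M\<^esub> r = b \<triangleleft>\<^bsub>M\<^esub> r"
          using eq c r by (simp add: M.r_neg1)
        ultimately show False using r d(1) by auto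
      qed
    qed
    then show "U = Z" using U(2) by blast
  qed
qed


section \<open>The Osofsky--Smith argument\<close>

lemma rel_CS_closure:
  assumes "rel_CS Z Y" "sub N" "Z \<subseteq> N" "N \<subseteq> Y"
  obtains D D' where "rel_compl Z Y D D'" "N \<subseteq> D" "rel_ess Z N D"
  using assms unfolding rel_CS_def by blast

text \<open>A version of the Osofsky--Smith theorem for V-rings. Closures \<open>C\<^sub>j\<close> of infinitely many infinite
  sums of simple modules would be independent. If \<open>E = xR + P\<close> is a closure of their sum modulo the
  sum \<open>P\<close> of these simple modules, then each \<open>C\<^sub>j\<close> meets \<open>X = xR + K\<close> in a nonzero element of \<open>P\<close>.
  The closure in \<open>X\<close> of a sum of such pieces, finitely many from each \<open>C\<^sub>j\<close>, does not meet the sum of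
  the \<open>C\<^sub>j\<close> outside \<open>P\<close>, although the latter is essential in \<open>E\<close> modulo \<open>P\<close>.\<close>

lemma cyclic_CS_or_noeth_imp_noeth:
  assumes v: "simples_split_above Zb" and cM: "rel_cyclic Zb (carrier M)"
    and good: "\<And>Z Y. Zb \<subseteq> Z \<Longrightarrow> rel_cyclic Z Y \<Longrightarrow> rel_CS Z Y \<or> rel_noeth Z Y"
  shows "rel_noeth Zb (carrier M)"
proof (rule ccontr)
  assume nn: "\<not> rel_noeth Zb (carrier M)"
  obtain K V where ZK: "Zb \<subseteq> K" and ind: "indep K V"
    by (rule not_noeth_indep[OF v nn sub_carrier]) blast
  note isub = indep_sub[OF ind] and Pint = psum_Int[OF ind] and Psub [simp] = sub_psum[OF ind]
    and Pbase [simp] = psum_base[OF ind] and Pmono = psum_mono[OF ind] and PUn = psum_Un[OF ind]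
    and Pchain = psum_chain[OF ind] and Pnn = not_noeth_psum[OF ind] and Pn = rel_noeth_psum[OF ind]
  let ?P = "psum K V"
  have K: "sub K" by (rule isub)
  have PM: "?P J \<subseteq> carrier M" for J by (rule rsubmodule_subset) simp
  have cyc_above: "rel_cyclic Z (carrier M)" if "Zb \<subseteq> Z" "sub Z" for Z
    by (rule rel_cyclic_mono[OF cM that(2,1)]) (rule rsubmodule_subset[OF that(2)])
  \<comment> \<open>A partition of the indices into infinitely many infinite blocks, by the pairing
    function.\<close>
  define I where "I j = range (\<lambda>i. prod_encode (j, i))" for j :: nat
  have I_inf: "infinite (I j)" for j
    unfolding I_def by (subst finite_image_iff) (auto simp: inj_on_def)
  have I_dis: "j \<noteq> k \<Longrightarrow> I j \<inter> I k = {}" for j k by (auto simp: I_def)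
  have I_all: "(\<Union>j. I j) = UNIV"
  proof -
    have "n \<in> I (fst (prod_decode n))" for n
      unfolding I_def by (rule image_eqI[of _ _ "snd (prod_decode n)"]) simp_all
    then show ?thesis by blast
  qed
  define IU where "IU n = (\<Union>j<n. I j)" for n
  have IU_Suc: "IU (Suc n) = IU n \<union> I n" for n by (auto simp: IU_def lessThan_Suc)
  have IU_dis: "IU n \<inter> I n = {}" for n
  proof -
    have "I j \<inter> I n = {}" if "j < n" for j using I_dis[of j n] that by simp
    then show ?thesis by (auto simp: IU_def)
  qed
  have IU_mono: "mono IU" unfolding IU_def by (rule monoI) force
  have IU_all: "(\<Union>n. IU n) = UNIV" using I_all by (auto simp: IU_def)
  have "\<not> rel_noeth K (carrier M)" using rel_noeth_mono[OF _ order_refl PM] Pnn[of UNIV] by auto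
  then have CSK: "rel_CS K (carrier M)" using good[OF ZK cyc_above[OF ZK K]] by simp
  have "\<exists>C C'. rel_compl K (carrier M) C C' \<and> ?P (I j) \<subseteq> C \<and> rel_ess K (?P (I j)) C" for j
    using CSK PM unfolding rel_CS_def by simp
  then obtain C C' where C: "\<And>j. rel_compl K (carrier M) (C j) (C' j)" "\<And>j. ?P (I j) \<subseteq> C j"
    "\<And>j. rel_ess K (?P (I j)) (C j)" by metis
  have sC [simp]: "sub (C j)" and KC: "K \<subseteq> C j" for j using rel_complD[OF C(1)] by blast+
  have cycC: "rel_cyclic K (C j)" for j by (rule rel_cyclic_summand[OF C(1) cyc_above[OF ZK K]])
  \<comment> \<open>\<open>U n\<close> is the sum of \<open>K\<close> and the closures
    \<open>C j\<close> with \<open>j < n\<close>. The independence of the closures is proved along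
    these partial sums.\<close>
  define U where "U = rec_nat K (\<lambda>n A. A \<boxplus> C n)"
  have U0: "U 0 = K" and US: "U (Suc n) = U n \<boxplus> C n" for n by (simp_all add: U_def)
  have sU [simp]: "sub (U n)" for n by (induction n) (simp_all add: U0 US K)
  have U_mono: "mono U" by (rule mono_iff_le_Suc[THEN iffD2]) (simp add: US sum_upper1)
  have KU: "K \<subseteq> U n" for n using monoD[OF U_mono, of 0 n] by (simp add: U0)
  have CU: "C n \<subseteq> U (Suc n)" for n by (simp add: US sum_upper2)
  have PU: "?P (IU n) \<subseteq> U n \<and> rel_ess K (?P (IU n)) (U n)" for n
  proof (induction n)
    case 0
    have "rel_ess K K K" unfolding rel_ess_def by blast
    then show ?case by (simp add: IU_def U0 psum_empty[OF ind])
  next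
    case (Suc n)
    have "rel_ess K (?P (IU n) \<boxplus> ?P (I n)) (U n \<boxplus> C n)"
      by (rule rel_ess_sum(2)) (use Suc C KC KU Pint[OF IU_dis] K in simp_all)
    moreover have "?P (IU n) \<boxplus> ?P (I n) \<subseteq> U n \<boxplus> C n" using Suc C(2) by (simp add: sum_mono)
    ultimately show ?case by (simp add: IU_Suc PUn US)
  qed
  \<comment> \<open>\<open>C n\<close> is independent of the earlier closures together with the
    simple modules of all later blocks, since both sides contain essential sums of simple modules
    over disjoint index sets.\<close>
  have dis: "(U n \<boxplus> ?P (- IU (Suc n))) \<inter> C n = K" for n
  proof (rule rel_ess_sum(1))
    let ?J = "- IU (Suc n)"
    have "rel_ess K (?P (IU n) \<boxplus> ?P ?J) (U n \<boxplus> ?P ?J)"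
    proof (rule rel_ess_sum(2))
      show "rel_ess K (?P ?J) (?P ?J)" unfolding rel_ess_def by (metis Int_absorb2 subset_antisym)
      show "?P (IU n) \<inter> ?P ?J = K" by (rule Pint) (auto simp: IU_Suc)
    qed (use PU KU K in simp_all)
    then show "rel_ess K (?P (IU n \<union> ?J)) (U n \<boxplus> ?P ?J)" by (simp add: PUn)
    show "?P (IU n \<union> ?J) \<inter> ?P (I n) = K" by (rule Pint) (use IU_dis in \<open>auto simp: IU_Suc\<close>)
    show "?P (IU n \<union> ?J) \<subseteq> U n \<boxplus> ?P ?J" using PU by (simp add: PUn sum_mono)
  qed (use C KC K KU in \<open>simp_all add: le_sumI1\<close>)
  define UC where "UC = (\<Union>n. U n)"
  have sUC [simp]: "sub UC" unfolding UC_def by (rule sub_incseq_Union) (use U_mono in simp_all)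
  have PUC: "?P UNIV \<subseteq> UC"
    using Pchain[OF IU_mono, of UNIV] IU_all PU unfolding UC_def by blast
  have CUC: "C j \<subseteq> UC" for j using CU unfolding UC_def by blast
  let ?T = "?P UNIV"
  \<comment> \<open>If the images of the \<open>U n\<close> modulo \<open>?T\<close> became
    stationary at \<open>k\<close>, the modular law would turn \<open>C k\<close> into
    \<open>psum K V (I k)\<close>, a cyclic module that is an infinite sum of simple ones.\<close>
  have "\<not> rel_noeth ?T (carrier M)"
  proof
    assume "rel_noeth ?T (carrier M)"
    then have "\<exists>k. \<forall>n\<ge>k. U n \<boxplus> ?T = U k \<boxplus> ?T"
    proof (rule rel_noethD)
      show "U n \<boxplus> ?T \<subseteq> carrier M" for n by (rule rsubmodule_subset) simp
      show "U n \<boxplus> ?T \<subseteq> U (Suc n) \<boxplus> ?T" for n using monoD[OF U_mono, of n "Suc n"] by (simp add: sum_mono)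
    qed (simp_all add: sum_upper2)
    then obtain k where k: "U (Suc k) \<boxplus> ?T = U k \<boxplus> ?T" using le_Suc_eq by blast
    let ?J = "- IU (Suc k)"
    have "UNIV = IU k \<union> (?J \<union> I k)" by (auto simp: IU_Suc)
    then have T: "?T = ?P (IU k) \<boxplus> (?P ?J \<boxplus> ?P (I k))" by (metis PUn)
    have "C k \<subseteq> U k \<boxplus> ?T" using CU[of k] sum_upper1[of "U (Suc k)" ?T] k by auto
    also have "\<dots> \<subseteq> ?P (I k) \<boxplus> (U k \<boxplus> ?P ?J)"
    proof (rule sum_least)
      have 1: "U k \<subseteq> ?P (I k) \<boxplus> (U k \<boxplus> ?P ?J)" by (simp add: le_sumI1 le_sumI2)
      show "?T \<subseteq> ?P (I k) \<boxplus> (U k \<boxplus> ?P ?J)" unfolding T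
        using subset_trans[OF conjunct1[OF PU[of k]] 1]
        by (simp add: sum_le_iff le_sumI2 sum_upper1 sum_upper2)
    qed (simp_all add: le_sumI1 le_sumI2)
    finally have "C k = (?P (I k) \<boxplus> (U k \<boxplus> ?P ?J)) \<inter> C k" by blast
    also have "\<dots> = ?P (I k) \<boxplus> ((U k \<boxplus> ?P ?J) \<inter> C k)" by (rule modular) (use C(2) in simp_all)
    also have "\<dots> = ?P (I k)" by (simp add: dis K sum_absorb2)
    finally have "rel_cyclic K (?P (I k))" using cycC by metis
    then have "rel_noeth K (?P (I k))" by (rule rel_ss_cyclic_noeth[OF rel_ss_psum[OF ind] _ order_refl])
    then show False using Pnn I_inf by blast
  qed
  moreover have ZT: "Zb \<subseteq> ?T" using ZK Pbase by blast
  ultimately have "rel_CS ?T (carrier M)" using good[OF ZT cyc_above[OF ZT Psub]] by blast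
  then obtain E E' where E: "rel_compl ?T (carrier M) E E'" "UC \<subseteq> E" "rel_ess ?T UC E"
    by (rule rel_CS_closure[OF _ sUC PUC rsubmodule_subset[OF sUC]])
  note E' = rel_complD[OF E(1)]
  obtain x where x: "x \<in> carrier M" "E = cyc x \<boxplus> ?T"
    using rel_cyclic_summand[OF E(1) cyc_above[OF ZT Psub]] by (auto simp: rel_cyclic_def)
  define X where "X = cyc x \<boxplus> K"
  have sX [simp]: "sub X" and KX: "K \<subseteq> X" using x K by (simp_all add: X_def sum_upper2)
  have XT: "X \<boxplus> ?T = E"
    unfolding X_def x(2) using x(1) K by (simp add: sum_assoc sum_absorb)
  have meet: "X \<inter> ?P (I j) \<noteq> K" for j
  proof
    assume eq: "X \<inter> ?P (I j) = K"
    \<comment> \<open>\<open>C j\<close> is cyclic and lies in \<open>X \<boxplus> ?T\<close>, so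
      \<open>X\<close> and finitely many of the simple modules already contain it. The infinite sum
      over \<open>I j\<close> would then be noetherian modulo \<open>X\<close>, so it must meet
      \<open>X\<close> outside \<open>K\<close>.\<close>
    have chain: "\<exists>N\<in>range (\<lambda>n. X \<boxplus> ?P {..<n}). C j \<subseteq> N"
    proof (rule rel_cyclic_le[OF cycC])
      fix y assume "y \<in> C j"
      then have "y \<in> X \<boxplus> ?T" using CUC E(2) XT by blast
      then obtain a t where at: "a \<in> X" "t \<in> ?T" "y = a \<oplus>\<^bsub>M\<^esub> t" by (rule sum_memE)
      have "mono (\<lambda>n::nat. {..<n})" by (auto simp: mono_def)
      then have "?T \<subseteq> (\<Union>n. ?P {..<n})" by (rule Pchain) auto
      then obtain n where "t \<in> ?P {..<n}" using at by blast
      then show "\<exists>N\<in>range (\<lambda>n. X \<boxplus> ?P {..<n}). y \<in> N" using at by (auto intro: sum_memI)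
    next
      show "sub N \<and> K \<subseteq> N" if "N \<in> range (\<lambda>n. X \<boxplus> ?P {..<n})" for N
        using that by (elim rangeE) (simp add: KX le_sumI1)
    qed
    then obtain n where n: "C j \<subseteq> X \<boxplus> ?P {..<n}" by blast
    have "rel_noeth (?P {..<n} \<inter> X) (?P {..<n})"
      by (rule rel_noeth_mono[OF Pn[of "{..<n}"]]) (use KX in simp_all)
    then have "rel_noeth X (?P {..<n} \<boxplus> X)" by (intro rel_noeth_sumI) simp_all
    moreover have "?P (I j) \<boxplus> X \<subseteq> ?P {..<n} \<boxplus> X"
      using C(2)[of j] n sum_comm[of X "?P {..<n}"] by (simp add: sum_least sum_upper2)
    ultimately have "rel_noeth X (?P (I j) \<boxplus> X)" using rel_noeth_mono by blast
    then have "rel_noeth (?P (I j) \<inter> X) (?P (I j))" by (intro rel_noeth_sumD) simp_all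
    then show False using eq Pnn[OF I_inf] by (simp add: Int_commute)
  qed
  have "\<exists>F. finite F \<and> F \<subseteq> I j \<and> X \<inter> ?P F \<noteq> K" for j
  proof -
    obtain y where y: "y \<in> X" "y \<in> ?P (I j)" "y \<notin> K" using meet[of j] KX Pbase by blast
    have "mono (\<lambda>n. I j \<inter> {..<n})" by (auto simp: mono_def)
    then have "?P (I j) \<subseteq> (\<Union>n. ?P (I j \<inter> {..<n}))" by (rule Pchain) auto
    then obtain n where "y \<in> ?P (I j \<inter> {..<n})" using y by blast
    then show ?thesis using y by (intro exI[of _ "I j \<inter> {..<n}"]) auto
  qed
  then obtain F where F: "\<And>j. finite (F j)" "\<And>j. F j \<subseteq> I j" "\<And>j. X \<inter> ?P (F j) \<noteq> K" by metis
  \<comment> \<open>One finite piece of every block. Each \<open>IU n\<close> contains only finitely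
    many of these indices, so every \<open>An n\<close> below is noetherian over \<open>K\<close>,
    while their union \<open>A\<close> is not.\<close>
  define J where "J = (\<Union>j. F j)"
  have JIU: "J \<inter> IU n = (\<Union>j<n. F j)" for n
  proof
    show "J \<inter> IU n \<subseteq> (\<Union>j<n. F j)"
    proof
      fix i assume "i \<in> J \<inter> IU n"
      then obtain j k where *: "i \<in> F j" "k < n" "i \<in> I k" by (auto simp: J_def IU_def)
      then have "j = k" using F(2)[of j] I_dis[of j k] by blast
      then show "i \<in> (\<Union>j<n. F j)" using * by blast
    qed
    show "(\<Union>j<n. F j) \<subseteq> J \<inter> IU n" using F(2) by (fastforce simp: J_def IU_def)
  qed
  have finJ: "finite (J \<inter> IU n)" for n using F(1) by (simp add: JIU)
  define A where "A = X \<inter> ?P J"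
  define An where "An n = X \<inter> ?P (J \<inter> IU n)" for n
  have sA [simp]: "sub A" and sAn [simp]: "sub (An n)" for n by (simp_all add: A_def An_def)
  have KA: "K \<subseteq> A" and KAn: "K \<subseteq> An n" for n using KX by (simp_all add: A_def An_def)
  have AAn: "A = (\<Union>n. An n)"
  proof -
    have "mono (\<lambda>n. J \<inter> IU n)" using IU_mono by (auto simp: mono_def)
    then have "?P J \<subseteq> (\<Union>n. ?P (J \<inter> IU n))" by (rule Pchain) (use IU_all in auto)
    moreover have "?P (J \<inter> IU n) \<subseteq> ?P J" for n by (rule Pmono) auto
    ultimately show ?thesis unfolding A_def An_def by blast
  qed
  have An_noeth: "rel_noeth K (An n)" for n
    by (rule rel_noeth_mono[OF Pn[OF finJ[of n]]]) (auto simp: An_def)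
  have An_ss: "rel_ss K (An n)" for n
    by (rule rel_ss_mono[OF rel_ss_psum[OF ind, of "J \<inter> IU n"]]) (use KAn in \<open>auto simp: An_def\<close>)
  have notA: "\<not> A \<subseteq> An k" for k
  proof
    assume le: "A \<subseteq> An k"
    have "?P (F k) \<subseteq> ?P J" by (rule Pmono) (auto simp: J_def)
    then have "X \<inter> ?P (F k) \<subseteq> ?P (F k) \<inter> ?P (J \<inter> IU k)" using le by (auto simp: A_def An_def)
    also have "\<dots> = K" by (rule Pint) (use F(2)[of k] IU_dis[of k] in blast)
    finally show False using F(3)[of k] KX Pbase by blast
  qed
  have nA: "\<not> rel_noeth K A"
  proof
    assume "rel_noeth K A"
    then have "\<exists>k. \<forall>n\<ge>k. An n = An k"
    proof (rule rel_noethD)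
      show "An n \<subseteq> An (Suc n)" for n
        unfolding An_def using Pmono[of "J \<inter> IU n" "J \<inter> IU (Suc n)"] by (auto simp: IU_Suc)
    qed (use KAn AAn in auto)
    then obtain k where k: "\<And>n. n \<ge> k \<Longrightarrow> An n = An k" by blast
    have "An n \<subseteq> An k" for n
    proof (cases "n \<ge> k")
      case False
      then have "J \<inter> IU n \<subseteq> J \<inter> IU k" using monoD[OF IU_mono, of n k] by auto
      then have "?P (J \<inter> IU n) \<subseteq> ?P (J \<inter> IU k)" by (rule Pmono)
      then show ?thesis by (auto simp: An_def)
    next
      case True
      show ?thesis using k[OF True] by simp
    qed
    then have "A \<subseteq> An k" by (auto simp: AAn)
    then show False using notA by simp
  qed
  have cX: "rel_cyclic K X" unfolding X_def by (rule rel_cyclicI[OF K x(1)])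
  have AX: "A \<subseteq> X" by (simp add: A_def)
  have "\<not> rel_noeth K X" using nA rel_noeth_mono[OF _ order_refl AX] by blast
  then have "rel_CS K X" using good[OF ZK cX] by blast
  then obtain A' A'' where A': "rel_compl K X A' A''" "A \<subseteq> A'" "rel_ess K A A'"
    by (rule rel_CS_closure[OF _ sA KA AX])
  note D = rel_complD[OF A'(1)]
  have cA': "rel_cyclic K A'" by (rule rel_cyclic_summand[OF A'(1) cX])
  \<comment> \<open>\<open>An n\<close> is semisimple and noetherian over \<open>K\<close>, so it
    splits off from \<open>A' \<inter> U n\<close>. The complement meets \<open>A\<close> only in
    \<open>K\<close> and vanishes because \<open>A\<close> is essential in
    \<open>A'\<close>.\<close>
  have small: "A' \<inter> U n = An n" for n
  proof -
    let ?G = "J \<inter> IU n" and ?H = "J - IU n"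
    have "?P J \<inter> U n = (?P ?G \<boxplus> ?P ?H) \<inter> U n"
      using PUn[of ?G ?H] by (simp add: Int_Diff_Un)
    also have "\<dots> = ?P ?G \<boxplus> (?P ?H \<inter> U n)"
      by (rule modular) (use PU[of n] Pmono[of ?G "IU n"] in auto)
    also have "?P ?H \<inter> U n = K"
    proof -
      have "U n \<inter> ?P ?H = K"
        by (rule rel_ess_Int[of _ "?P (IU n)"]) (use PU K Pint[of "IU n" ?H] in auto)
      then show ?thesis by (simp add: Int_commute)
    qed
    finally have PJU: "?P J \<inter> U n = ?P ?G" by (simp add: K sum_absorb2)
    have le: "An n \<subseteq> A' \<inter> U n"
      using PJU A'(2) unfolding A_def An_def by blast
    obtain L where L: "rel_compl K (A' \<inter> U n) (An n) L"
      by (rule noeth_ss_split[OF v ZK An_ss An_noeth le]) (use D in simp)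
    note L' = rel_complD[OF L]
    have "L = K"
    proof (rule rel_essD[OF A'(3)])
      have "L \<inter> A \<subseteq> An n \<inter> L" using PJU L'(10) unfolding A_def An_def by blast
      then show "L \<inter> A \<subseteq> K" using L'(6) by simp
    qed (use L' in auto)
    then show ?thesis using L'(5) KAn by (simp add: K sum_absorb2)
  qed
  have "A' \<inter> UC = A" using small AAn unfolding UC_def by blast
  \<comment> \<open>Modulo \<open>?T\<close> the image of \<open>A'\<close> misses the essential
    submodule \<open>UC\<close> of \<open>E\<close>, so \<open>A'\<close> lies in \<open>?T\<close>.
    Then \<open>A' = A\<close>, and this cyclic module would lie in a single \<open>An n\<close>,
    contrary to \<open>notA\<close>.\<close>
  have "?T \<boxplus> A' = ?T"
  proof (rule rel_essD[OF E(3)])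
    have "(?T \<boxplus> A') \<inter> UC = ?T \<boxplus> (A' \<inter> UC)" by (rule modular) (use D PUC in simp_all)
    also have "\<dots> \<subseteq> ?T"
      unfolding \<open>A' \<inter> UC = A\<close> by (rule sum_least) (use Pmono[of J UNIV] in \<open>auto simp: A_def\<close>)
    finally show "(?T \<boxplus> A') \<inter> UC \<subseteq> ?T" .
    have "X \<subseteq> E" using XT sum_upper1[OF sX Psub] by blast
    then show "?T \<boxplus> A' \<subseteq> E" using D E' by (intro sum_least) auto
  qed (use D in \<open>simp_all add: sum_upper1\<close>)
  then have "A' \<subseteq> UC" using sum_upper2[OF Psub D(1)] PUC by auto
  then have "A' = A" using \<open>A' \<inter> UC = A\<close> by blast
  then have "\<exists>N\<in>range An. A \<subseteq> N" using cA' AAn KAn by (intro rel_cyclic_le[of K]) auto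
  then show False using notA by blast
qed


section \<open>The condition \<open>property_star\<close>\<close>

text \<open>The condition \<open>property_star\<close> for \<open>Y/Z\<close>. The submodule \<open>B'\<close> is a copy in \<open>Y\<close> of the projective module \<open>B/Z\<close>.\<close>

definition rel_star :: "'m set \<Rightarrow> 'm set \<Rightarrow> bool"
  where "rel_star Z Y \<longleftrightarrow> (\<exists>A B B'. rel_compl Z Y A B \<and> (rel_CS Z A \<or> rel_noeth Z A) \<and>
    rel_compl {\<zero>\<^bsub>M\<^esub>} B Z B')"

text \<open>Adding \<open>Zb\<close> to the copy of the projective part turns a complement of
  \<open>Z\<close> over zero into one over \<open>Zb\<close>, by the modular law.\<close>

lemma rel_starE:
  assumes "rel_star Z Y" "sub Zb" "Zb \<subseteq> Z"
  obtains A B B' where "rel_compl Z Y A B" "rel_CS Z A \<or> rel_noeth Z A" "rel_compl Zb B Z B'"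
proof -
  obtain A B B' where *: "rel_compl Z Y A B" "rel_CS Z A \<or> rel_noeth Z A" "rel_compl {\<zero>\<^bsub>M\<^esub>} B Z B'"
    using assms(1) unfolding rel_star_def by blast
  note D = rel_complD[OF *(3)]
  have "Z \<boxplus> (B' \<boxplus> Zb) = B"
  proof -
    have "Z \<boxplus> (B' \<boxplus> Zb) = (Z \<boxplus> B') \<boxplus> Zb" using D assms by (intro sum_assoc[symmetric])
    also have "\<dots> = B \<boxplus> Zb" by (simp only: D(5))
    also have "\<dots> = B" by (rule sum_absorb2) (use D assms in auto)
    finally show ?thesis .
  qed
  moreover have "Z \<inter> (B' \<boxplus> Zb) = Zb"
  proof -
    have "(Zb \<boxplus> B') \<inter> Z = Zb \<boxplus> (B' \<inter> Z)" by (rule modular) (use D assms in simp_all)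
    also have "B' \<inter> Z = {\<zero>\<^bsub>M\<^esub>}" using D(6) by blast
    also have "Zb \<boxplus> {\<zero>\<^bsub>M\<^esub>} = Zb" using assms by (simp add: sum_absorb2 rsubmoduleD)
    finally show ?thesis using sum_comm[of Zb B'] D assms by (simp add: Int_commute)
  qed
  ultimately have "rel_compl Zb B Z (B' \<boxplus> Zb)" using D assms by (simp add: rel_compl_def)
  then show thesis using * that by blast
qed

text \<open>The copy \<open>B'\<close> of the projective part meets the essential submodule \<open>Z\<close> trivially, so it vanishes.\<close>

lemma rel_star_ess:
  assumes "rel_star Z Y" "sub Zb" "Zb \<subseteq> Z" "rel_ess Zb Z Y"
  shows "rel_CS Z Y \<or> rel_noeth Z Y"
proof -
  obtain A B B' where *: "rel_compl Z Y A B" "rel_CS Z A \<or> rel_noeth Z A" "rel_compl Zb B Z B'"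
    by (rule rel_starE[OF assms(1-3)])
  note D = rel_complD[OF *(1)] and D' = rel_complD[OF *(3)]
  have "B' = Zb" by (rule rel_essD[OF assms(4)]) (use D D' in auto)
  then have "B = Z" using D' by (simp add: sum_absorb2)
  then have "A = Y" using D by (simp add: sum_absorb2)
  then show ?thesis using * by blast
qed

section \<open>The quotient by the socle\<close>

lemma rel_ess_mono_left:
  assumes "rel_ess Zb N Y" "N \<subseteq> N'"
  shows "rel_ess Zb N' Y"
  using assms unfolding rel_ess_def by (meson Int_mono order_refl subset_trans)

text \<open>If \<open>K \<supseteq> S\<close> and \<open>M/K\<close> contains an infinite direct sum of simple modules, then so does the
  quotient by the essential submodule \<open>K \<oplus> C\<close>, all of whose cyclic subfactors are CS or noetherian.\<close>

lemma noeth_mod_socle: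
  assumes v: "simples_split_above {\<zero>\<^bsub>M\<^esub>}" and cM: "rel_cyclic {\<zero>\<^bsub>M\<^esub>} (carrier M)"
    and star: "\<And>Z Y. rel_cyclic Z Y \<Longrightarrow> rel_star Z Y"
    and S: "sub S" "\<And>V. covers {\<zero>\<^bsub>M\<^esub>} V \<Longrightarrow> V \<subseteq> S"
  shows "rel_noeth S (carrier M)"
proof (rule ccontr)
  let ?O = "{\<zero>\<^bsub>M\<^esub>}"
  assume nn: "\<not> rel_noeth S (carrier M)"
  obtain K V where SK: "S \<subseteq> K" and ind: "indep K V"
    by (rule not_noeth_indep[OF simples_split_above_mono[OF v sub_zero_le[OF S(1)]] nn sub_carrier]) blast
  let ?P = "psum K V UNIV"
  note P = sub_psum[OF ind, of UNIV] psum_base[OF ind, of UNIV]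
  have K: "sub K" by (rule indep_sub[OF ind])
  have OK: "?O \<subseteq> K" by (rule sub_zero_le[OF K])
  obtain C where C: "sub C" "?O \<subseteq> C" "C \<subseteq> carrier M" "C \<inter> K = ?O"
    and max: "\<And>C'. sub C' \<Longrightarrow> C \<subseteq> C' \<Longrightarrow> C' \<subseteq> carrier M \<Longrightarrow> C' \<inter> K \<subseteq> ?O \<Longrightarrow> C' = C"
    by (rule rel_pseudo_compl[OF sub_zero K sub_carrier OK]) (use sub_zero_le[OF sub_carrier] in blast)+
  let ?E = "K \<boxplus> C"
  have E: "sub ?E" using K C by simp
  have ess: "rel_ess ?O ?E (carrier M)"
    by (rule rel_pseudo_compl_ess[OF C(1) K sub_carrier rsubmodule_subset[OF K] C(3,4) sub_zero max])
  have OE: "?O \<subseteq> ?E" by (rule sub_zero_le[OF E])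
  have "rel_noeth ?E (carrier M)"
  proof (rule cyclic_CS_or_noeth_imp_noeth)
    show "simples_split_above ?E" by (rule simples_split_above_mono[OF v OE])
    show "rel_cyclic ?E (carrier M)" by (rule rel_cyclic_mono[OF cM E OE rsubmodule_subset[OF E]])
    fix Z Y assume Z: "?E \<subseteq> Z" "rel_cyclic Z Y"
    note c = rel_cyclicD[OF Z(2)]
    have "rel_ess ?O Z Y"
      by (rule rel_ess_subset[OF rel_ess_mono_left[OF ess Z(1)] rsubmodule_subset[OF c(2)]])
    then show "rel_CS Z Y \<or> rel_noeth Z Y"
      by (intro rel_star_ess[of Z Y ?O] star Z) (use c sub_zero_le in simp_all)
  qed
  then have "rel_noeth ?E (?P \<boxplus> ?E)"
    by (rule rel_noeth_mono) (use rsubmodule_subset[of "?P \<boxplus> ?E"] P E in simp_all)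
  then have n: "rel_noeth (?P \<inter> ?E) ?P" by (intro rel_noeth_sumD) (use P E in simp_all)
  \<comment> \<open>Otherwise \<open>K \<boxplus> (?P \<inter> C)\<close> contains a simple module
    over \<open>K\<close>. As \<open>C\<close> meets \<open>K\<close> only in zero, that module is
    isomorphic to a simple submodule of \<open>M\<close> inside \<open>C\<close>, which lies in
    \<open>S \<subseteq> K\<close>, a contradiction.\<close>
  have PC: "?P \<inter> C \<subseteq> K"
  proof (rule ccontr)
    assume ne: "\<not> ?P \<inter> C \<subseteq> K"
    let ?W = "K \<boxplus> (?P \<inter> C)"
    have W: "sub ?W" "K \<subseteq> ?W" "?W \<subseteq> ?P" using K P C by (simp_all add: sum_upper1 sum_least)
    have ss: "rel_ss K ?W" by (rule rel_ss_mono[OF rel_ss_psum[OF ind] W])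
    have "\<exists>V. covers K V \<and> V \<subseteq> ?W"
    proof (rule ccontr)
      assume "\<not> ?thesis"
      then have "?W \<subseteq> K" by (intro rel_ss_le[OF ss K]) auto
      then show False using ne sum_upper2[of K "?P \<inter> C"] K P C by auto
    qed
    then obtain V where V: "covers K V" "V \<subseteq> ?W" by blast
    note vd = coversD[OF V(1)]
    let ?V = "V \<inter> (?P \<inter> C)"
    have "V \<subseteq> (?P \<inter> C) \<boxplus> K" using V(2) sum_comm[of K "?P \<inter> C"] K P C by simp
    then have eq: "V = ?V \<boxplus> K" by (intro between_sum_eq) (use K P C vd in simp_all)
    then have "covers K (?V \<boxplus> K)" using V(1) by simp
    then have "covers (?V \<inter> K) ?V" by (rule covers_sumD) (use P C vd in simp)
    moreover have "?V \<inter> K = ?O" using C(4) sub_zero_le[OF K] sub_zero_le[OF vd(2)] sub_zero_le[OF P(1)] sub_zero_le[OF C(1)] by blast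
    ultimately have "?V \<subseteq> S" using S(2) by simp
    then have "?V \<boxplus> K = K" using SK P C vd K by (intro sum_absorb) auto
    then show False using eq vd by simp
  qed
  have "?P \<inter> ?E = K"
  proof -
    have "(K \<boxplus> C) \<inter> ?P = K \<boxplus> (C \<inter> ?P)" by (rule modular) (use K C P in simp_all)
    also have "\<dots> = K" using PC K C P by (intro sum_absorb2) auto
    finally show ?thesis by (simp add: Int_commute)
  qed
  then show False using n not_noeth_psum[OF ind, of UNIV] by simp
qed

section \<open>Finiteness of the socle\<close>

lemma rel_ss_decompose:
  assumes v: "simples_split_above Zb" "Zb \<subseteq> Z" and ss: "rel_ss Z T" and nn: "\<not> rel_noeth Z T"
  obtains A B where "rel_compl Z T A B" "\<not> rel_noeth Z A" "\<not> rel_noeth Z B"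
proof -
  note S = rel_ssD[OF ss]
  obtain K V where ZK: "Z \<subseteq> K" and ind: "indep K V" and VT: "\<And>i. V i \<subseteq> T"
    by (rule not_noeth_indep[OF simples_split_above_mono[OF v] nn S(2)]) blast
  \<comment> \<open>The independent simple modules live over \<open>K\<close>, which may be larger
    than \<open>Z\<close>, so \<open>?B\<close> need not be a complement of \<open>?A\<close> over
    \<open>Z\<close>. It only shows that \<open>T/?A\<close> is not noetherian, which suffices for
    any complement of \<open>?A\<close>.\<close>
  let ?A = "psum K V {i. even i}" and ?B = "psum K V {i. odd i}"
  have K: "sub K" "K \<subseteq> T" using indep_sub[OF ind] coversD(3)[OF indep_covers[OF ind]] VT by blast+
  have sub: "sub ?A" "sub ?B" by (rule sub_psum[OF ind])+
  have le: "?A \<subseteq> T" "?B \<subseteq> T" by (rule psum_least[OF ind S(2) K(2)], rule VT)+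
  have ZA: "Z \<subseteq> ?A" using ZK psum_base[OF ind] by blast
  have inf: "infinite {i::nat. even i}" "infinite {i::nat. odd i}"
    by (metis (mono_tags) finite_nat_set_iff_bounded_le mem_Collect_eq even_Suc Suc_n_not_le_n nat_le_linear le_SucI)+
  have nA: "\<not> rel_noeth Z ?A"
    using not_noeth_psum[OF ind inf(1)] rel_noeth_mono[OF _ ZK order_refl] by blast
  obtain B where B: "rel_compl Z T ?A B" by (rule rel_ss_compl[OF ss sub(1) ZA le(1)])
  note D = rel_complD[OF B]
  have "\<not> rel_noeth Z B"
  proof
    assume "rel_noeth Z B"
    then have "rel_noeth (B \<inter> ?A) B" using D(6) by (simp add: Int_commute)
    then have "rel_noeth ?A (B \<boxplus> ?A)" by (rule rel_noeth_sumI[OF D(2,1)])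
    then have "rel_noeth ?A T" using D sum_comm[OF D(1,2)] by simp
    then have "rel_noeth ?A (?B \<boxplus> ?A)" by (rule rel_noeth_mono) (use le S in \<open>simp_all add: sum_least\<close>)
    then have "rel_noeth (?B \<inter> ?A) ?B" by (rule rel_noeth_sumD[OF sub(2,1)])
    moreover have "?B \<inter> ?A = K" by (rule psum_Int[OF ind]) auto
    ultimately show False using not_noeth_psum[OF ind inf(2)] by simp
  qed
  then show thesis using B nA that by blast
qed

definition rel_uniform :: "'m set \<Rightarrow> 'm set \<Rightarrow> bool"
  where "rel_uniform Z Y \<longleftrightarrow> (\<forall>A B. sub A \<and> sub B \<and> Z \<subseteq> A \<and> Z \<subseteq> B \<and> A \<subseteq> Y \<and> B \<subseteq> Y \<and> A \<inter> B = Z \<longrightarrow>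
    A = Z \<or> B = Z)"

text \<open>Take \<open>U\<close> maximal among the submodules that have a nonzero partner
  \<open>W\<close> meeting them trivially. If \<open>A\<close> and \<open>B\<close> are independent
  in \<open>W\<close> and \<open>B\<close> is nonzero, then \<open>B\<close> is a partner of
  \<open>A \<boxplus> U\<close>, so \<open>A \<subseteq> U\<close> and \<open>A\<close> is zero.
  Here zero means equal to \<open>Z\<close>.\<close>

lemma noeth_uniform:
  assumes n: "rel_noeth Z Y" and s: "sub Z" "sub Y" "Z \<subseteq> Y" "Z \<noteq> Y"
  obtains W where "sub W" "Z \<subseteq> W" "W \<subseteq> Y" "W \<noteq> Z" "rel_uniform Z W"
proof -
  let ?F = "{U. sub U \<and> Z \<subseteq> U \<and> U \<subseteq> Y \<and> (\<exists>W. sub W \<and> Z \<subseteq> W \<and> W \<subseteq> Y \<and> W \<noteq> Z \<and> U \<inter> W = Z)}"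
  have "Z \<in> ?F" using s by (auto intro!: exI[of _ Y])
  then have ne: "?F \<noteq> {}" by (metis empty_iff)
  have "\<exists>U\<in>?F. \<forall>U'\<in>?F. U \<subseteq> U' \<longrightarrow> U' = U" by (rule rel_noeth_max[OF n _ ne]) simp
  then obtain U where U: "U \<in> ?F" and max: "\<forall>U'\<in>?F. U \<subseteq> U' \<longrightarrow> U' = U" by (elim bexE)
  obtain W where W: "sub W" "Z \<subseteq> W" "W \<subseteq> Y" "W \<noteq> Z" "U \<inter> W = Z" using U by blast
  have u: "sub U" "Z \<subseteq> U" "U \<subseteq> Y" using U by simp_all
  have "A = Z \<or> B = Z"
    if AB: "sub A" "sub B" "Z \<subseteq> A" "Z \<subseteq> B" "A \<subseteq> W" "B \<subseteq> W" "A \<inter> B = Z" for A B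
  proof (cases "B = Z")
    case False
    have "(A \<boxplus> U) \<inter> W = A \<boxplus> (U \<inter> W)" by (rule modular) (use AB u W in simp_all)
    also have "\<dots> = A" using W AB s by (simp add: sum_absorb2)
    finally have "(A \<boxplus> U) \<inter> B = Z" using AB by blast
    moreover have "sub (A \<boxplus> U)" "Z \<subseteq> A \<boxplus> U" "A \<boxplus> U \<subseteq> Y" "B \<subseteq> Y"
      using AB u W s by (simp_all add: sum_least le_sumI1)
    ultimately have "A \<boxplus> U \<in> ?F" using AB(2,4) False by blast
    then have "A \<boxplus> U = U" using max[rule_format, of "A \<boxplus> U"] sum_upper2[OF AB(1) u(1)] by simp
    then have "A \<subseteq> U \<inter> W" using sum_upper1[OF AB(1) u(1)] AB by auto
    then have "A = Z" using W(5) AB(3) by simp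
    then show ?thesis ..
  qed simp
  then have "rel_uniform Z W" unfolding rel_uniform_def by blast
  then show thesis using W that by blast
qed

lemma rel_uniform_mono:
  assumes un: "rel_uniform Z Y" "Y' \<subseteq> Y"
  shows "rel_uniform Z Y'"
  unfolding rel_uniform_def
proof (intro allI impI, elim conjE)
  fix A B assume "sub A" "sub B" "Z \<subseteq> A" "Z \<subseteq> B" "A \<subseteq> Y'" "B \<subseteq> Y'" "A \<inter> B = Z"
  then show "A = Z \<or> B = Z"
    using un(1)[unfolded rel_uniform_def, rule_format, of A B] subset_trans[OF _ un(2)] by simp
qed

lemma rel_uniform_sumD:
  assumes un: "rel_uniform E (X \<boxplus> E)" and s: "sub X" "sub E"
  shows "rel_uniform (X \<inter> E) X"
  unfolding rel_uniform_def
proof (intro allI impI, elim conjE)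
  fix A B assume AB: "sub A" "sub B" "X \<inter> E \<subseteq> A" "X \<inter> E \<subseteq> B" "A \<subseteq> X" "B \<subseteq> X" "A \<inter> B = X \<inter> E"
  have eqA: "A = (A \<boxplus> E) \<inter> X" and eqB: "B = (B \<boxplus> E) \<inter> X" using between_Int_eq[of X E] AB s by blast+
  have "(E \<boxplus> A) \<inter> (B \<boxplus> E) = E \<boxplus> (A \<inter> (B \<boxplus> E))" by (rule modular) (use AB s sum_upper2 in simp_all)
  also have "A \<inter> (B \<boxplus> E) = A \<inter> B" using AB eqB by blast
  also have "E \<boxplus> (A \<inter> B) = E" using AB s by (simp add: sum_absorb2)
  finally have "(A \<boxplus> E) \<inter> (B \<boxplus> E) = E" using sum_comm[of E A] AB s by simp
  then have "A \<boxplus> E = E \<or> B \<boxplus> E = E"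
    using un[unfolded rel_uniform_def, rule_format, of "A \<boxplus> E" "B \<boxplus> E"] AB s by (simp add: sum_upper2 sum_mono)
  then show "A = X \<inter> E \<or> B = X \<inter> E" using eqA eqB by blast
qed

text \<open>Let \<open>N/Z\<^sub>b\<close> be the socle of the cyclic module \<open>X/Z\<^sub>b\<close> and let \<open>X/N\<close> be uniform. If \<open>N/Z\<^sub>b\<close> is
  infinite, write \<open>N = S\<^sub>1 + S\<^sub>2\<close> with infinite parts. Uniformity makes the projective part of \<open>X/S\<^sub>1\<close>
  semisimple, so the other part \<open>A/S\<^sub>1\<close> is CS with infinite socle. It splits into two modules that are
  not semisimple, which contradicts uniformity again.\<close>

lemma uniform_mod_socle_imp_noeth:
  assumes v: "simples_split_above Zb" and cX: "rel_cyclic Zb X" and X: "Zb \<subseteq> N" "N \<subseteq> X"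
    and star: "\<And>Z Y. rel_cyclic Z Y \<Longrightarrow> rel_star Z Y"
    and ss: "rel_ss Zb N" and soc: "\<And>V. covers Zb V \<Longrightarrow> V \<subseteq> X \<Longrightarrow> V \<subseteq> N"
    and un: "rel_uniform N X"
  shows "rel_noeth Zb N"
proof (rule ccontr)
  assume nn: "\<not> rel_noeth Zb N"
  note S = rel_ssD[OF ss] and cXd = rel_cyclicD[OF cX]
  obtain S1 S2 where N12: "rel_compl Zb N S1 S2" "\<not> rel_noeth Zb S1" "\<not> rel_noeth Zb S2"
    by (rule rel_ss_decompose[OF v order_refl ss nn])
  note D12 = rel_complD[OF N12(1)]
  have S1X: "S1 \<subseteq> X" using D12 X by blast
  have c1: "rel_cyclic S1 X" by (rule rel_cyclic_mono[OF cX D12(1,7) S1X])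
  obtain A B B1 where AB: "rel_compl S1 X A B" "rel_CS S1 A \<or> rel_noeth S1 A" "rel_compl Zb B S1 B1"
    by (rule rel_starE[OF star[OF c1] S(1) D12(7)])
  note DA = rel_complD[OF AB(1)] and DB = rel_complD[OF AB(3)]
  \<comment> \<open>The copy \<open>B1\<close> of \<open>B/S1\<close> lifts the decomposition of
    \<open>X/S1\<close> to one over \<open>Zb\<close>.\<close>
  have cAB: "rel_compl Zb X A B1"
  proof -
    have "A \<boxplus> B1 = X"
    proof -
      have "A \<boxplus> B1 = (A \<boxplus> S1) \<boxplus> B1" using DA by (simp add: sum_absorb2)
      also have "\<dots> = A \<boxplus> B" using DA DB by (simp add: sum_assoc)
      finally show ?thesis using DA by simp
    qed
    moreover have "A \<inter> B1 = Zb"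
    proof -
      have "A \<inter> B1 = S1 \<inter> B1" using DA(6) DA(7) DB(10) by blast
      then show ?thesis using DB(6) by simp
    qed
    ultimately show ?thesis using DA DB by (simp add: rel_compl_def)
  qed
  note DAB = rel_complD[OF cAB]
  \<comment> \<open>The decomposition stays direct modulo the socle, so by uniformity one summand
    lies in \<open>N\<close>. It cannot be \<open>A\<close>: a cyclic module inside \<open>N\<close>
    is noetherian over \<open>Zb\<close>, but \<open>A\<close> contains \<open>S1\<close>.\<close>
  have "(A \<boxplus> N) \<inter> (B1 \<boxplus> N) = N"
    by (rule rel_ss_disjoint[OF ss cAB X(2), of "N \<inter> A"])
      (use S DAB X soc in \<open>auto dest: subsetD\<close>)
  then have "A \<boxplus> N = N \<or> B1 \<boxplus> N = N"
    using un[unfolded rel_uniform_def, rule_format, of "A \<boxplus> N" "B1 \<boxplus> N"] DAB S X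
    by (simp add: sum_upper2 sum_least)
  moreover have "\<not> A \<subseteq> N"
  proof
    assume "A \<subseteq> N"
    then have "rel_noeth Zb A" using rel_ss_cyclic_noeth[OF ss rel_cyclic_summand[OF cAB cX]] by simp
    then show False using N12(2) rel_noeth_mono[OF _ order_refl DA(7)] by blast
  qed
  ultimately have B1N: "B1 \<subseteq> N" using sum_upper1[OF DAB(1) S(2)] sum_upper1[OF DAB(2) S(2)] by auto
  have nB1: "rel_noeth Zb B1"
    using rel_ss_cyclic_noeth[OF ss rel_cyclic_summand[OF rel_compl_sym[OF cAB] cX] B1N] .
  have "rel_noeth (B1 \<inter> A) B1" using nB1 DAB(6) by (simp add: Int_commute)
  then have "rel_noeth A (B1 \<boxplus> A)" by (rule rel_noeth_sumI[OF DAB(2,1)])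
  then have nXA: "rel_noeth A X" using DAB sum_comm[OF DAB(1,2)] by simp
  have nS1N: "\<not> rel_noeth S1 N"
  proof
    assume "rel_noeth S1 N"
    then have "rel_noeth S1 (S2 \<boxplus> S1)" using D12 sum_comm[OF D12(1,2)] by simp
    then have "rel_noeth (S2 \<inter> S1) S2" by (rule rel_noeth_sumD[OF D12(2,1)])
    then show False using N12(3) D12(6) by (simp add: Int_commute)
  qed
  \<comment> \<open>\<open>?T\<close> is not noetherian over \<open>S1\<close>, because
    \<open>N/?T\<close> embeds in \<open>X/A\<close>, which is isomorphic to the noetherian module
    \<open>B1/Zb\<close>.\<close>
  let ?T = "N \<inter> A"
  have T: "sub ?T" "S1 \<subseteq> ?T" "?T \<subseteq> N" using S DA D12 by auto
  have nT: "\<not> rel_noeth S1 ?T"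
  proof
    assume "rel_noeth S1 ?T"
    moreover have "rel_noeth ?T N"
    proof -
      have "rel_noeth A (N \<boxplus> A)"
        by (rule rel_noeth_mono[OF nXA order_refl]) (use X DA in \<open>simp add: sum_least\<close>)
      then show ?thesis by (rule rel_noeth_sumD[OF S(2) DA(1)])
    qed
    ultimately show False using nS1N rel_noeth_trans[of S1 ?T N] T S by blast
  qed
  have "\<not> rel_noeth S1 A" using nT rel_noeth_mono[OF _ order_refl, of S1 A ?T] by blast
  then have CS: "rel_CS S1 A" using AB(2) by blast
  have ss1: "rel_ss S1 N" using rel_ss_quotient[OF ss D12(1,7)] D12 S by (simp add: sum_absorb2)
  have ssT: "rel_ss S1 ?T" by (rule rel_ss_mono[OF ss1 T])
  obtain P1 P2 where P: "rel_compl S1 ?T P1 P2" "\<not> rel_noeth S1 P1" "\<not> rel_noeth S1 P2"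
    by (rule rel_ss_decompose[OF v D12(7) ssT nT])
  note DP = rel_complD[OF P(1)]
  have P1A: "P1 \<subseteq> A" using DP by blast
  obtain A1 A2 where A12: "rel_compl S1 A A1 A2" "P1 \<subseteq> A1" "rel_ess S1 P1 A1"
    by (rule rel_CS_closure[OF CS DP(1,7) P1A])
  note D = rel_complD[OF A12(1)]
  have cA: "rel_cyclic S1 A" by (rule rel_cyclic_summand[OF AB(1) c1])
  have cA1: "rel_cyclic S1 A1" by (rule rel_cyclic_summand[OF A12(1) cA])
  have cA2: "rel_cyclic S1 A2" by (rule rel_cyclic_summand[OF rel_compl_sym[OF A12(1)] cA])
  have A1N: "\<not> A1 \<subseteq> N"
    using rel_ss_cyclic_noeth[OF ss1 cA1] P(2) rel_noeth_mono[OF _ order_refl A12(2)] by blast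
  \<comment> \<open>\<open>P2\<close> meets the essential extension \<open>A1\<close> of
    \<open>P1\<close> only in \<open>S1\<close>. It therefore embeds modulo \<open>S1\<close> in
    \<open>A/A1\<close>, a copy of \<open>A2/S1\<close>, which then is not noetherian.\<close>
  have A2N: "\<not> A2 \<subseteq> N"
  proof
    assume "A2 \<subseteq> N"
    then have "rel_noeth S1 A2" by (rule rel_ss_cyclic_noeth[OF ss1 cA2])
    then have "rel_noeth (A2 \<inter> A1) A2" using D(6) by (simp add: Int_commute)
    then have "rel_noeth A1 (A2 \<boxplus> A1)" by (rule rel_noeth_sumI[OF D(2,1)])
    then have "rel_noeth A1 A" using D sum_comm[OF D(1,2)] by simp
    then have "rel_noeth A1 (P2 \<boxplus> A1)"
      by (rule rel_noeth_mono[OF _ order_refl]) (rule sum_least[OF D(3) _ D(9)], use DP(10) in blast)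
    then have "rel_noeth (P2 \<inter> A1) P2" by (rule rel_noeth_sumD[OF DP(2) D(1)])
    moreover have "A1 \<inter> P2 = S1" by (rule rel_ess_Int[OF A12(3)]) (use D DP A12 in simp_all)
    ultimately show False using P(3) by (simp add: Int_commute)
  qed
  have cc: "rel_compl S1 X A1 (A2 \<boxplus> B)"
  proof -
    have "A1 \<boxplus> (A2 \<boxplus> B) = X" using D DA by (simp add: sum_assoc[symmetric])
    moreover have "A1 \<inter> (A2 \<boxplus> B) = S1"
    proof -
      have "(A2 \<boxplus> B) \<inter> A = A2 \<boxplus> (B \<inter> A)" by (rule modular) (use D DA in simp_all)
      also have "\<dots> = A2" using D DA by (simp add: Int_commute sum_absorb2)
      finally show ?thesis using D(6,9) by blast
    qed
    ultimately show ?thesis using D DA by (simp add: rel_compl_def)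
  qed
  \<comment> \<open>\<open>P1\<close> is essential in \<open>A1\<close> and so contains all simple
    submodules of \<open>A1/S1\<close>. Hence this decomposition also stays direct modulo
    \<open>N\<close>, although neither summand lies in \<open>N\<close>.\<close>
  have "(A1 \<boxplus> N) \<inter> ((A2 \<boxplus> B) \<boxplus> N) = N"
  proof (rule rel_ss_disjoint[OF ss1 cc X(2)])
    show "V \<subseteq> P1" if V: "covers S1 V" "V \<subseteq> A1" for V
    proof (rule ccontr)
      assume "\<not> V \<subseteq> P1"
      then have "V \<inter> P1 = S1" by (rule covers_Int[OF V(1) DP(1,7)])
      then have "V = S1" using rel_essD[OF A12(3)] coversD[OF V(1)] V(2) by simp
      then show False using coversD[OF V(1)] by simp
    qed
  qed (use DP A12 in auto)
  moreover have "A1 \<boxplus> N \<subseteq> X" "(A2 \<boxplus> B) \<boxplus> N \<subseteq> X" using rel_complD[OF cc] X by (simp_all add: sum_least)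
  ultimately have "A1 \<boxplus> N = N \<or> (A2 \<boxplus> B) \<boxplus> N = N"
    using un[unfolded rel_uniform_def, rule_format, of "A1 \<boxplus> N" "(A2 \<boxplus> B) \<boxplus> N"] D DA S
    by (simp add: sum_upper2)
  moreover have "A2 \<subseteq> (A2 \<boxplus> B) \<boxplus> N" using D DA S by (simp add: le_sumI1)
  ultimately show False using A1N A2N sum_upper1[OF D(1) S(2)] by auto
qed

text \<open>Modulo a pseudo-complement \<open>C\<close> of the socle \<open>S\<close>, every simple
  submodule lies in \<open>S \<boxplus> C\<close>. If this sum were not \<open>M\<close>, some
  \<open>x\<close> outside it would generate a module \<open>?X\<close> over \<open>C\<close> that
  is uniform modulo its part \<open>?N\<close> in \<open>S \<boxplus> C\<close>. By the previous
  theorem \<open>?N\<close> is noetherian over \<open>C\<close> and splits off from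
  \<open>?X\<close>. The complement meets \<open>S\<close> trivially, so it equals \<open>C\<close>
  by maximality and \<open>x\<close> lies in \<open>S \<boxplus> C\<close> after all.\<close>

theorem cyclic_star_imp_noeth:
  assumes v: "simples_split_above {\<zero>\<^bsub>M\<^esub>}" and cM: "rel_cyclic {\<zero>\<^bsub>M\<^esub>} (carrier M)"
    and star: "\<And>Z Y. rel_cyclic Z Y \<Longrightarrow> rel_star Z Y"
  shows "rel_noeth {\<zero>\<^bsub>M\<^esub>} (carrier M)"
proof -
  let ?O = "{\<zero>\<^bsub>M\<^esub>}"
  define S where "S = rmod_span R M (\<Union>{V. covers ?O V})"
  have Vc: "V \<subseteq> carrier M" if "covers ?O V" for V by (rule rsubmodule_subset[OF coversD(2)[OF that]])
  have S: "sub S" unfolding S_def by (rule sub_span) (use Vc in blast)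
  have VS: "V \<subseteq> S" if "covers ?O V" for V
    using span_superset[of "\<Union>{V. covers ?O V}"] that by (auto simp: S_def)
  have ssS: "rel_ss ?O S"
  proof (rule rel_ssI)
    fix W assume W: "sub W" "\<And>V. covers ?O V \<Longrightarrow> V \<subseteq> S \<Longrightarrow> V \<subseteq> W"
    then show "S \<subseteq> W" using VS unfolding S_def by (intro span_least) auto
  qed (use S sub_zero_le in simp_all)
  have nMS: "rel_noeth S (carrier M)" by (rule noeth_mod_socle[OF v cM star S VS])
  obtain C where C: "sub C" "?O \<subseteq> C" "C \<subseteq> carrier M" "C \<inter> S = ?O"
    and max: "\<And>C'. sub C' \<Longrightarrow> C \<subseteq> C' \<Longrightarrow> C' \<subseteq> carrier M \<Longrightarrow> C' \<inter> S \<subseteq> ?O \<Longrightarrow> C' = C"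
    by (rule rel_pseudo_compl[OF sub_zero S sub_carrier sub_zero_le[OF S] sub_zero_le[OF sub_carrier]]) blast
  have vC: "simples_split_above C" by (rule simples_split_above_mono[OF v C(2)])
  let ?E = "S \<boxplus> C"
  have E: "sub ?E" "S \<subseteq> ?E" "C \<subseteq> ?E" using S C by (simp_all add: sum_upper1 sum_upper2)
  have EM: "?E \<subseteq> carrier M" by (rule rsubmodule_subset[OF E(1)])
  have ssE: "rel_ss C ?E" by (rule rel_ss_quotient[OF ssS C(1,2)])
  \<comment> \<open>By maximality of \<open>C\<close> the larger module \<open>V\<close> meets
    \<open>S\<close> nontrivially, hence meets \<open>?E\<close> outside \<open>C\<close>, and
    simplicity of \<open>V/C\<close> gives the inclusion.\<close>
  have socE: "V \<subseteq> ?E" if V: "covers C V" for V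
  proof -
    note vd = coversD[OF V]
    have "\<not> V \<inter> S \<subseteq> ?O"
    proof
      assume "V \<inter> S \<subseteq> ?O"
      then have "V = C" by (rule max[OF vd(2,3) rsubmodule_subset[OF vd(2)]])
      then show False using vd by simp
    qed
    then have "\<not> V \<inter> S \<subseteq> C" using C(4) by blast
    then have "\<not> V \<inter> ?E \<subseteq> C" using E by blast
    then show ?thesis using covers_Int[OF V E(1,3)] by auto
  qed
  have "rel_noeth C ?E"
  proof (cases "?E = carrier M")
    case True
    have "rel_cyclic C ?E" using rel_cyclic_mono[OF cM C(1,2,3)] True by simp
    then show ?thesis by (rule rel_ss_cyclic_noeth[OF ssE]) simp
  next
    case False
    have "rel_noeth ?E (carrier M)" by (rule rel_noeth_mono[OF nMS E(2)]) simp
    then obtain W where W: "sub W" "?E \<subseteq> W" "W \<subseteq> carrier M" "W \<noteq> ?E" "rel_uniform ?E W"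
      by (rule noeth_uniform[OF _ E(1) sub_carrier EM False])
    obtain x where x: "x \<in> W" "x \<notin> ?E" using W by blast
    have xM: "x \<in> carrier M" using x W by blast
    let ?X = "cyc x \<boxplus> C"
    have X: "sub ?X" "C \<subseteq> ?X" "x \<in> ?X"
      using xM C cyc_self[OF xM] sum_upper1[OF sub_cyc[OF xM] C(1)] by (auto simp del: subset_eq simp: sum_upper2)
    let ?N = "?X \<inter> ?E"
    have "?X \<boxplus> ?E \<subseteq> W" using x W E cyc_least[OF W(1)] by (intro sum_least) auto
    then have "rel_uniform ?E (?X \<boxplus> ?E)" by (rule rel_uniform_mono[OF W(5)])
    then have un: "rel_uniform ?N ?X" by (rule rel_uniform_sumD[OF _ X(1) E(1)])
    have ssN: "rel_ss C ?N" by (rule rel_ss_mono[OF ssE]) (use X E in auto)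
    have nN: "rel_noeth C ?N"
    proof (rule uniform_mod_socle_imp_noeth[OF vC _ _ _ star ssN _ un])
      show "rel_cyclic C ?X" by (rule rel_cyclicI[OF C(1) xM])
      show "V \<subseteq> ?N" if "covers C V" "V \<subseteq> ?X" for V using that socE by blast
    qed (use X E in auto)
    obtain L where L: "rel_compl C ?X ?N L" by (rule noeth_ss_split[OF vC order_refl ssN nN _ X(1)]) auto
    note D = rel_complD[OF L]
    have "L \<inter> S \<subseteq> ?O" using D(6,10) E C(4) by blast
    then have "L = C" by (rule max[OF D(2,8) rsubmodule_subset[OF D(2)]])
    then have "?N = ?X" using D by (simp add: sum_absorb2)
    then show ?thesis using X(3) x(2) by blast
  qed
  then have "rel_noeth (S \<inter> C) S" by (rule rel_noeth_sumD[OF S C(1)])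
  then have "rel_noeth ?O S" using C(4) by (simp add: Int_commute)
  then show ?thesis by (rule rel_noeth_trans[OF _ nMS S sub_carrier sub_zero_le[OF S] rsubmodule_subset[OF S]])
qed

end

section \<open>Modules over V-rings\<close>

lemma set_add_submod [simp]: "A <+>\<^bsub>submod M Y\<^esub> B = A <+>\<^bsub>M\<^esub> B"
  by (simp add: set_add_def')

lemma submod_submod [simp]: "submod (submod M Y) N = submod M N"
  by (simp add: submod_def)

lemma (in right_module) rsubmodule_submod_iff:
  assumes Y: "rsubmodule R M Y"
  shows "rsubmodule R (submod M Y) N \<longleftrightarrow> rsubmodule R M N \<and> N \<subseteq> Y"
proof -
  interpret Y: right_module R "submod M Y" by (rule right_module_submod[OF Y])
  show ?thesis
  proof (intro iffI conjI)
    assume N: "rsubmodule R (submod M Y) N"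
    show "N \<subseteq> Y" using Y.rsubmodule_subset[OF N] by simp
    then show "rsubmodule R M N"
      using Y.rsubmoduleD[OF N] rsubmodule_subset[OF Y] by (intro rsubmoduleI) auto
  next
    assume N: "rsubmodule R M N \<and> N \<subseteq> Y"
    then show "rsubmodule R (submod M Y) N"
      using rsubmoduleD[of N] by (intro Y.rsubmoduleI) auto
  qed
qed

section \<open>Transfer of module properties to intervals\<close>

locale module_epi = right_module R M + Q: right_module R Q
  for R :: "('a, 'r) ring_scheme" (structure) and M :: "('a, 'm) rmodule" (structure)
    and Q :: "('a, 'q) rmodule" +
  fixes Y :: "'m set" and \<pi> :: "'m \<Rightarrow> 'q"
  assumes sub_Y [simp]: "rsubmodule R M Y"
    and epi_hom: "\<pi> \<in> rmod_hom R (submod M Y) Q"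
    and epi_surj: "\<pi> ` Y = carrier Q"
begin

definition ker :: "'m set" where "ker = {x \<in> Y. \<pi> x = \<zero>\<^bsub>Q\<^esub>}"

text \<open>With the image under \<open>\<pi>\<close> this is the correspondence between the
  submodules of \<open>Q\<close> and the submodules between \<open>ker\<close> and
  \<open>Y\<close>.\<close>

definition pre :: "'q set \<Rightarrow> 'm set" where "pre N = {x \<in> Y. \<pi> x \<in> N}"

lemma epi_simps [simp]:
  "x \<in> Y \<Longrightarrow> \<pi> x \<in> carrier Q"
  "x \<in> Y \<Longrightarrow> y \<in> Y \<Longrightarrow> \<pi> (x \<oplus>\<^bsub>M\<^esub> y) = \<pi> x \<oplus>\<^bsub>Q\<^esub> \<pi> y"
  "x \<in> Y \<Longrightarrow> r \<in> carrier R \<Longrightarrow> \<pi> (x \<triangleleft>\<^bsub>M\<^esub> r) = \<pi> x \<triangleleft>\<^bsub>Q\<^esub> r"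
  using rmod_homD[OF epi_hom] by simp_all

lemma epi_zero [simp]: "\<pi> \<zero>\<^bsub>M\<^esub> = \<zero>\<^bsub>Q\<^esub>"
  using rmod_hom_zero[OF right_module_submod[OF sub_Y] Q.right_module_axioms epi_hom] by simp

lemma epi_minus [simp]: "x \<in> Y \<Longrightarrow> \<pi> (\<ominus>\<^bsub>M\<^esub> x) = \<ominus>\<^bsub>Q\<^esub> \<pi> x"
  using sub_mem[OF sub_Y, of x] by (simp add: minus_ract Q.minus_ract)

lemma Y_closed [simp]:
  "x \<in> Y \<Longrightarrow> y \<in> Y \<Longrightarrow> x \<oplus>\<^bsub>M\<^esub> y \<in> Y" "x \<in> Y \<Longrightarrow> \<ominus>\<^bsub>M\<^esub> x \<in> Y" "\<zero>\<^bsub>M\<^esub> \<in> Y"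
  "x \<in> Y \<Longrightarrow> r \<in> carrier R \<Longrightarrow> x \<triangleleft>\<^bsub>M\<^esub> r \<in> Y"
  using rsubmoduleD[OF sub_Y] by simp_all

lemma sub_pre: "rsubmodule R Q N \<Longrightarrow> sub (pre N)"
  by (rule rsubmoduleI) (use sub_mem[OF sub_Y] Q.rsubmoduleD[of N] in \<open>auto simp: pre_def\<close>)

lemma pre_zero: "pre {\<zero>\<^bsub>Q\<^esub>} = ker"
  by (simp add: pre_def ker_def)

lemma sub_ker [simp]: "sub ker"
  using sub_pre[OF Q.sub_zero] by (simp add: pre_zero)

lemma ker_le_pre: "rsubmodule R Q N \<Longrightarrow> ker \<subseteq> pre N"
  using Q.rsubmoduleD(1)[of N] by (auto simp: ker_def pre_def)

lemma pre_le: "pre N \<subseteq> Y"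
  by (auto simp: pre_def)

lemma pre_mono: "N \<subseteq> N' \<Longrightarrow> pre N \<subseteq> pre N'"
  by (auto simp: pre_def)

lemma image_pre: "N \<subseteq> carrier Q \<Longrightarrow> \<pi> ` pre N = N"
  using epi_surj by (auto simp: pre_def)

lemma pre_carrier: "pre (carrier Q) = Y"
  by (auto simp: pre_def)

lemma pre_Int: "pre (A \<inter> B) = pre A \<inter> pre B"
  by (auto simp: pre_def)

lemma sub_image:
  assumes N: "sub N" "N \<subseteq> Y"
  shows "rsubmodule R Q (\<pi> ` N)"
proof (rule Q.rsubmoduleI)
  show "\<pi> ` N \<subseteq> carrier Q" using N by auto
  show "\<zero>\<^bsub>Q\<^esub> \<in> \<pi> ` N" using rsubmoduleD(1)[OF N(1)] epi_zero by (metis image_eqI)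
  show "x \<oplus>\<^bsub>Q\<^esub> y \<in> \<pi> ` N" if xy: "x \<in> \<pi> ` N" "y \<in> \<pi> ` N" for x y
  proof -
    obtain a b where ab: "a \<in> N" "b \<in> N" "x = \<pi> a" "y = \<pi> b" using xy by blast
    then have "a \<in> Y" "b \<in> Y" using N by blast+
    then show ?thesis using ab rsubmoduleD(2)[OF N(1)] by (intro image_eqI[of _ _ "a \<oplus>\<^bsub>M\<^esub> b"]) auto
  qed
  show "x \<triangleleft>\<^bsub>Q\<^esub> r \<in> \<pi> ` N" if xr: "x \<in> \<pi> ` N" "r \<in> carrier R" for x r
  proof -
    obtain a where a: "a \<in> N" "x = \<pi> a" using xr(1) by blast
    then have "a \<in> Y" using N by blast
    then show ?thesis using a xr(2) rsubmoduleD(3)[OF N(1)] by (intro image_eqI[of _ _ "a \<triangleleft>\<^bsub>M\<^esub> r"]) auto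
  qed
qed

lemma diff_ker:
  assumes "x \<in> Y" "y \<in> Y" "\<pi> x = \<pi> y"
  shows "x \<oplus>\<^bsub>M\<^esub> (\<ominus>\<^bsub>M\<^esub> y) \<in> ker"
  using assms by (simp add: ker_def Q.M.r_neg)

lemma diff_add:
  assumes "x \<in> Y" "y \<in> Y"
  shows "(x \<oplus>\<^bsub>M\<^esub> (\<ominus>\<^bsub>M\<^esub> y)) \<oplus>\<^bsub>M\<^esub> y = x"
  using assms sub_mem[OF sub_Y] by (simp add: M.a_assoc M.l_neg)

lemma pre_image:
  assumes N: "sub N" "N \<subseteq> Y" "ker \<subseteq> N"
  shows "pre (\<pi> ` N) = N"
proof
  show "pre (\<pi> ` N) \<subseteq> N"
  proof
    fix x assume "x \<in> pre (\<pi> ` N)"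
    then obtain y where y: "x \<in> Y" "y \<in> N" "\<pi> x = \<pi> y" by (auto simp: pre_def)
    then have yY: "y \<in> Y" using N by blast
    have "x \<oplus>\<^bsub>M\<^esub> (\<ominus>\<^bsub>M\<^esub> y) \<in> N" using diff_ker[OF y(1) yY y(3)] N by blast
    then show "x \<in> N" using rsubmoduleD(2)[OF N(1) _ y(2)] diff_add[OF y(1) yY] by metis
  qed
  show "N \<subseteq> pre (\<pi> ` N)" using N by (auto simp: pre_def)
qed

lemma pre_sum:
  assumes A: "rsubmodule R Q A" and B: "rsubmodule R Q B"
  shows "pre (A <+>\<^bsub>Q\<^esub> B) = pre A \<boxplus> pre B"
proof
  show "pre (A <+>\<^bsub>Q\<^esub> B) \<subseteq> pre A \<boxplus> pre B"
  proof
    fix x assume x: "x \<in> pre (A <+>\<^bsub>Q\<^esub> B)"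
    then have "\<pi> x \<in> A <+>\<^bsub>Q\<^esub> B" "x \<in> Y" by (auto simp: pre_def)
    then obtain a b where ab: "a \<in> A" "b \<in> B" "\<pi> x = a \<oplus>\<^bsub>Q\<^esub> b" by (auto elim: Q.sum_memE)
    obtain b' where b': "b' \<in> Y" "\<pi> b' = b" using ab(2) Q.sub_mem[OF B] epi_surj by (metis imageE)
    have c: "a \<in> carrier Q" "b \<in> carrier Q" using ab Q.sub_mem[OF A] Q.sub_mem[OF B] by auto
    have "\<pi> (x \<oplus>\<^bsub>M\<^esub> (\<ominus>\<^bsub>M\<^esub> b')) = a"
      using \<open>x \<in> Y\<close> b' ab c by (simp add: Q.M.a_assoc Q.M.r_neg)
    then have "x \<oplus>\<^bsub>M\<^esub> (\<ominus>\<^bsub>M\<^esub> b') \<in> pre A" "b' \<in> pre B" using \<open>x \<in> Y\<close> b' ab by (auto simp: pre_def)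
    then show "x \<in> pre A \<boxplus> pre B" using sum_memI diff_add[OF \<open>x \<in> Y\<close> b'(1)] by metis
  qed
  show "pre A \<boxplus> pre B \<subseteq> pre (A <+>\<^bsub>Q\<^esub> B)"
    by (auto elim!: sum_memE simp: pre_def intro: Q.sum_memI)
qed

lemma pre_compl:
  assumes N: "rsubmodule R Q N" and c: "internal_direct_sum R (submod Q N) A B"
  shows "rel_compl ker (pre N) (pre A) (pre B)"
proof -
  have AB: "rsubmodule R Q A" "rsubmodule R Q B" "A <+>\<^bsub>Q\<^esub> B = N" "A \<inter> B = {\<zero>\<^bsub>Q\<^esub>}"
    using c by (simp_all add: internal_direct_sum_def Q.rsubmodule_submod_iff[OF N])
  then show ?thesis
    by (simp add: rel_compl_def sub_pre pre_sum[symmetric] pre_Int[symmetric] pre_zero)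
qed

lemma CS_module_pre:
  assumes A: "rsubmodule R Q A" and CS: "CS_module R (submod Q A)"
  shows "rel_CS ker (pre A)"
  unfolding rel_CS_def
proof (intro allI impI, elim conjE)
  fix N assume N: "sub N" "ker \<subseteq> N" "N \<subseteq> pre A"
  have NY: "N \<subseteq> Y" using N(3) pre_le by blast
  have NA: "\<pi> ` N \<subseteq> A" using N(3) by (auto simp: pre_def)
  obtain D D' where D: "internal_direct_sum R (submod Q A) D D'" "essential_in R (submod Q A) (\<pi> ` N) D"
    using CS sub_image[OF N(1) NY] NA
    by (auto simp: CS_module_def Q.rsubmodule_submod_iff[OF A] direct_summand_def)
  have sD: "rsubmodule R Q D" "D \<subseteq> A"
    using D(1) by (auto simp: internal_direct_sum_def Q.rsubmodule_submod_iff[OF A])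
  have "rel_compl ker (pre A) (pre D) (pre D')" by (rule pre_compl[OF A D(1)])
  moreover have "N \<subseteq> pre D" using D(2) NY by (auto simp: essential_in_def pre_def)
  moreover have "rel_ess ker N (pre D)"
    unfolding rel_ess_def
  proof (intro allI impI, elim conjE)
    fix U assume U: "sub U" "ker \<subseteq> U" "U \<subseteq> pre D" "U \<inter> N \<subseteq> ker"
    have UY: "U \<subseteq> Y" using U(3) pre_le by blast
    have "pre (\<pi> ` U \<inter> \<pi> ` N) = U \<inter> N"
      using pre_image[OF U(1) UY U(2)] pre_image[OF N(1) NY N(2)] by (simp add: pre_Int)
    then have "\<pi> ` pre (\<pi> ` U \<inter> \<pi> ` N) \<subseteq> {\<zero>\<^bsub>Q\<^esub>}" using U(4) by (auto simp: ker_def)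
    moreover have "\<pi> ` U \<inter> \<pi> ` N \<subseteq> carrier Q" using UY epi_surj by blast
    ultimately have "\<pi> ` U \<inter> \<pi> ` N \<subseteq> {\<zero>\<^bsub>Q\<^esub>}" by (simp add: image_pre)
    moreover have "\<zero>\<^bsub>Q\<^esub> \<in> \<pi> ` U" "\<zero>\<^bsub>Q\<^esub> \<in> \<pi> ` N"
      using Q.rsubmoduleD(1)[OF sub_image] U(1) UY N(1) NY by simp_all
    ultimately have "\<pi> ` U \<inter> \<pi> ` N = {\<zero>\<^bsub>Q\<^esub>}" by blast
    moreover have "\<pi> ` U \<subseteq> D" using U(3) by (auto simp: pre_def)
    moreover have "rsubmodule R (submod Q A) (\<pi> ` U)"
      using sub_image[OF U(1) UY] \<open>\<pi> ` U \<subseteq> D\<close> sD(2) by (auto simp: Q.rsubmodule_submod_iff[OF A])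
    ultimately have "\<pi> ` U = {\<zero>\<^bsub>Q\<^esub>}" using D(2) by (simp add: essential_in_def)
    then show "U = ker" using pre_image[OF U(1) UY U(2)] pre_zero by simp
  qed
  ultimately show "\<exists>D D'. rel_compl ker (pre A) D D' \<and> N \<subseteq> D \<and> rel_ess ker N D" by blast
qed

lemma noetherian_module_pre:
  assumes A: "rsubmodule R Q A" and n: "noetherian_module R (submod Q A)"
  shows "rel_noeth ker (pre A)"
  unfolding rel_noeth_def
proof (intro allI impI, elim conjE)
  fix N :: "nat \<Rightarrow> 'm set"
  assume N: "\<forall>n. sub (N n) \<and> ker \<subseteq> N n \<and> N n \<subseteq> pre A" and inc: "\<forall>n. N n \<subseteq> N (Suc n)"
  have NY: "N n \<subseteq> Y" for n using N pre_le by blast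
  have "rsubmodule R (submod Q A) (\<pi> ` N n)" for n
    using N NY sub_image by (auto simp: Q.rsubmodule_submod_iff[OF A] pre_def)
  moreover have "\<pi> ` N n \<subseteq> \<pi> ` N (Suc n)" for n by (rule image_mono) (use inc in simp)
  ultimately have "\<exists>k. \<forall>n\<ge>k. \<pi> ` N n = \<pi> ` N k"
    using n unfolding noetherian_module_def by (elim allE[of _ "\<lambda>n. \<pi> ` N n"]) simp
  then obtain k where k: "\<And>n. n \<ge> k \<Longrightarrow> \<pi> ` N n = \<pi> ` N k" by blast
  have eq: "pre (\<pi> ` N n) = N n" for n using N NY by (intro pre_image) auto
  have "N n = N k" if "n \<ge> k" for n
    using arg_cong[OF k[OF that], of pre] by (simp only: eq)
  then show "\<exists>k. \<forall>n\<ge>k. N n = N k" by blast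
qed

text \<open>Projectivity gives a section of the map from \<open>pre B\<close> onto \<open>B\<close>,
  and its image is a complement of the kernel. The universal form of projectivity is needed because
  the elements of \<open>M\<close> and \<open>Q\<close> have unrelated types.\<close>

lemma projective_module_pre:
  assumes B: "rsubmodule R Q B" and p: "projective_module R (submod Q B)"
  obtains B' where "rel_compl {\<zero>\<^bsub>M\<^esub>} (pre B) ker B'"
proof -
  have sB: "sub (pre B)" by (rule sub_pre[OF B])
  have rB: "right_module R (submod Q B)" by (rule Q.right_module_submod[OF B])
  have rP: "right_module R (submod M (pre B))" by (rule right_module_submod[OF sB])
  have "\<pi> \<in> rmod_hom R (submod M (pre B)) (submod Q B)"
    by (auto simp: rmod_hom_def pre_def)
  moreover have "\<pi> ` carrier (submod M (pre B)) = carrier (submod Q B)"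
    using image_pre[OF Q.rsubmodule_subset[OF B]] by simp
  moreover have "(\<lambda>x. x) \<in> rmod_hom R (submod Q B) (submod Q B)" by (simp add: rmod_hom_def)
  ultimately obtain h where h: "h \<in> rmod_hom R (submod Q B) (submod M (pre B))" "\<And>x. x \<in> B \<Longrightarrow> \<pi> (h x) = x"
    using projective_module_universal[OF rB p rP rB] by fastforce
  note H = rmod_homD[OF h(1), simplified]
  have h0: "h \<zero>\<^bsub>Q\<^esub> = \<zero>\<^bsub>M\<^esub>" using rmod_hom_zero[OF rB rP h(1)] by simp
  have sh: "sub (h ` B)"
  proof (rule rsubmoduleI)
    show "h ` B \<subseteq> carrier M" using H(1) sub_mem[OF sB] by blast
    show "\<zero>\<^bsub>M\<^esub> \<in> h ` B" using h0 Q.rsubmoduleD(1)[OF B] by (metis image_eqI)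
    show "x \<oplus>\<^bsub>M\<^esub> y \<in> h ` B" if xy: "x \<in> h ` B" "y \<in> h ` B" for x y
    proof -
      obtain a b where "a \<in> B" "b \<in> B" "x = h a" "y = h b" using xy by blast
      then show ?thesis using H(2) Q.rsubmoduleD(2)[OF B] by (intro image_eqI[of _ _ "a \<oplus>\<^bsub>Q\<^esub> b"]) auto
    qed
    show "x \<triangleleft>\<^bsub>M\<^esub> r \<in> h ` B" if xr: "x \<in> h ` B" "r \<in> carrier R" for x r
    proof -
      obtain a where "a \<in> B" "x = h a" using xr(1) by blast
      then show ?thesis using H(3) xr(2) Q.rsubmoduleD(3)[OF B] by (intro image_eqI[of _ _ "a \<triangleleft>\<^bsub>Q\<^esub> r"]) auto
    qed
  qed
  have hB: "h ` B \<subseteq> pre B" using H(1) by blast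
  have "x \<in> ker \<boxplus> h ` B" if x: "x \<in> pre B" for x
  proof -
    have xY: "x \<in> Y" "\<pi> x \<in> B" using x by (auto simp: pre_def)
    then have hx: "h (\<pi> x) \<in> Y" "\<pi> (h (\<pi> x)) = \<pi> x" using hB pre_le h(2) by blast+
    have "x \<oplus>\<^bsub>M\<^esub> (\<ominus>\<^bsub>M\<^esub> h (\<pi> x)) \<in> ker" using diff_ker[OF xY(1) hx(1)] hx(2) by simp
    then show ?thesis using sum_memI[of _ ker "h (\<pi> x)" "h ` B"] diff_add[OF xY(1) hx(1)] xY by force
  qed
  moreover have "ker \<boxplus> h ` B \<subseteq> pre B" by (rule sum_least[OF sB ker_le_pre[OF B] hB])
  ultimately have "ker \<boxplus> h ` B = pre B" by blast
  moreover have "ker \<inter> h ` B = {\<zero>\<^bsub>M\<^esub>}"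
  proof
    show "ker \<inter> h ` B \<subseteq> {\<zero>\<^bsub>M\<^esub>}" using h(2) h0 by (auto simp: ker_def)
    show "{\<zero>\<^bsub>M\<^esub>} \<subseteq> ker \<inter> h ` B" using rsubmoduleD(1)[OF sh] by (simp add: ker_def)
  qed
  ultimately have "rel_compl {\<zero>\<^bsub>M\<^esub>} (pre B) ker (h ` B)" using sh by (simp add: rel_compl_def)
  then show thesis by (rule that)
qed

lemma property_star_pre:
  assumes "property_star R Q"
  shows "rel_star ker Y"
proof -
  obtain A B where c: "internal_direct_sum R Q A B"
    and A: "CS_module R (submod Q A) \<or> noetherian_module R (submod Q A)"
    and B: "projective_module R (submod Q B)"
    using assms unfolding property_star_def by blast
  have s: "rsubmodule R Q A" "rsubmodule R Q B" using c by (auto simp: internal_direct_sum_def)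
  have "submod Q (carrier Q) = Q" by (simp add: submod_def)
  then have "rel_compl ker Y (pre A) (pre B)"
    using pre_compl[OF Q.sub_carrier, of A B] c by (simp add: pre_carrier)
  moreover obtain B' where "rel_compl {\<zero>\<^bsub>M\<^esub>} (pre B) ker B'"
    by (rule projective_module_pre[OF s(2) B])
  moreover have "rel_CS ker (pre A) \<or> rel_noeth ker (pre A)"
    using A CS_module_pre[OF s(1)] noetherian_module_pre[OF s(1)] by blast
  ultimately show ?thesis unfolding rel_star_def by blast
qed

lemma cyclic_module_epi:
  assumes "rel_cyclic ker Y"
  shows "cyclic_module R Q"
proof -
  obtain y where y: "y \<in> Y" "y \<in> carrier M" "Y = cyc y \<boxplus> ker" by (rule rel_cyclic_obtain[OF assms])
  have "q \<in> (\<lambda>r. \<pi> y \<triangleleft>\<^bsub>Q\<^esub> r) ` carrier R" if q: "q \<in> carrier Q" for q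
  proof -
    obtain x where x: "x \<in> Y" "q = \<pi> x" using q epi_surj by blast
    have "x \<in> cyc y \<boxplus> ker" using x(1) y(3) by blast
    then obtain r z where r: "r \<in> carrier R" "z \<in> ker" "x = y \<triangleleft>\<^bsub>M\<^esub> r \<oplus>\<^bsub>M\<^esub> z"
      by (auto simp: cyc_def elim!: sum_memE)
    have "z \<in> Y" "\<pi> z = \<zero>\<^bsub>Q\<^esub>" using r by (auto simp: ker_def)
    then have "q = \<pi> y \<triangleleft>\<^bsub>Q\<^esub> r" using x r y(1) by simp
    then show ?thesis using r by blast
  qed
  moreover have "(\<lambda>r. \<pi> y \<triangleleft>\<^bsub>Q\<^esub> r) ` carrier R \<subseteq> carrier Q" using y(1) by auto
  ultimately show ?thesis unfolding cyclic_module_def using y(1) epi_simps(1) by blast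
qed

lemma simple_module_epi:
  assumes "covers ker Y"
  shows "simple_module R Q"
  unfolding simple_module_def
proof (intro conjI allI impI)
  note c = coversD[OF assms]
  show "carrier Q \<noteq> {\<zero>\<^bsub>Q\<^esub>}"
  proof
    assume "carrier Q = {\<zero>\<^bsub>Q\<^esub>}"
    then have "Y \<subseteq> ker" using epi_simps(1) by (auto simp: ker_def)
    then show False using c(3,4) by simp
  qed
  fix N assume N: "rsubmodule R Q N"
  have "pre N = ker \<or> pre N = Y" using c(5)[OF sub_pre[OF N] ker_le_pre[OF N] pre_le] by blast
  then have "\<pi> ` pre N = \<pi> ` ker \<or> \<pi> ` pre N = \<pi> ` Y" by blast
  moreover have "\<pi> ` ker = {\<zero>\<^bsub>Q\<^esub>}" by (simp add: pre_zero[symmetric] image_pre)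
  ultimately show "N = {\<zero>\<^bsub>Q\<^esub>} \<or> N = carrier Q"
    using image_pre[OF Q.rsubmodule_subset[OF N]] epi_surj by simp
qed

end

section \<open>Simple subfactors over V-rings\<close>

context right_module
begin

lemma quotient_epi:
  assumes Y: "sub Y" and Z: "sub Z" "Z \<subseteq> Y"
  defines "\<pi> \<equiv> \<lambda>x. Z +>\<^bsub>M\<^esub> x"
  shows "module_epi R M (quotient_module (submod M Y) Z) Y \<pi>"
    "module_epi.ker (quotient_module (submod M Y) Z) Y \<pi> = Z"
proof -
  interpret Y: right_module R "submod M Y" by (rule right_module_submod[OF Y])
  let ?Q = "quotient_module (submod M Y) Z"
  have Z': "rsubmodule R (submod M Y) Z" using Z by (simp add: rsubmodule_submod_iff[OF Y])
  interpret Q: right_module R ?Q by (rule Y.right_module_quotient[OF Z'])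
  have sZ: "subgroup Z (add_monoid (submod M Y))" using Z' by (simp add: rsubmodule_def)
  interpret Z: abelian_subgroup Z "submod M Y"
    by (rule abelian_subgroupI3) (use sZ in \<open>auto simp: additive_subgroup_def intro: Y.M.abelian_group_axioms\<close>)
  have cos: "Z +>\<^bsub>submod M Y\<^esub> x = \<pi> x" for x by (simp add: \<pi>_def a_r_coset_def')
  have hom: "\<pi> \<in> rmod_hom R (submod M Y) ?Q"
    unfolding rmod_hom_def mem_Collect_eq
  proof (intro conjI ballI funcsetI)
    fix x assume x: "x \<in> carrier (submod M Y)"
    show "\<pi> x \<in> carrier ?Q" using x by (auto simp: quotient_module_def A_RCOSETS_def' cos)
    show "\<pi> (x \<triangleleft>\<^bsub>submod M Y\<^esub> r) = \<pi> x \<triangleleft>\<^bsub>?Q\<^esub> r" if "r \<in> carrier R" for r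
      using Y.quotient_ract[OF Z' x that] by (simp add: cos)
    show "\<pi> (x \<oplus>\<^bsub>submod M Y\<^esub> y) = \<pi> x \<oplus>\<^bsub>?Q\<^esub> \<pi> y" if "y \<in> carrier (submod M Y)" for y
      using Z.a_rcos_sum[OF x that] by (simp add: quotient_module_def cos)
  qed
  have surj: "\<pi> ` Y = carrier ?Q" by (auto simp: quotient_module_def A_RCOSETS_def' cos)
  show epi: "module_epi R M ?Q Y \<pi>"
    by (intro module_epi.intro module_epi_axioms.intro right_module_axioms Q.right_module_axioms Y hom surj)
  interpret module_epi R M ?Q Y \<pi> by (rule epi)
  have zero: "\<zero>\<^bsub>?Q\<^esub> = Z" by (simp add: quotient_module_def)
  have "\<pi> x = Z \<longleftrightarrow> x \<in> Z" if "x \<in> Y" for x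
  proof
    assume "\<pi> x = Z"
    then show "x \<in> Z" using Y.M.add.rcos_self[OF _ sZ, of x] that cos[of x] by (simp add: a_r_coset_def)
  next
    assume x: "x \<in> Z"
    show "\<pi> x = Z" using Z.a_rcos_const[OF x] cos[of x] by simp
  qed
  then show "ker = Z" using Z by (auto simp: ker_def zero)
qed

lemma rel_star_quotient:
  assumes "sub Y" "sub Z" "Z \<subseteq> Y" "property_star R (quotient_module (submod M Y) Z)"
  shows "rel_star Z Y"
  using module_epi.property_star_pre[OF quotient_epi(1)[OF assms(1-3)] assms(4)] quotient_epi(2)[OF assms(1-3)] by simp

lemma cyclic_quotient:
  assumes "rel_cyclic Z Y"
  shows "cyclic_module R (quotient_module (submod M Y) Z)"
  using module_epi.cyclic_module_epi[OF quotient_epi(1)[of Y Z]] quotient_epi(2)[of Y Z] assms rel_cyclicD[OF assms]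
  by simp

text \<open>\<open>g\<close> restricts to an isomorphism of \<open>V/Z\<close> with
  \<open>Q\<close>, so every \<open>x\<close> differs from some element of \<open>V\<close> with the
  same image by an element of the kernel.\<close>

lemma kernel_split:
  assumes "right_module R Q" "g \<in> rmod_hom R M Q" "sub V" "g ` V = carrier Q"
    "{x \<in> V. g x = \<zero>\<^bsub>Q\<^esub>} = Z"
  shows "rel_compl Z (carrier M) V {x \<in> carrier M. g x = \<zero>\<^bsub>Q\<^esub>}"
proof -
  interpret Q: right_module R Q by fact
  have surj: "g ` carrier M = carrier Q"
  proof
    show "g ` carrier M \<subseteq> carrier Q" using rmod_homD(1)[OF assms(2)] by auto
    show "carrier Q \<subseteq> g ` carrier M"
      using image_mono[OF rsubmodule_subset[OF assms(3)], of g] assms(4) by simp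
  qed
  have "submod M (carrier M) = M" by (simp add: submod_def)
  then interpret E: module_epi R M Q "carrier M" g
    by (intro module_epi.intro module_epi_axioms.intro right_module_axioms assms sub_carrier surj) (simp_all add: assms)
  have "x \<in> V \<boxplus> E.ker" if x: "x \<in> carrier M" for x
  proof -
    have "g x \<in> g ` V" using x assms(4) by simp
    then obtain v where v: "v \<in> V" "g v = g x" by (metis imageE)
    have vM: "v \<in> carrier M" using sub_mem[OF assms(3) v(1)] .
    have "x \<oplus>\<^bsub>M\<^esub> (\<ominus>\<^bsub>M\<^esub> v) \<in> E.ker" by (rule E.diff_ker) (use x v vM in simp_all)
    then have "(x \<oplus>\<^bsub>M\<^esub> (\<ominus>\<^bsub>M\<^esub> v)) \<oplus>\<^bsub>M\<^esub> v \<in> E.ker \<boxplus> V" by (rule sum_memI[OF _ v(1)])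
    then show ?thesis using E.diff_add[OF x vM] sum_comm[OF assms(3) E.sub_ker] by simp
  qed
  then have "V \<boxplus> E.ker = carrier M" using rsubmodule_subset[of "V \<boxplus> E.ker"] assms(3) by auto
  moreover have "V \<inter> E.ker = Z" using assms(5) rsubmodule_subset[OF assms(3)] by (auto simp: E.ker_def)
  ultimately have "rel_compl Z (carrier M) V E.ker" using assms(3) by (simp add: rel_compl_def)
  then show ?thesis by (simp add: E.ker_def)
qed

lemma covers_cyclic:
  assumes "covers Z V"
  shows "rel_cyclic Z V"
proof -
  note c = coversD[OF assms]
  obtain v where v: "v \<in> V" "v \<notin> Z" using c by blast
  have vM: "v \<in> carrier M" using sub_mem[OF c(2) v(1)] .
  have "cyc v \<boxplus> Z = V"
  proof (rule ccontr)
    assume "cyc v \<boxplus> Z \<noteq> V"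
    moreover have "cyc v \<boxplus> Z \<subseteq> V" by (rule sum_least[OF c(2) cyc_least[OF c(2) v(1)] c(3)])
    ultimately have "cyc v \<boxplus> Z = Z" using c vM by (simp add: sum_upper2)
    then show False using v(2) cyc_self[OF vM] sum_upper1[OF sub_cyc[OF vM] c(1)] by blast
  qed
  then show ?thesis using rel_cyclicI[OF c(1) vM] by simp
qed

text \<open>\<open>right_V_ring\<close> speaks about simple modules on the type of cosets of
  \<open>R\<close>, so \<open>V/Z\<close> is first replaced by an isomorphic \<open>R/A\<close>. By
  injectivity the map from \<open>V\<close> onto \<open>R/A\<close> extends to \<open>M\<close>, and
  the kernel of the extension is the complement.\<close>

lemma V_ring_simples_split:
  assumes V: "right_V_ring R"
  shows "simples_split_above Zb"
  unfolding simples_split_above_def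
proof (intro allI impI, elim conjE)
  fix Z V assume cov: "covers Z V"
  note c = coversD[OF cov]
  let ?Q = "quotient_module (submod M V) Z" and ?\<pi> = "\<lambda>x. Z +>\<^bsub>M\<^esub> x"
  interpret E: module_epi R M ?Q V ?\<pi> by (rule quotient_epi(1)[OF c(2,1,3)])
  have ker: "E.ker = Z" by (rule quotient_epi(2)[OF c(2,1,3)])
  have sQ: "simple_module R ?Q" by (rule E.simple_module_epi) (simp add: ker cov)
  obtain A f where A: "right_ideal R A" and f: "f \<in> rmod_hom R (quotient_module (regular_module R) A) ?Q"
    "bij_betw f (carrier (quotient_module (regular_module R) A)) (carrier ?Q)"
    using cyclic_iso_quotient[OF E.Q.right_module_axioms cyclic_quotient[OF covers_cyclic[OF cov]]]
    unfolding rmod_isomorphic_def by blast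
  let ?A = "quotient_module (regular_module R) A"
  interpret RR: right_module R "regular_module R" by (rule right_module_regular[OF R.ring_axioms])
  interpret A: right_module R ?A by (rule RR.right_module_quotient) (use A in \<open>simp add: right_ideal_def\<close>)
  let ?h = "inv_into (carrier ?A) f"
  note F = rmod_homD[OF f(1)]
  have h1: "?h q \<in> carrier ?A" "f (?h q) = q" if "q \<in> carrier ?Q" for q
    using that f(2) by (metis bij_betw_def inv_into_into, metis bij_betw_def f_inv_into_f)
  have h2: "?h (f a) = a" if "a \<in> carrier ?A" for a
    using that f(2) by (metis bij_betw_def inv_into_f_f)
  have hhom: "?h \<in> rmod_hom R ?Q ?A"
    unfolding rmod_hom_def mem_Collect_eq
  proof (intro conjI ballI funcsetI)
    fix q assume q: "q \<in> carrier ?Q"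
    show "?h q \<in> carrier ?A" using h1 q by simp
    show "?h (q \<triangleleft>\<^bsub>?Q\<^esub> r) = ?h q \<triangleleft>\<^bsub>?A\<^esub> r" if r: "r \<in> carrier R" for r
      using h2[of "?h q \<triangleleft>\<^bsub>?A\<^esub> r"] F(3)[OF h1(1)[OF q] r] h1[OF q] r by simp
    show "?h (q \<oplus>\<^bsub>?Q\<^esub> p) = ?h q \<oplus>\<^bsub>?A\<^esub> ?h p" if p: "p \<in> carrier ?Q" for p
      using h2[of "?h q \<oplus>\<^bsub>?A\<^esub> ?h p"] F(2)[OF h1(1)[OF q] h1(1)[OF p]] h1[OF q] h1[OF p] by simp
  qed
  note H = rmod_homD[OF hhom]
  have h0: "?h \<zero>\<^bsub>?Q\<^esub> = \<zero>\<^bsub>?A\<^esub>" by (rule rmod_hom_zero[OF E.Q.right_module_axioms A.right_module_axioms hhom])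
  have himg: "?h ` carrier ?Q = carrier ?A"
    using f(2) by (metis bij_betw_def bij_betw_inv_into)
  have Aid: "submod ?A (carrier ?A) = ?A" by (simp add: submod_def)
  have "simple_module R ?A"
    unfolding simple_module_def
  proof (intro conjI allI impI)
    have "f ` {\<zero>\<^bsub>?A\<^esub>} = {\<zero>\<^bsub>?Q\<^esub>}"
      using rmod_hom_zero[OF A.right_module_axioms E.Q.right_module_axioms f(1)] by simp
    then show "carrier ?A \<noteq> {\<zero>\<^bsub>?A\<^esub>}"
      using sQ f(2) unfolding simple_module_def bij_betw_def by metis
    interpret F: module_epi R ?A ?Q "carrier ?A" f
      by (intro module_epi.intro module_epi_axioms.intro A.right_module_axioms E.Q.right_module_axioms A.sub_carrier)
        (use f in \<open>simp_all add: Aid bij_betw_def\<close>)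
    fix N assume N: "rsubmodule R ?A N"
    have "rsubmodule R ?Q (f ` N)" by (rule F.sub_image[OF N A.rsubmodule_subset[OF N]])
    then have "f ` N = {\<zero>\<^bsub>?Q\<^esub>} \<or> f ` N = carrier ?Q" using sQ unfolding simple_module_def by blast
    moreover have "?h (f a) = a" if "a \<in> N" for a using h2 A.rsubmodule_subset[OF N] that by blast
    then have "?h ` f ` N = N" by (simp add: image_image)
    ultimately show "N = {\<zero>\<^bsub>?A\<^esub>} \<or> N = carrier ?A" using h0 himg by auto
  qed
  then have "injective_module R ?A"
    using V A.right_module_axioms unfolding right_V_ring_def by blast
  then have inj: "relatively_injective R M ?A"
    by (rule injective_module_universal[OF A.right_module_axioms _ right_module_axioms])
  have "(\<lambda>x. ?h (?\<pi> x)) \<in> rmod_hom R (submod M V) ?A"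
    by (simp add: rmod_hom_def H E.epi_simps Pi_def)
  from inj[unfolded relatively_injective_def, rule_format, OF conjI[OF c(2) this]]
  obtain g where g: "g \<in> rmod_hom R M ?A" "\<And>x. x \<in> V \<Longrightarrow> g x = ?h (?\<pi> x)" by auto
  have "rel_compl Z (carrier M) V {x \<in> carrier M. g x = \<zero>\<^bsub>?A\<^esub>}"
  proof (rule kernel_split[OF A.right_module_axioms g(1) c(2)])
    show "g ` V = carrier ?A"
      using g(2) himg E.epi_surj by (metis (no_types, lifting) image_cong image_image)
    have "g x = \<zero>\<^bsub>?A\<^esub> \<longleftrightarrow> ?\<pi> x = \<zero>\<^bsub>?Q\<^esub>" if "x \<in> V" for x
      using g(2)[OF that] h0 h1(2)[OF E.epi_simps(1)[OF that]] h1(2)[OF E.Q.M.zero_closed] by metis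
    then show "{x \<in> V. g x = \<zero>\<^bsub>?A\<^esub>} = Z" using ker by (auto simp: E.ker_def)
  qed
  then show "\<exists>D. rel_compl Z (carrier M) V D" by blast
qed

section \<open>Noetherian modules and socles in terms of intervals\<close>

lemma rel_noeth_submod:
  assumes Y: "sub Y" "Y' \<subseteq> Y"
  shows "right_module.rel_noeth R (submod M Y) Z Y' \<longleftrightarrow> rel_noeth Z Y'"
proof -
  interpret Y: right_module R "submod M Y" by (rule right_module_submod[OF Y(1)])
  have "Y.sub N \<and> Z \<subseteq> N \<and> N \<subseteq> Y' \<longleftrightarrow> sub N \<and> Z \<subseteq> N \<and> N \<subseteq> Y'" for N
    using Y by (auto simp: rsubmodule_submod_iff)
  then show ?thesis unfolding Y.rel_noeth_def rel_noeth_def by simp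
qed

lemma noetherian_module_iff: "noetherian_module R M \<longleftrightarrow> rel_noeth {\<zero>\<^bsub>M\<^esub>} (carrier M)"
  unfolding noetherian_module_def rel_noeth_def by (meson rsubmodule_subset sub_zero_le)

lemma noetherian_submod_iff:
  assumes "sub Y"
  shows "noetherian_module R (submod M Y) \<longleftrightarrow> rel_noeth {\<zero>\<^bsub>M\<^esub>} Y"
  using right_module.noetherian_module_iff[OF right_module_submod[OF assms]] rel_noeth_submod[OF assms order_refl]
  by simp

lemma covers_zero_iff: "covers {\<zero>\<^bsub>M\<^esub>} V \<longleftrightarrow> sub V \<and> simple_module R (submod M V)"
proof (cases "sub V")
  case True
  then show ?thesis
    using sub_zero_le[OF True] sub_zero_le
    by (auto simp: covers_def simple_module_def rsubmodule_submod_iff[OF True])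
qed (auto simp: covers_def)

text \<open>The simple submodules of \<open>Y\<close> are those of \<open>M\<close> inside
  \<open>Y\<close>, and intersecting with \<open>Y\<close> shows that their span is the same in both
  modules.\<close>

lemma socle_submod:
  assumes Y: "sub Y"
  shows "socle R (submod M Y) = rmod_span R M (\<Union>{V. covers {\<zero>\<^bsub>M\<^esub>} V \<and> V \<subseteq> Y})"
proof -
  let ?X = "\<Union>{V. covers {\<zero>\<^bsub>M\<^esub>} V \<and> V \<subseteq> Y}"
  have "\<Union>{V. rsubmodule R (submod M Y) V \<and> simple_module R (submod (submod M Y) V)} = ?X"
    by (auto simp: rsubmodule_submod_iff[OF Y] covers_zero_iff)
  then have 1: "socle R (submod M Y) = \<Inter>{N. sub N \<and> N \<subseteq> Y \<and> ?X \<subseteq> N}"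
    by (simp add: socle_def rmod_span_def rsubmodule_submod_iff[OF Y] conj_assoc)
  have XY: "?X \<subseteq> Y" by blast
  have "\<Inter>{N. sub N \<and> N \<subseteq> Y \<and> ?X \<subseteq> N} \<subseteq> N" if "sub N" "?X \<subseteq> N" for N
  proof -
    have "N \<inter> Y \<in> {N. sub N \<and> N \<subseteq> Y \<and> ?X \<subseteq> N}" using that Y XY by simp
    then show ?thesis by (meson Int_lower1 Inter_lower subset_trans)
  qed
  then show ?thesis unfolding 1 rmod_span_def by (intro subset_antisym Inter_greatest) (auto simp del: Sup_le_iff)
qed

lemma socle_eq: "socle R M = rmod_span R M (\<Union>{V. covers {\<zero>\<^bsub>M\<^esub>} V})"
proof -
  have "{V. covers {\<zero>\<^bsub>M\<^esub>} V \<and> V \<subseteq> carrier M} = {V. covers {\<zero>\<^bsub>M\<^esub>} V}"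
    using rsubmodule_subset coversD(2) by blast
  then show ?thesis using socle_submod[OF sub_carrier] by (simp add: submod_def)
qed

lemma sub_socle: "sub (socle R M)"
  unfolding socle_eq by (rule sub_span) (use rsubmodule_subset[OF coversD(2)] in blast)

lemma covers_socle: "covers {\<zero>\<^bsub>M\<^esub>} V \<Longrightarrow> V \<subseteq> socle R M"
  using span_superset[of "\<Union>{V. covers {\<zero>\<^bsub>M\<^esub>} V}"] by (auto simp: socle_eq)

lemma rel_ss_socle: "rel_ss {\<zero>\<^bsub>M\<^esub>} (socle R M)"
proof (rule rel_ssI)
  fix W assume W: "sub W" "\<And>V. covers {\<zero>\<^bsub>M\<^esub>} V \<Longrightarrow> V \<subseteq> socle R M \<Longrightarrow> V \<subseteq> W"
  then show "socle R M \<subseteq> W" using covers_socle unfolding socle_eq by (intro span_least) blast+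
qed (use sub_socle sub_zero_le in simp_all)

section \<open>Finitely generated modules over V-rings\<close>

lemma span_insert:
  assumes "x \<in> carrier M" "X \<subseteq> carrier M"
  shows "rmod_span R M (insert x X) = cyc x \<boxplus> rmod_span R M X"
proof
  note s = sub_cyc[OF assms(1)] sub_span[OF assms(2)]
  show "rmod_span R M (insert x X) \<subseteq> cyc x \<boxplus> rmod_span R M X"
    using cyc_self[OF assms(1)] sum_upper1[OF s] sum_upper2[OF s] span_superset[of X] s
    by (intro span_least) auto
  have "sub (rmod_span R M (insert x X))" using assms by (intro sub_span) simp
  then show "cyc x \<boxplus> rmod_span R M X \<subseteq> rmod_span R M (insert x X)"
    using span_superset[of "insert x X"] by (intro sum_least cyc_least span_least) auto
qed

lemma noeth_span_finite:
  assumes "finite X" "X \<subseteq> carrier M" "\<And>x. x \<in> carrier M \<Longrightarrow> rel_noeth {\<zero>\<^bsub>M\<^esub>} (cyc x)"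
  shows "rel_noeth {\<zero>\<^bsub>M\<^esub>} (rmod_span R M X)"
  using assms(1,2)
proof (induction X rule: finite_induct)
  case empty
  have "rmod_span R M {} \<subseteq> {\<zero>\<^bsub>M\<^esub>}" by (rule span_least) simp_all
  moreover have "rel_noeth {\<zero>\<^bsub>M\<^esub>} {\<zero>\<^bsub>M\<^esub>}" unfolding rel_noeth_def by (metis subset_antisym)
  ultimately show ?case using rel_noeth_mono by blast
next
  case (insert x X)
  then have "rel_noeth {\<zero>\<^bsub>M\<^esub>} (cyc x \<boxplus> rmod_span R M X)"
    using assms(3) sub_zero_le sub_span by (intro rel_noeth_sum) simp_all
  then show ?case using insert by (simp add: span_insert)
qed

text \<open>\<open>M\<close> is a finite sum of cyclic submodules. The cyclic theorem applies to
  each of them, since their cyclic subfactors are cyclic subfactors of \<open>M\<close>.\<close>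

lemma cyclic_subfactors_star_imp_noeth:
  assumes V: "right_V_ring R" and fg: "finitely_generated_module R M"
    and star: "\<And>Y Z. sub Y \<Longrightarrow> sub Z \<Longrightarrow> Z \<subseteq> Y \<Longrightarrow> cyclic_module R (quotient_module (submod M Y) Z) \<Longrightarrow>
      property_star R (quotient_module (submod M Y) Z)"
  shows "noetherian_module R M"
proof -
  have "rel_noeth {\<zero>\<^bsub>M\<^esub>} (cyc x)" if x: "x \<in> carrier M" for x
  proof -
    have s: "sub (cyc x)" using x by simp
    interpret Y: right_module R "submod M (cyc x)" by (rule right_module_submod[OF s])
    have "Y.rel_noeth {\<zero>\<^bsub>submod M (cyc x)\<^esub>} (carrier (submod M (cyc x)))"
    proof (rule Y.cyclic_star_imp_noeth)
      show "Y.simples_split_above {\<zero>\<^bsub>submod M (cyc x)\<^esub>}" by (rule Y.V_ring_simples_split[OF V])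
      have "cyc x \<boxplus> {\<zero>\<^bsub>M\<^esub>} = cyc x" using s by (simp add: sum_absorb2 rsubmoduleD)
      moreover have "Y.cyc x = cyc x" unfolding Y.cyc_def by (simp add: cyc_def)
      ultimately have "cyc x = Y.cyc x \<boxplus> {\<zero>\<^bsub>M\<^esub>}" by simp
      then show "Y.rel_cyclic {\<zero>\<^bsub>submod M (cyc x)\<^esub>} (carrier (submod M (cyc x)))"
        using cyc_self[OF x] Y.sub_zero by (auto simp: Y.rel_cyclic_def)
      fix Z Y' assume c: "Y.rel_cyclic Z Y'"
      note d = Y.rel_cyclicD[OF c]
      have "cyclic_module R (quotient_module (submod M Y') Z)" using Y.cyclic_quotient[OF c] by simp
      then have "property_star R (quotient_module (submod M Y') Z)"
        using d by (intro star) (simp_all add: rsubmodule_submod_iff[OF s])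
      then show "Y.rel_star Z Y'" using Y.rel_star_quotient[OF d(2,1,3)] by simp
    qed
    then show ?thesis using rel_noeth_submod[OF s order_refl] by simp
  qed
  moreover obtain X where "finite X" "X \<subseteq> carrier M" "rmod_span R M X = carrier M"
    using fg unfolding finitely_generated_module_def by blast
  ultimately show ?thesis using noeth_span_finite[of X] by (simp add: noetherian_module_iff)
qed

text \<open>The socle is noetherian and semisimple, so it splits off, and a complement contains no
  simple submodule.\<close>

lemma V_ring_noeth_decompose:
  assumes V: "right_V_ring R" and n: "noetherian_module R M"
  obtains T where "internal_direct_sum R M (socle R M) T" "semisimple_module R (submod M (socle R M))"
    "noetherian_module R (submod M T)" "socle R (submod M T) = {\<zero>\<^bsub>M\<^esub>}"
proof -
  let ?O = "{\<zero>\<^bsub>M\<^esub>}" and ?S = "socle R M"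
  have n': "rel_noeth ?O (carrier M)" using n by (simp add: noetherian_module_iff)
  have "rel_noeth ?O ?S" by (rule rel_noeth_mono[OF n' order_refl rsubmodule_subset[OF sub_socle]])
  then obtain T where T: "rel_compl ?O (carrier M) ?S T"
    by (rule noeth_ss_split[OF V_ring_simples_split[OF V] order_refl rel_ss_socle _ rsubmodule_subset[OF sub_socle] sub_carrier])
  note D = rel_complD[OF T]
  have "{V. covers ?O V \<and> V \<subseteq> ?S} = {V. covers ?O V}" using covers_socle by blast
  then have "semisimple_module R (submod M ?S)"
    by (simp add: semisimple_module_def socle_submod[OF sub_socle] socle_eq[symmetric])
  moreover have "noetherian_module R (submod M T)"
    using rel_noeth_mono[OF n' order_refl rsubmodule_subset[OF D(2)]] by (simp add: noetherian_submod_iff[OF D(2)])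
  moreover have "socle R (submod M T) = ?O"
  proof -
    have "False" if "covers ?O V" "V \<subseteq> T" for V
      using covers_socle[OF that(1)] that(2) D(6) coversD(3,4)[OF that(1)] by blast
    then have "\<Union>{V. covers ?O V \<and> V \<subseteq> T} = {}" by blast
    then have "socle R (submod M T) \<subseteq> ?O" unfolding socle_submod[OF D(2)] by (intro span_least) auto
    moreover have "?O \<subseteq> socle R (submod M T)"
      unfolding socle_submod[OF D(2)]
      by (rule sub_zero_le[OF sub_span]) (use rsubmodule_subset[OF D(2)] in blast)
    ultimately show ?thesis by blast
  qed
  moreover have "internal_direct_sum R M ?S T" using D by (simp add: internal_direct_sum_def)
  ultimately show thesis using that by blast
qed

end

section \<open>WV-rings\<close>

lemma submod_carrier [simp]: "submod M (carrier M) = M"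
  by (simp add: submod_def)

section \<open>Cyclic modules over right noetherian rings\<close>

lemma noetherian_module_image:
  assumes "right_module R M" "right_module R N" "f \<in> rmod_hom R M N" "f ` carrier M = carrier N"
    and n: "noetherian_module R M"
  shows "noetherian_module R N"
proof -
  interpret M: right_module R M by fact
  interpret N: right_module R N by fact
  interpret E: module_epi R M N "carrier M" f
    by (intro module_epi.intro module_epi_axioms.intro assms M.sub_carrier) (simp_all add: assms)
  show ?thesis
    unfolding noetherian_module_def
  proof (intro allI impI, elim conjE)
    fix C :: "nat \<Rightarrow> _ set"
    assume C: "\<forall>n. rsubmodule R N (C n)" "\<forall>n. C n \<subseteq> C (Suc n)"
    have "(\<forall>n. rsubmodule R M (E.pre (C n))) \<and> (\<forall>n. E.pre (C n) \<subseteq> E.pre (C (Suc n)))"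
      using C E.sub_pre E.pre_mono by simp
    then have "\<exists>k. \<forall>n\<ge>k. E.pre (C n) = E.pre (C k)"
      using n unfolding noetherian_module_def by (elim allE[of _ "\<lambda>n. E.pre (C n)"]) simp
    then obtain k where k: "\<And>n. n \<ge> k \<Longrightarrow> E.pre (C n) = E.pre (C k)" by blast
    have "C n = f ` E.pre (C n)" for n using E.image_pre[OF N.rsubmodule_subset] C(1) by simp
    then show "\<exists>k. \<forall>n\<ge>k. C n = C k" using k by metis
  qed
qed

lemma projective_zero_submod:
  assumes "right_module R N"
  shows "projective_module R (submod N {\<zero>\<^bsub>N\<^esub>})"
  unfolding projective_module_def
proof (intro allI impI, elim conjE)
  fix A L g f
  assume A: "right_module R A" "right_module R L" "g \<in> rmod_hom R A L" and f: "f \<in> rmod_hom R (submod N {\<zero>\<^bsub>N\<^esub>}) L"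
  interpret N: right_module R N by fact
  interpret A: right_module R A by fact
  have r: "right_module R (submod N {\<zero>\<^bsub>N\<^esub>})" by (rule N.right_module_submod) simp
  have "(\<lambda>_. \<zero>\<^bsub>A\<^esub>) \<in> rmod_hom R (submod N {\<zero>\<^bsub>N\<^esub>}) A" by (simp add: rmod_hom_def)
  moreover have "g \<zero>\<^bsub>A\<^esub> = f \<zero>\<^bsub>N\<^esub>"
    using rmod_hom_zero[OF A] rmod_hom_zero[OF r A(2) f] by simp
  ultimately show "\<exists>h\<in>rmod_hom R (submod N {\<zero>\<^bsub>N\<^esub>}) A. \<forall>x\<in>carrier (submod N {\<zero>\<^bsub>N\<^esub>}). g (h x) = f x"
    by (intro bexI[of _ "\<lambda>_. \<zero>\<^bsub>A\<^esub>"]) simp_all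
qed

text \<open>Take the zero module as the projective summand.\<close>

lemma noetherian_property_star:
  assumes "right_module R N" "noetherian_module R N"
  shows "property_star R N"
proof -
  interpret N: right_module R N by fact
  have "internal_direct_sum R N (carrier N) {\<zero>\<^bsub>N\<^esub>}"
    by (auto simp: internal_direct_sum_def N.sum_absorb2)
  then show ?thesis
    using assms projective_zero_submod[OF assms(1)] unfolding property_star_def by (metis submod_carrier)
qed

lemma right_noetherian_every_cyclic_has_star:
  assumes "right_noetherian_ring R"
  shows "every_cyclic_has_star R"
  unfolding every_cyclic_has_star_def
proof (intro allI impI, elim conjE)
  fix N :: "('a, 'a set) rmodule"
  assume N: "right_module R N" "cyclic_module R N"
  interpret N: right_module R N by fact
  have R: "ring R" "noetherian_module R (regular_module R)" using assms by (auto simp: right_noetherian_ring_def)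
  obtain x where x: "x \<in> carrier N" "carrier N = (\<lambda>r. x \<triangleleft>\<^bsub>N\<^esub> r) ` carrier R"
    using N(2) unfolding cyclic_module_def by blast
  have "noetherian_module R N"
    by (rule noetherian_module_image[OF right_module_regular[OF R(1)] N(1) _ _ R(2), of "\<lambda>r. x \<triangleleft>\<^bsub>N\<^esub> r"])
      (use x in \<open>auto simp: rmod_hom_def N.ract_r_distr N.ract_assoc\<close>)
  then show "property_star R N" by (rule noetherian_property_star[OF N(1)])
qed

context right_module
begin

text \<open>A chain that ever leaves \<open>Z\<close> runs from then on above some
  \<open>A \<noteq> Z\<close>. This reduces the chain condition to the proper quotients of
  \<open>Y/Z\<close>.\<close>

lemma rel_noeth_stepI:
  assumes "\<And>A. sub A \<Longrightarrow> Z \<subseteq> A \<Longrightarrow> A \<subseteq> Y \<Longrightarrow> A \<noteq> Z \<Longrightarrow> rel_noeth A Y"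
  shows "rel_noeth Z Y"
  unfolding rel_noeth_def
proof (intro allI impI, elim conjE)
  fix N :: "nat \<Rightarrow> 'm set"
  assume N: "\<forall>n. sub (N n) \<and> Z \<subseteq> N n \<and> N n \<subseteq> Y" and inc: "\<forall>n. N n \<subseteq> N (Suc n)"
  show "\<exists>k. \<forall>n\<ge>k. N n = N k"
  proof (cases "\<exists>m. N m \<noteq> Z")
    case True
    then obtain m where m: "N m \<noteq> Z" by blast
    have nn: "rel_noeth (N m) Y" using assms[of "N m"] N m by blast
    have mono: "a \<le> b \<Longrightarrow> N a \<subseteq> N b" for a b using mono_chain[of N] inc by blast
    have "\<exists>k. \<forall>n\<ge>k. N (m + n) = N (m + k)"
      by (rule rel_noethD[OF nn]) (use N inc mono in auto)
    then obtain k where k: "\<And>n. n \<ge> k \<Longrightarrow> N (m + n) = N (m + k)" by blast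
    have "N n = N (m + k)" if "n \<ge> m + k" for n using k[of "n - m"] that by simp
    then show ?thesis by blast
  qed auto
qed

end

section \<open>The regular module of a WV-ring\<close>

context
  fixes R :: "('a, 'r) ring_scheme" and M :: "('a, 'a) rmodule"
  assumes ringR: "ring R" and M_def: "M = regular_module R"
begin

interpretation R: ring R by (rule ringR)

interpretation M: right_module R M
  unfolding M_def by (rule right_module_regular[OF ringR])

lemma M_simps: "carrier M = carrier R" "\<zero>\<^bsub>M\<^esub> = \<zero>\<^bsub>R\<^esub>"
  by (simp_all add: M_def)

lemma regular_cyclic: "M.rel_cyclic {\<zero>\<^bsub>M\<^esub>} (carrier M)"
proof -
  have "(\<lambda>r. \<one>\<^bsub>R\<^esub> \<triangleleft>\<^bsub>M\<^esub> r) ` carrier R = (\<lambda>r. r) ` carrier R"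
    by (rule image_cong) (simp_all add: M_def)
  then have "M.cyc \<one>\<^bsub>R\<^esub> = carrier M" by (simp add: M.cyc_def M_simps)
  moreover have "M.sum_sub (carrier M) {\<zero>\<^bsub>M\<^esub>} = carrier M"
    by (rule M.sum_absorb2) simp_all
  ultimately show ?thesis unfolding M.rel_cyclic_def
    by (intro conjI M.sub_zero bexI[of _ "\<one>\<^bsub>R\<^esub>"]) (simp_all add: M_simps)
qed

lemma regular_star:
  assumes "every_cyclic_has_star R" "M.rel_cyclic Z Y"
  shows "M.rel_star Z Y"
proof -
  note d = M.rel_cyclicD[OF assms(2)]
  have "right_module R (quotient_module (submod M Y) Z)"
    using module_epi.axioms(2)[OF M.quotient_epi(1)[OF d(2,1,3)]] .
  then have "property_star R (quotient_module (submod M Y) Z)"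
    using assms(1) M.cyclic_quotient[OF assms(2)] unfolding every_cyclic_has_star_def by blast
  then show ?thesis by (rule M.rel_star_quotient[OF d(2,1,3)])
qed

text \<open>An isomorphism \<open>R/Z \<cong> R\<close>, composed with the projection.\<close>

lemma iso_regular_epi:
  assumes Z: "M.sub Z" and iso: "rmod_isomorphic R (quotient_module M Z) M"
  obtains \<psi> where "module_epi R M M (carrier M) \<psi>" "module_epi.ker M (carrier M) \<psi> = Z"
proof -
  let ?Q = "quotient_module M Z" and ?\<pi> = "\<lambda>x. Z +>\<^bsub>M\<^esub> x"
  have ZM: "Z \<subseteq> carrier M" by (rule M.rsubmodule_subset[OF Z])
  have E: "module_epi R M ?Q (carrier M) ?\<pi>" "module_epi.ker ?Q (carrier M) ?\<pi> = Z"
    using M.quotient_epi[OF M.sub_carrier Z ZM] by simp_all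
  interpret E: module_epi R M ?Q "carrier M" ?\<pi> by (rule E(1))
  obtain f where f: "f \<in> rmod_hom R ?Q M" "bij_betw f (carrier ?Q) (carrier M)"
    using iso unfolding rmod_isomorphic_def by blast
  note F = rmod_homD[OF f(1)]
  let ?\<psi> = "\<lambda>x. f (?\<pi> x)"
  have hom: "?\<psi> \<in> rmod_hom R (submod M (carrier M)) M"
    unfolding rmod_hom_def mem_Collect_eq
    by (intro conjI ballI funcsetI) (simp_all add: F)
  have surj: "?\<psi> ` carrier M = carrier M"
    using E.epi_surj f(2) by (metis (no_types) bij_betw_def image_image)
  have P: "module_epi R M M (carrier M) ?\<psi>"
    by (intro module_epi.intro module_epi_axioms.intro M.right_module_axioms M.sub_carrier hom surj)
  have f0: "f \<zero>\<^bsub>?Q\<^esub> = \<zero>\<^bsub>M\<^esub>" by (rule rmod_hom_zero[OF E.Q.right_module_axioms M.right_module_axioms f(1)])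
  have "f q = \<zero>\<^bsub>M\<^esub> \<longleftrightarrow> q = \<zero>\<^bsub>?Q\<^esub>" if "q \<in> carrier ?Q" for q
    using that f0 f(2) E.Q.M.zero_closed unfolding bij_betw_def inj_on_def by metis
  then have "module_epi.ker M (carrier M) ?\<psi> = E.ker"
    using E.epi_simps(1) by (auto simp: module_epi.ker_def[OF P] E.ker_def)
  then show thesis using that[OF P] E(2) by simp
qed

text \<open>Injectivity of \<open>V/Z\<close> relative to \<open>R/Z\<close> gives a retraction of
  \<open>R/Z\<close> onto \<open>V/Z\<close>. Composed with the projection from \<open>R\<close>,
  its kernel is the complement.\<close>

lemma WV_ring_split:
  assumes WV: "right_WV_ring R" and cov: "M.covers Z V"
    and niso: "\<not> rmod_isomorphic R (quotient_module M Z) M"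
  shows "\<exists>D. M.rel_compl Z (carrier M) V D"
proof -
  let ?Q = "quotient_module M Z" and ?\<pi> = "\<lambda>x. Z +>\<^bsub>M\<^esub> x"
  note c = M.coversD[OF cov]
  have ZM: "Z \<subseteq> carrier M" "V \<subseteq> carrier M" using M.rsubmodule_subset c by blast+
  have E: "module_epi R M ?Q (carrier M) ?\<pi>" "module_epi.ker ?Q (carrier M) ?\<pi> = Z"
    using M.quotient_epi[OF M.sub_carrier c(1) ZM(1)] by simp_all
  interpret E: module_epi R M ?Q "carrier M" ?\<pi> by (rule E(1))
  have sV: "rsubmodule R ?Q (?\<pi> ` V)" by (rule E.sub_image[OF c(2) ZM(2)])
  let ?S = "submod ?Q (?\<pi> ` V)"
  have rS: "right_module R ?S" by (rule E.Q.right_module_submod[OF sV])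
  interpret S: module_epi R M ?S V ?\<pi>
  proof (intro module_epi.intro module_epi_axioms.intro M.right_module_axioms rS c(2))
    show "?\<pi> \<in> rmod_hom R (submod M V) ?S"
      using ZM(2) unfolding rmod_hom_def mem_Collect_eq
      by (intro conjI ballI funcsetI) (auto simp: subset_iff)
  qed simp
  have kS: "S.ker = Z" using E(2) ZM c(3) by (auto simp: S.ker_def E.ker_def)
  have "simple_module R ?S" by (rule S.simple_module_epi) (simp add: kS cov)
  then have inj: "relatively_injective R ?Q ?S"
    using WV rS niso c(1) unfolding right_WV_ring_def right_ideal_def M_def by blast
  have "(\<lambda>x. x) \<in> rmod_hom R ?S ?S" by (simp add: rmod_hom_def)
  from inj[unfolded relatively_injective_def, rule_format, OF conjI[OF sV this]]
  obtain g where g: "g \<in> rmod_hom R ?Q ?S" "\<And>x. x \<in> ?\<pi> ` V \<Longrightarrow> g x = x" by auto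
  note G = rmod_homD[OF g(1)]
  have hom: "(\<lambda>x. g (?\<pi> x)) \<in> rmod_hom R M ?S"
    unfolding rmod_hom_def mem_Collect_eq
    by (intro conjI ballI funcsetI) (use G in \<open>simp_all  del: submod_simps\<close>)
  have "M.rel_compl Z (carrier M) V {x \<in> carrier M. g (?\<pi> x) = \<zero>\<^bsub>?S\<^esub>}"
  proof (rule M.kernel_split[OF rS hom c(2)])
    show "(\<lambda>x. g (?\<pi> x)) ` V = carrier ?S" using g(2) by auto
    show "{x \<in> V. g (?\<pi> x) = \<zero>\<^bsub>?S\<^esub>} = Z" using g(2) kS by (auto simp: S.ker_def)
  qed
  then show ?thesis by blast
qed

text \<open>If \<open>C\<close> is maximal with \<open>C \<inter> V = Z\<close>, then \<open>R/C\<close> has the essential simple submodule \<open>(V + C)/C\<close>.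
  Hence \<open>R/C\<close> is not isomorphic to \<open>R\<close> unless \<open>R\<close> is uniform.\<close>

lemma WV_ring_not_uniform:
  assumes WV: "right_WV_ring R" and nu: "\<not> M.rel_uniform {\<zero>\<^bsub>M\<^esub>} (carrier M)"
  shows "M.simples_split_above Zb"
  unfolding M.simples_split_above_def
proof (intro allI impI, elim conjE)
  fix Z V assume cov: "M.covers Z V"
  note c = M.coversD[OF cov]
  have ZM: "Z \<subseteq> carrier M" "V \<subseteq> carrier M" using M.rsubmodule_subset c by blast+
  obtain C where C: "M.sub C" "Z \<subseteq> C" "C \<subseteq> carrier M" "C \<inter> V = Z"
    and max: "\<And>C'. M.sub C' \<Longrightarrow> C \<subseteq> C' \<Longrightarrow> C' \<subseteq> carrier M \<Longrightarrow> C' \<inter> V \<subseteq> Z \<Longrightarrow> C' = C"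
    by (rule M.rel_pseudo_compl[OF c(1,2) M.sub_carrier c(3) ZM(1)]) blast
  have "\<not> rmod_isomorphic R (quotient_module M C) M"
  proof
    assume "rmod_isomorphic R (quotient_module M C) M"
    then obtain \<psi> where P: "module_epi R M M (carrier M) \<psi>" "module_epi.ker M (carrier M) \<psi> = C"
      by (rule iso_regular_epi[OF C(1)]) blast
    interpret P: module_epi R M M "carrier M" \<psi> by (rule P(1))
    obtain I J where IJ: "M.sub I" "M.sub J" "I \<inter> J = {\<zero>\<^bsub>M\<^esub>}" "I \<noteq> {\<zero>\<^bsub>M\<^esub>}" "J \<noteq> {\<zero>\<^bsub>M\<^esub>}"
      using nu unfolding M.rel_uniform_def by (simp only: not_all not_imp de_Morgan_disj) (elim exE conjE)
    \<comment> \<open>Under \<open>R/C \<cong> R\<close> a nonzero right ideal \<open>I\<close>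
      corresponds to a submodule strictly above \<open>C\<close>. By maximality of \<open>C\<close>
      it meets \<open>V\<close> outside \<open>Z\<close>, so it contains \<open>V\<close>. Two
      independent right ideals would both contain \<open>V\<close>.\<close>
    have V: "V \<subseteq> P.pre I" if I: "M.sub I" "I \<noteq> {\<zero>\<^bsub>M\<^esub>}" for I
    proof (rule ccontr)
      assume n: "\<not> V \<subseteq> P.pre I"
      have CI: "C \<subseteq> P.pre I" using P.ker_le_pre[OF I(1)] P(2) by simp
      have "V \<inter> P.pre I = Z" by (rule M.covers_Int[OF cov P.sub_pre[OF I(1)] _ n]) (use CI C in blast)
      then have "P.pre I = C" by (intro max P.sub_pre I CI P.pre_le) blast
      then have "P.pre I = P.pre {\<zero>\<^bsub>M\<^esub>}" using P(2) P.pre_zero by simp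
      then have "I = {\<zero>\<^bsub>M\<^esub>}"
        using P.image_pre[OF M.rsubmodule_subset[OF I(1)]] P.image_pre[of "{\<zero>\<^bsub>M\<^esub>}"] M.M.zero_closed
        by (metis M.rsubmodule_subset M.sub_zero)
      then show False using I by simp
    qed
    have "V \<subseteq> P.pre (I \<inter> J)" using V[OF IJ(1,4)] V[OF IJ(2,5)] by (simp only: P.pre_Int Int_subset_iff)
    then have "V \<subseteq> C" using IJ(3) P.pre_zero P(2) by simp
    then show False using C(4) c(3,4) by blast
  qed
  \<comment> \<open>So the simple module \<open>(V + C)/C\<close> splits off from
    \<open>R/C\<close>, and its complement over \<open>C\<close> is also a complement of
    \<open>V\<close> over \<open>Z\<close>.\<close>
  moreover have "M.covers C (M.sum_sub V C)" by (rule M.covers_sumI) (use cov C in \<open>simp_all add: Int_commute\<close>)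
  ultimately obtain D where D: "M.rel_compl C (carrier M) (M.sum_sub V C) D"
    using WV_ring_split[OF WV] by blast
  note d = M.rel_complD[OF D]
  have "M.sum_sub V D = carrier M"
  proof -
    have "carrier M = M.sum_sub V (M.sum_sub C D)" using d(5) M.sum_assoc[OF c(2) C(1) d(2)] by simp
    also have "M.sum_sub C D = D" by (rule M.sum_absorb[OF C(1) d(2,8)])
    finally show ?thesis by simp
  qed
  moreover have "V \<inter> D = Z"
  proof -
    have "V \<inter> D \<subseteq> C" using d(6) M.sum_upper1[OF c(2) C(1)] by blast
    then show ?thesis using C(4) d(8) C(2) c(3) by blast
  qed
  ultimately have "M.rel_compl Z (carrier M) V D" using c d by (simp add: M.rel_compl_def)
  then show "\<exists>D. M.rel_compl Z (carrier M) V D" by blast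
qed

text \<open>An isomorphism \<open>R/Z \<cong> R\<close> yields an epimorphism of \<open>R\<close>
  onto itself with kernel \<open>Z\<close>. It is split by left multiplication with a preimage
  \<open>t\<close> of \<open>\<one>\<close>, so \<open>tR\<close> and the nonzero \<open>Z\<close>
  would be independent in a uniform module.\<close>

lemma WV_ring_uniform:
  assumes WV: "right_WV_ring R" and un: "M.rel_uniform {\<zero>\<^bsub>M\<^esub>} (carrier M)"
    and A: "M.sub A" "A \<noteq> {\<zero>\<^bsub>M\<^esub>}"
  shows "M.simples_split_above A"
  unfolding M.simples_split_above_def
proof (intro allI impI, elim conjE)
  fix Z V assume cov: "M.covers Z V" and AZ: "A \<subseteq> Z"
  note c = M.coversD[OF cov]
  have Z0: "Z \<noteq> {\<zero>\<^bsub>M\<^esub>}" using AZ A M.rsubmoduleD(1)[OF A(1)] by blast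
  have "\<not> rmod_isomorphic R (quotient_module M Z) M"
  proof
    assume "rmod_isomorphic R (quotient_module M Z) M"
    then obtain \<psi> where P: "module_epi R M M (carrier M) \<psi>" "module_epi.ker M (carrier M) \<psi> = Z"
      by (rule iso_regular_epi[OF c(1)]) blast
    interpret P: module_epi R M M "carrier M" \<psi> by (rule P(1))
    obtain t where t: "t \<in> carrier M" "\<psi> t = \<one>\<^bsub>R\<^esub>" using P.epi_surj by (metis M_simps(1) R.one_closed imageE)
    have "M.cyc t \<inter> Z \<subseteq> {\<zero>\<^bsub>M\<^esub>}"
    proof
      fix x assume "x \<in> M.cyc t \<inter> Z"
      then obtain r where r: "r \<in> carrier R" "x = t \<triangleleft>\<^bsub>M\<^esub> r" "x \<in> Z" by (auto simp: M.cyc_def)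
      have "\<psi> x = r" using P.epi_simps(3)[OF t(1) r(1)] t r by (simp add: M_def)
      moreover have "\<psi> x = \<zero>\<^bsub>M\<^esub>" using r(3) P(2) by (auto simp: P.ker_def)
      ultimately have "x = t \<triangleleft>\<^bsub>M\<^esub> \<zero>\<^bsub>R\<^esub>" using r by (simp add: M_simps)
      then show "x \<in> {\<zero>\<^bsub>M\<^esub>}" using M.ract_r_zero[OF t(1)] by simp
    qed
    then have "M.cyc t \<inter> Z = {\<zero>\<^bsub>M\<^esub>}"
      using M.rsubmoduleD(1)[OF c(1)] M.rsubmoduleD(1)[OF M.sub_cyc[OF t(1)]] by blast
    then have "M.cyc t = {\<zero>\<^bsub>M\<^esub>} \<or> Z = {\<zero>\<^bsub>M\<^esub>}"
      using un[unfolded M.rel_uniform_def, rule_format, of "M.cyc t" Z] t c(1)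
        M.rsubmoduleD(1)[OF c(1)] M.rsubmoduleD(1)[OF M.sub_cyc[OF t(1)]]
      by (simp add: M.sub_zero_le M.rsubmodule_subset)
    then have "t = \<zero>\<^bsub>M\<^esub>" using Z0 M.cyc_self[OF t(1)] by auto
    then have "\<one>\<^bsub>R\<^esub> = \<zero>\<^bsub>R\<^esub>" using t P.epi_zero by (simp add: M_simps)
    then have "carrier M = {\<zero>\<^bsub>M\<^esub>}" using R.one_zeroD by (simp add: M_simps)
    then show False using Z0 M.rsubmodule_subset[OF c(1)] M.rsubmoduleD(1)[OF c(1)] by blast
  qed
  then show "\<exists>D. M.rel_compl Z (carrier M) V D" by (rule WV_ring_split[OF WV cov])
qed

lemma WV_ring_star_imp_noeth:
  assumes WV: "right_WV_ring R" and star: "every_cyclic_has_star R"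
  shows "right_noetherian_ring R"
proof -
  have "M.rel_noeth {\<zero>\<^bsub>M\<^esub>} (carrier M)"
  proof (cases "M.rel_uniform {\<zero>\<^bsub>M\<^esub>} (carrier M)")
    case False
    then show ?thesis
      by (intro M.cyclic_star_imp_noeth WV_ring_not_uniform[OF WV] regular_cyclic regular_star[OF star])
  next
    case True
    show ?thesis
    proof (rule M.rel_noeth_stepI)
      fix A assume A: "M.sub A" "{\<zero>\<^bsub>M\<^esub>} \<subseteq> A" "A \<subseteq> carrier M" "A \<noteq> {\<zero>\<^bsub>M\<^esub>}"
      show "M.rel_noeth A (carrier M)"
      proof (rule M.cyclic_CS_or_noeth_imp_noeth)
        show "M.simples_split_above A" by (rule WV_ring_uniform[OF WV True A(1,4)])
        show "M.rel_cyclic A (carrier M)" by (rule M.rel_cyclic_mono[OF regular_cyclic A(1-3)])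
        fix Z Y assume Z: "A \<subseteq> Z" "M.rel_cyclic Z Y"
        note d = M.rel_cyclicD[OF Z(2)]
        have Z0: "Z \<noteq> {\<zero>\<^bsub>M\<^esub>}" using A Z(1) by blast
        \<comment> \<open>In a uniform module every nonzero submodule is essential, so
          \<open>rel_star_ess\<close> removes the projective summand.\<close>
        have "M.rel_ess {\<zero>\<^bsub>M\<^esub>} Z Y"
          unfolding M.rel_ess_def
        proof (intro allI impI, elim conjE)
          fix U assume U: "M.sub U" "{\<zero>\<^bsub>M\<^esub>} \<subseteq> U" "U \<inter> Z \<subseteq> {\<zero>\<^bsub>M\<^esub>}"
          then have "U \<inter> Z = {\<zero>\<^bsub>M\<^esub>}" using M.sub_zero_le[OF d(1)] by blast
          then show "U = {\<zero>\<^bsub>M\<^esub>}"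
            using True[unfolded M.rel_uniform_def, rule_format, of U Z] U d(1) Z0 M.rsubmoduleD(1)[OF d(1)]
            by (simp add: M.sub_zero_le M.rsubmodule_subset)
        qed
        then show "M.rel_CS Z Y \<or> M.rel_noeth Z Y"
          by (intro M.rel_star_ess[OF regular_star[OF star Z(2)] M.sub_zero M.sub_zero_le[OF d(1)]])
      qed
    qed
  qed
  then show ?thesis
    using ringR M.noetherian_module_iff unfolding right_noetherian_ring_def M_def by blast
qed

lemma V_ring_star_imp_noeth:
  assumes V: "right_V_ring R" and star: "every_cyclic_has_star R"
  shows "M.rel_noeth {\<zero>\<^bsub>M\<^esub>} (carrier M)"
  by (intro M.cyclic_star_imp_noeth M.V_ring_simples_split[OF V] regular_cyclic regular_star[OF star])

end

section \<open>Descending chains in semisimple intervals\<close>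

context right_module
begin

text \<open>Complements of consecutive members of a descending chain have ascending partial sums
  \<open>U n\<close>, and \<open>U n\<close> meets \<open>N n\<close> only in \<open>Z\<close>. Once
  these sums are stationary, the complements lie in both and are trivial.\<close>

lemma rel_ss_noeth_artinian:
  assumes ss: "rel_ss Z T" and n: "rel_noeth Z T"
    and N: "\<And>n. sub (N n)" "\<And>n. Z \<subseteq> N n" "\<And>n. N n \<subseteq> T" "\<And>n. N (Suc n) \<subseteq> N n"
  shows "\<exists>k. \<forall>n\<ge>k. N n = N (k :: nat)"
proof -
  have S: "sub Z" "sub T" "Z \<subseteq> T" by (rule rel_ssD[OF ss])+
  have "\<exists>C. rel_compl Z (N n) (N (Suc n)) C" for n
  proof -
    have "rel_ss Z (N n)" by (rule rel_ss_mono[OF ss N(1,2,3)])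
    then obtain C where "rel_compl Z (N n) (N (Suc n)) C" by (rule rel_ss_compl[OF _ N(1,2,4)])
    then show ?thesis by blast
  qed
  then obtain C where C: "\<And>n. rel_compl Z (N n) (N (Suc n)) (C n)" by metis
  define U where "U = rec_nat Z (\<lambda>n A. A \<boxplus> C n)"
  have U0: "U 0 = Z" and US: "U (Suc n) = U n \<boxplus> C n" for n by (simp_all add: U_def)
  have sC: "sub (C n)" "C n \<subseteq> N n" "Z \<subseteq> C n" for n using rel_complD[OF C[of n]] by simp_all
  have sU: "sub (U n)" for n by (induction n) (simp_all add: U0 US S sC)
  have ZU: "Z \<subseteq> U n" for n by (induction n) (simp_all add: U0 US le_sumI1 sU sC)
  have dis: "U n \<inter> N n = Z \<and> U n \<subseteq> T" for n
  proof (induction n)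
    case 0
    then show ?case using N(2)[of 0] S by (auto simp: U0)
  next
    case (Suc n)
    have "(C n \<boxplus> U n) \<inter> N n = C n \<boxplus> (U n \<inter> N n)" by (rule modular) (use sC sU N in simp_all)
    also have "\<dots> = C n" using Suc sC S by (simp add: sum_absorb2)
    finally have "(U n \<boxplus> C n) \<inter> N n = C n" using sum_comm[OF sU sC(1)] by simp
    then have "U (Suc n) \<inter> N (Suc n) \<subseteq> N (Suc n) \<inter> C n" using N(4)[of n] unfolding US by blast
    then have "U (Suc n) \<inter> N (Suc n) = Z"
      using rel_complD(6)[OF C[of n]] ZU[of "Suc n"] N(2)[of "Suc n"] by blast
    moreover have "U (Suc n) \<subseteq> T"
      unfolding US using Suc sC(2)[of n] N(3)[of n] by (intro sum_least[OF S(2)]) auto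
    ultimately show ?case by blast
  qed
  have "\<exists>k. \<forall>n\<ge>k. U n = U k"
    by (rule rel_noethD[OF n]) (use sU ZU dis in \<open>simp_all add: US sum_upper1 sC\<close>)
  then obtain k where k: "\<And>n. n \<ge> k \<Longrightarrow> U n = U k" by blast
  have step: "N (Suc n) = N n" if "n \<ge> k" for n
  proof -
    have "U (Suc n) = U n" using k[of n] k[of "Suc n"] that by simp
    then have "C n \<subseteq> U n" using sum_upper2[OF sU sC(1), of n n] by (simp add: US)
    then have "C n \<subseteq> Z" using dis[of n] sC(2)[of n] by blast
    then have "C n = Z" using sC(3)[of n] by blast
    then show ?thesis using rel_complD(5)[OF C[of n]] sum_absorb2[OF N(1) S(1) N(2)] by simp
  qed
  have "N (k + m) = N k" for m by (induction m) (use step in simp_all)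
  then have "N n = N k" if "n \<ge> k" for n using that by (metis le_Suc_ex)
  then show ?thesis by blast
qed

end

section \<open>Ring decomposition\<close>

locale noeth_split_ring = ring R for R :: "('a, 'r) ring_scheme" (structure) +
  assumes simples_split: "right_module.simples_split_above R (regular_module R) {\<zero>}"
    and noeth: "right_module.rel_noeth R (regular_module R) {\<zero>} (carrier R)"
begin

abbreviation "RM \<equiv> regular_module R"

sublocale M: right_module R RM
  by (rule right_module_regular[OF ring_axioms])

lemma sum_regular [simp]: "A <+>\<^bsub>RM\<^esub> B = A <+>\<^bsub>R\<^esub> B"
  by (simp add: set_add_def')

lemma ideal_sub: "ideal I R \<Longrightarrow> M.sub I"
  unfolding rsubmodule_def
  using additive_subgroup.a_subgroup[OF ideal.axioms(1)] ideal.I_r_closed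
  by (fastforce simp: regular_module_def subgroup_def m_inv_def)

lemma sub_idealI:
  assumes "M.sub I" "\<And>r x. r \<in> carrier R \<Longrightarrow> x \<in> I \<Longrightarrow> r \<otimes> x \<in> I"
  shows "ideal I R"
proof (rule idealI[OF ring_axioms])
  show "subgroup I (add_monoid R)"
    using assms(1) by (auto simp: rsubmodule_def regular_module_def subgroup_def m_inv_def)
qed (use assms M.rsubmoduleD(3)[OF assms(1)] in auto)

lemma idealD:
  assumes "ideal I R"
  shows "\<And>x. x \<in> I \<Longrightarrow> x \<in> carrier R" "\<zero> \<in> I" "\<And>x y. x \<in> I \<Longrightarrow> y \<in> I \<Longrightarrow> x \<oplus> y \<in> I"
    "\<And>x. x \<in> I \<Longrightarrow> \<ominus> x \<in> I" "\<And>x r. x \<in> I \<Longrightarrow> r \<in> carrier R \<Longrightarrow> x \<otimes> r \<in> I"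
    "\<And>x r. x \<in> I \<Longrightarrow> r \<in> carrier R \<Longrightarrow> r \<otimes> x \<in> I"
  using ideal.Icarr[OF assms] additive_subgroup.zero_closed[OF ideal.axioms(1)[OF assms]]
    additive_subgroup.a_closed[OF ideal.axioms(1)[OF assms]] additive_subgroup.a_inv_closed[OF ideal.axioms(1)[OF assms]]
    ideal.I_r_closed[OF assms] ideal.I_l_closed[OF assms] by auto

text \<open>Otherwise a maximal right ideal \<open>D \<supseteq> cJ\<close> does not contain \<open>c\<close>, so \<open>1 \<in> cR + D\<close> and
  \<open>c \<in> c(Rc) + D\<close>.\<close>

lemma ideal_absorbs:
  assumes J: "ideal J R" and c: "c \<in> J"
  shows "\<exists>j\<in>J. c \<otimes> j = c"
proof (rule ccontr)
  note j = idealD[OF J]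
  have cR: "c \<in> carrier R" using c j by simp
  define L where "L = (\<lambda>j. c \<otimes> j) ` J"
  assume "\<not> ?thesis"
  then have cL: "c \<notin> L" by (auto simp: L_def)
  have L: "M.sub L"
  proof (rule M.rsubmoduleI)
    show "L \<subseteq> carrier RM" using cR j by (auto simp: L_def)
    show "\<zero>\<^bsub>RM\<^esub> \<in> L" using cR j(2) by (auto simp: L_def intro!: image_eqI[of _ _ \<zero>])
    show "x \<oplus>\<^bsub>RM\<^esub> y \<in> L" if xy: "x \<in> L" "y \<in> L" for x y
    proof -
      obtain a b where "a \<in> J" "x = c \<otimes> a" "b \<in> J" "y = c \<otimes> b" using xy by (auto simp: L_def)
      then show ?thesis using cR j by (auto simp: L_def r_distr intro!: image_eqI[of _ _ "a \<oplus> b"])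
    qed
    show "x \<triangleleft>\<^bsub>RM\<^esub> r \<in> L" if xr: "x \<in> L" "r \<in> carrier R" for x r
    proof -
      obtain a where "a \<in> J" "x = c \<otimes> a" using xr by (auto simp: L_def)
      then show ?thesis using cR xr(2) j by (auto simp: L_def m_assoc intro!: image_eqI[of _ _ "a \<otimes> r"])
    qed
  qed
  have cM: "c \<in> carrier RM" using cR by simp
  let ?Y = "M.cyc c <+>\<^bsub>RM\<^esub> L"
  have cY: "c \<in> ?Y" using M.cyc_self[OF cM] M.sum_upper1[OF M.sub_cyc[OF cM] L] by blast
  have sY: "M.sub ?Y" using L cM by (intro M.sub_sum M.sub_cyc)
  obtain Q where Q: "M.covers Q ?Y" "L \<subseteq> Q"
    by (rule M.maximal_avoiding[OF L sY M.sum_upper2[OF M.sub_cyc[OF cM] L] cY cL refl cM])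
  note q = M.coversD[OF Q(1)]
  obtain D where D: "M.rel_compl Q (carrier RM) ?Y D"
    by (rule M.simple_split[OF simples_split Q(1) _ M.rsubmodule_subset[OF sY] M.sub_carrier])
      (use M.sub_zero_le[OF q(1)] in auto)
  note d = M.rel_complD[OF D]
  have LD: "L \<subseteq> D" using Q(2) d by blast
  have "c \<notin> D"
  proof
    assume "c \<in> D"
    then have "c \<in> Q" using cY d(6) by blast
    then have "?Y \<subseteq> Q" by (intro M.sum_least[OF q(1) M.cyc_least[OF q(1)] Q(2)])
    then show False using q(3,4) by blast
  qed
  have "\<one> \<in> ?Y <+>\<^bsub>RM\<^esub> D" using d(5) by simp
  then obtain y e where ye: "y \<in> ?Y" "e \<in> D" "\<one> = y \<oplus> e" by (rule M.sum_memE) simp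
  obtain a l where al: "a \<in> M.cyc c" "l \<in> L" "y = a \<oplus> l" using ye(1) by (rule M.sum_memE) simp
  obtain r where r: "r \<in> carrier R" "a = c \<otimes> r" using al(1) by (auto simp: M.cyc_def)
  have D_R: "x \<in> D \<Longrightarrow> x \<in> carrier R" for x using M.sub_mem[OF d(2)] by simp
  define f where "f = l \<oplus> e"
  have fD: "f \<in> D" using al(2) LD ye(2) M.rsubmoduleD(2)[OF d(2)] by (auto simp: f_def)
  have "l \<in> carrier R" "e \<in> carrier R" using al(2) LD ye(2) D_R by blast+
  then have one: "\<one> = c \<otimes> r \<oplus> f" using ye(3) al(3) r cR by (simp add: f_def a_assoc)
  have fR: "f \<in> carrier R" using fD D_R by simp
  have "c = (c \<otimes> r \<oplus> f) \<otimes> c" using one cR by (metis l_one)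
  also have "\<dots> = c \<otimes> (r \<otimes> c) \<oplus> f \<otimes> c" using cR r(1) fR by (simp add: l_distr m_assoc)
  finally have eq: "c = c \<otimes> (r \<otimes> c) \<oplus> f \<otimes> c" .
  have "c \<otimes> (r \<otimes> c) \<in> D" using LD j(6)[OF c r(1)] by (auto simp: L_def)
  moreover have "f \<otimes> c \<in> D" using M.rsubmoduleD(3)[OF d(2) fD cR] by simp
  ultimately have "c \<in> D" using eq M.rsubmoduleD(2)[OF d(2)] by (metis regular_module_simps(3))
  then show False using \<open>c \<notin> D\<close> by simp
qed

lemma ideal_absorbs_finite:
  assumes J: "ideal J R" and "finite F" "F \<subseteq> J"
  shows "\<exists>j\<in>J. \<forall>c\<in>F. c \<otimes> j = c"
  using assms(2,3)
proof (induction F rule: finite_induct)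
  case empty
  then show ?case using idealD(2)[OF J] by blast
next
  case (insert c F)
  note j = idealD[OF J]
  obtain e where e: "e \<in> J" "\<And>a. a \<in> F \<Longrightarrow> a \<otimes> e = a" using insert by auto
  have cJ: "c \<in> J" using insert by simp
  let ?b = "c \<oplus> \<ominus> (c \<otimes> e)"
  have "?b \<in> J" using cJ e(1) j by simp
  then obtain e' where e': "e' \<in> J" "?b \<otimes> e' = ?b" using ideal_absorbs[OF J] by blast
  have C: "c \<in> carrier R" "e \<in> carrier R" "e' \<in> carrier R" using cJ e e' j by simp_all
  \<comment> \<open>Chosen so that \<open>1 - ?e = (1 - e)(1 - e')\<close>: the first factor
    annihilates \<open>F\<close> on the right, the second one the defect \<open>?b\<close> of
    \<open>c\<close>.\<close>
  let ?e = "e \<oplus> (e' \<oplus> \<ominus> (e \<otimes> e'))"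
  have eq: "a \<otimes> ?e = a \<otimes> e \<oplus> (a \<oplus> \<ominus> (a \<otimes> e)) \<otimes> e'" if "a \<in> carrier R" for a
    using that C by (simp add: r_distr l_distr r_minus l_minus m_assoc)
  have "a \<otimes> ?e = a" if "a \<in> F" for a
  proof -
    have "a \<in> carrier R" using that insert j by auto
    then show ?thesis using eq[of a] e(2)[OF that] C by (simp add: r_neg)
  qed
  moreover have "c \<otimes> ?e = c"
  proof -
    have "c \<otimes> ?e = c \<otimes> e \<oplus> (c \<oplus> \<ominus> (c \<otimes> e))" using eq[OF C(1)] e'(2) by simp
    also have "\<dots> = c" using C by (simp add: a_lcomm r_neg)
    finally show ?thesis .
  qed
  moreover have "?e \<in> J" using e(1) e'(1) j C by simp
  ultimately show ?case by (intro bexI[of _ ?e]) auto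
qed

section \<open>The right singular ideal\<close>

definition singular :: "'a set"
  where "singular = {z \<in> carrier R. \<forall>x\<in>carrier R. x \<noteq> \<zero> \<longrightarrow> (\<exists>r\<in>carrier R. x \<otimes> r \<noteq> \<zero> \<and> z \<otimes> (x \<otimes> r) = \<zero>)}"

text \<open>Membership of \<open>z\<close> says that its right annihilator is an essential right
  ideal. Essential right ideals are closed under intersection and under inverse images by left
  multiplication, which accounts for sums and right multiples.\<close>

lemma ideal_singular: "ideal singular R"
proof (rule sub_idealI)
  have sing: "\<exists>r\<in>carrier R. x \<otimes> r \<noteq> \<zero> \<and> z \<otimes> (x \<otimes> r) = \<zero>"
    if "z \<in> singular" "x \<in> carrier R" "x \<noteq> \<zero>" for x z
    using that by (auto simp: singular_def)
  show "M.sub singular"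
  proof (rule M.rsubmoduleI)
    show "\<zero>\<^bsub>RM\<^esub> \<in> singular" by (auto simp: singular_def intro!: bexI[of _ \<one>])
    show "z \<oplus>\<^bsub>RM\<^esub> w \<in> singular" if zw: "z \<in> singular" "w \<in> singular" for z w
    proof -
      have C: "z \<in> carrier R" "w \<in> carrier R" using zw by (auto simp: singular_def)
      have "\<exists>r\<in>carrier R. x \<otimes> r \<noteq> \<zero> \<and> (z \<oplus> w) \<otimes> (x \<otimes> r) = \<zero>" if x: "x \<in> carrier R" "x \<noteq> \<zero>" for x
      proof -
        obtain r where r: "r \<in> carrier R" "x \<otimes> r \<noteq> \<zero>" "z \<otimes> (x \<otimes> r) = \<zero>" using sing[OF zw(1) x] by blast
        obtain s where s: "s \<in> carrier R" "(x \<otimes> r) \<otimes> s \<noteq> \<zero>" "w \<otimes> ((x \<otimes> r) \<otimes> s) = \<zero>"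
          using sing[OF zw(2), of "x \<otimes> r"] r x by auto
        have "z \<otimes> ((x \<otimes> r) \<otimes> s) = (z \<otimes> (x \<otimes> r)) \<otimes> s"
          using C x r(1) s(1) by (intro m_assoc[symmetric]) simp_all
        then have "z \<otimes> ((x \<otimes> r) \<otimes> s) = \<zero>" using r(3) s(1) by simp
        then have "(z \<oplus> w) \<otimes> ((x \<otimes> r) \<otimes> s) = \<zero>" using s C x r(1) by (simp add: l_distr)
        then show ?thesis using s x r(1) by (intro bexI[of _ "r \<otimes> s"]) (simp_all add: m_assoc)
      qed
      then show ?thesis using C by (simp add: singular_def)
    qed
    show "z \<triangleleft>\<^bsub>RM\<^esub> a \<in> singular" if z: "z \<in> singular" and a: "a \<in> carrier R" for z a
    proof -
      have C: "z \<in> carrier R" using z by (auto simp: singular_def)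
      have "\<exists>r\<in>carrier R. x \<otimes> r \<noteq> \<zero> \<and> (z \<otimes> a) \<otimes> (x \<otimes> r) = \<zero>" if x: "x \<in> carrier R" "x \<noteq> \<zero>" for x
      proof (cases "a \<otimes> x = \<zero>")
        case True
        then show ?thesis using x C a by (intro bexI[of _ \<one>]) (simp_all add: m_assoc)
      next
        case False
        then obtain r where r: "r \<in> carrier R" "(a \<otimes> x) \<otimes> r \<noteq> \<zero>" "z \<otimes> ((a \<otimes> x) \<otimes> r) = \<zero>"
          using sing[OF z, of "a \<otimes> x"] a x by auto
        then have "x \<otimes> r \<noteq> \<zero>" using a x by (auto simp: m_assoc)
        then show ?thesis using r a x C by (intro bexI[of _ r]) (simp_all add: m_assoc)
      qed
      then show ?thesis using C a by (simp add: singular_def)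
    qed
  qed (auto simp: singular_def)
  show "a \<otimes> z \<in> singular" if a: "a \<in> carrier R" and z: "z \<in> singular" for a z
  proof -
    have C: "z \<in> carrier R" using z by (auto simp: singular_def)
    have "\<exists>r\<in>carrier R. x \<otimes> r \<noteq> \<zero> \<and> (a \<otimes> z) \<otimes> (x \<otimes> r) = \<zero>" if x: "x \<in> carrier R" "x \<noteq> \<zero>" for x
      using sing[OF z x] a C x by (auto simp: m_assoc)
    then show ?thesis using C a by (simp add: singular_def)
  qed
qed

lemma sub_annihilator:
  assumes "F \<subseteq> carrier R"
  shows "M.sub {x \<in> carrier R. \<forall>c\<in>F. c \<otimes> x = \<zero>}"
proof (rule M.rsubmoduleI)
  fix x r assume "x \<in> {x \<in> carrier R. \<forall>c\<in>F. c \<otimes> x = \<zero>}" "r \<in> carrier R"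
  then show "x \<triangleleft>\<^bsub>RM\<^esub> r \<in> {x \<in> carrier R. \<forall>c\<in>F. c \<otimes> x = \<zero>}"
    using assms by (auto simp: m_assoc[symmetric] subset_iff)
qed (use assms in \<open>auto simp: r_distr subset_iff\<close>)

text \<open>A singular \<open>z\<close> has the form \<open>z = zt\<close> with \<open>t\<close> singular, and \<open>t\<close> is nilpotent because the
  annihilators of its powers stabilise.\<close>

lemma singular_zero:
  assumes z: "z \<in> singular"
  shows "z = \<zero>"
proof -
  obtain t where t: "t \<in> singular" "z \<otimes> t = z" using ideal_absorbs[OF ideal_singular z] by blast
  have C: "z \<in> carrier R" "t \<in> carrier R" using z t by (auto simp: singular_def)
  define N where "N n = {x \<in> carrier R. \<forall>c\<in>{t [^] (n::nat)}. c \<otimes> x = \<zero>}" for n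
  have "\<exists>k. \<forall>n\<ge>k. N n = N k"
  proof (rule M.rel_noethD[OF noeth])
    show s: "M.sub (N n)" for n unfolding N_def using C by (intro sub_annihilator) simp
    show "{\<zero>} \<subseteq> N n" for n using C by (auto simp: N_def)
    show "N n \<subseteq> carrier R" for n by (auto simp: N_def)
    show "N n \<subseteq> N (Suc n)" for n
    proof
      fix x assume "x \<in> N n"
      then have x: "x \<in> carrier R" "t [^] n \<otimes> x = \<zero>" by (auto simp: N_def)
      have "t [^] Suc n \<otimes> x = t \<otimes> (t [^] n \<otimes> x)" using C x(1) nat_pow_Suc2[OF C(2)] by (simp add: m_assoc del: nat_pow_Suc)
      then show "x \<in> N (Suc n)" using x C by (simp add: N_def del: nat_pow_Suc)
    qed
  qed
  then obtain k where k: "\<And>n. n \<ge> k \<Longrightarrow> N n = N k" by blast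
  \<comment> \<open>The annihilator of \<open>t\<close> is essential and would meet a nonzero
    \<open>t [^] k R\<close>. This gives an \<open>r\<close> annihilated by
    \<open>t [^] Suc k\<close> but not by \<open>t [^] k\<close>.\<close>
  have "t [^] k = \<zero>"
  proof (rule ccontr)
    assume "t [^] k \<noteq> \<zero>"
    then obtain r where r: "r \<in> carrier R" "t [^] k \<otimes> r \<noteq> \<zero>" "t \<otimes> (t [^] k \<otimes> r) = \<zero>"
      using t(1) C by (auto simp: singular_def)
    then have "t [^] Suc k \<otimes> r = \<zero>" using C nat_pow_Suc2[OF C(2), of k] by (simp add: m_assoc del: nat_pow_Suc)
    then have "r \<in> N (Suc k)" using r(1) by (simp add: N_def)
    then show False using k[of "Suc k"] r by (auto simp: N_def)
  qed
  moreover have "z \<otimes> t [^] n = z" for n :: nat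
    by (induction n) (use C t(2) in \<open>simp_all add: m_assoc[symmetric]\<close>)
  ultimately show ?thesis using C by (metis r_null)
qed

text \<open>The point is to find a finite \<open>F \<subseteq> J\<close> with zero right
  annihilator. These annihilators form descending chains, about which right noetherian rings say
  nothing directly, so a right ideal \<open>W\<close> independent of one of them is maximised
  instead.\<close>

lemma faithful_ideal:
  assumes J: "ideal J R" and ann: "\<And>x. x \<in> carrier R \<Longrightarrow> (\<And>c. c \<in> J \<Longrightarrow> c \<otimes> x = \<zero>) \<Longrightarrow> x = \<zero>"
  shows "\<one> \<in> J"
proof -
  note j = idealD[OF J]
  let ?A = "\<lambda>F. {x \<in> carrier R. \<forall>c\<in>F. c \<otimes> x = \<zero>}"
  let ?F = "{W. M.sub W \<and> (\<exists>F. finite F \<and> F \<subseteq> J \<and> W \<inter> ?A F \<subseteq> {\<zero>})}"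
  have "{\<zero>} \<in> ?F" using M.sub_zero by (auto intro!: exI[of _ "{}"])
  then have ne: "?F \<noteq> {}" by (metis empty_iff)
  have "\<exists>W\<in>?F. \<forall>W'\<in>?F. W \<subseteq> W' \<longrightarrow> W' = W"
  proof (rule M.rel_noeth_max[OF noeth _ ne])
    fix W assume "W \<in> ?F"
    then have "M.sub W" by simp
    then show "M.sub W \<and> {\<zero>} \<subseteq> W \<and> W \<subseteq> carrier R"
      using M.sub_zero_le[of W] M.rsubmodule_subset[of W] by simp
  qed
  then obtain W where W: "W \<in> ?F" and max: "\<forall>W'\<in>?F. W \<subseteq> W' \<longrightarrow> W' = W" by (elim bexE)
  obtain F where F: "finite F" "F \<subseteq> J" "W \<inter> ?A F \<subseteq> {\<zero>}" using W by blast
  have sW: "M.sub W" using W by simp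
  have FR: "F \<subseteq> carrier R" using F(2) j by blast
  have sA: "M.sub (?A F)" by (rule sub_annihilator[OF FR])
  have zero: "u = \<zero>" if u: "u \<in> ?A F" for u
  proof (rule ccontr)
    assume "u \<noteq> \<zero>"
    then obtain c where c: "c \<in> J" "c \<otimes> u \<noteq> \<zero>" using ann[of u] u by auto
    have C: "u \<in> carrier R" "c \<in> carrier R" using u c(1) j by auto
    \<comment> \<open>By nonsingularity left multiplication by \<open>c \<otimes> u\<close> is
      injective on some nonzero \<open>xR\<close>. Hence left multiplication by \<open>c\<close> is
      injective on \<open>vR\<close> for \<open>v = u \<otimes> x\<close>.\<close>
    have "c \<otimes> u \<notin> singular" using singular_zero c(2) by blast
    then obtain x where x: "x \<in> carrier R" "x \<noteq> \<zero>"
      "\<And>r. r \<in> carrier R \<Longrightarrow> x \<otimes> r \<noteq> \<zero> \<Longrightarrow> (c \<otimes> u) \<otimes> (x \<otimes> r) \<noteq> \<zero>"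
      using C by (auto simp: singular_def)
    define v where "v = u \<otimes> x"
    have v: "v \<in> carrier R" "v \<in> ?A F" using C x M.rsubmoduleD(3)[OF sA u x(1)] by (simp_all add: v_def)
    have cv: "v \<otimes> r = \<zero>" if r: "r \<in> carrier R" "c \<otimes> (v \<otimes> r) = \<zero>" for r
    proof -
      have "(c \<otimes> u) \<otimes> (x \<otimes> r) = \<zero>" using r C x(1) by (simp add: v_def m_assoc)
      then have "x \<otimes> r = \<zero>" using x(3)[OF r(1)] by blast
      then show ?thesis using C x(1) r(1) by (simp add: v_def m_assoc)
    qed
    have "v \<noteq> \<zero>"
    proof
      assume "v = \<zero>"
      then have "(c \<otimes> u) \<otimes> (x \<otimes> \<one>) = \<zero>" using C x(1) by (simp add: v_def m_assoc)
      then show False using x(3)[of \<one>] x(1,2) by simp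
    qed
    have vM: "v \<in> carrier RM" using v by simp
    have cA: "M.cyc v \<subseteq> ?A F" by (rule M.cyc_least[OF sA v(2)])
    let ?W = "W <+>\<^bsub>RM\<^esub> M.cyc v"
    have sW': "M.sub ?W" by (intro M.sub_sum sW M.sub_cyc vM)
    \<comment> \<open>The summand from \<open>vR\<close> is annihilated by \<open>F\<close>, hence
      so is the one from \<open>W\<close>, which is therefore zero. What is left lies in
      \<open>vR\<close>, where \<open>c\<close> annihilates nothing but zero.\<close>
    have "?W \<inter> ?A (insert c F) \<subseteq> {\<zero>}"
    proof
      fix y assume y: "y \<in> ?W \<inter> ?A (insert c F)"
      then have "y \<in> ?W" by blast
      then obtain w b where wb: "w \<in> W" "b \<in> M.cyc v" "y = w \<oplus>\<^bsub>RM\<^esub> b" by (rule M.sum_memE)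
      have C': "w \<in> carrier R" "b \<in> carrier R" using wb M.sub_mem[OF sW] cA by auto
      have "y \<oplus>\<^bsub>RM\<^esub> (\<ominus>\<^bsub>RM\<^esub> b) \<in> ?A F"
        using y wb(2) cA by (intro M.rsubmoduleD(2,4)[OF sA]) auto
      moreover have "y \<oplus>\<^bsub>RM\<^esub> (\<ominus>\<^bsub>RM\<^esub> b) = w"
        using C' M.M.r_neg[of b] M.M.a_assoc[of w b "\<ominus>\<^bsub>RM\<^esub> b"] M.M.a_inv_closed[of b] unfolding wb(3) by simp
      ultimately have "w = \<zero>" using F(3) wb(1) by auto
      then have yb: "y = b" using wb C' by simp
      obtain r where "r \<in> carrier R" "b = v \<otimes> r" using wb(2) by (auto simp: M.cyc_def)
      then show "y \<in> {\<zero>}" using cv y yb by simp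
    qed
    then have "?W \<in> ?F" using F c(1) sW' by (intro CollectI conjI exI[of _ "insert c F"]) auto
    moreover have "W \<subseteq> ?W" by (rule M.sum_upper1[OF sW M.sub_cyc[OF vM]])
    ultimately have "?W = W" using max by blast
    then have "v \<in> W" using M.sum_upper2[OF sW M.sub_cyc[OF vM]] M.cyc_self[OF vM] by blast
    then show False using F(3) v(2) \<open>v \<noteq> \<zero>\<close> by blast
  qed
  obtain e where e: "e \<in> J" "\<And>c. c \<in> F \<Longrightarrow> c \<otimes> e = c" using ideal_absorbs_finite[OF J F(1,2)] by blast
  have eR: "e \<in> carrier R" using e j by simp
  \<comment> \<open>An element absorbed by all of \<open>F\<close> differs from
    \<open>\<one>\<close> by something that \<open>F\<close> annihilates.\<close>
  have "\<one> \<oplus> \<ominus> e = \<zero>"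
  proof (rule zero)
    have "c \<otimes> (\<one> \<oplus> \<ominus> e) = \<zero>" if "c \<in> F" for c
      using e(2)[OF that] eR FR that by (auto simp: r_distr r_minus r_neg subset_iff)
    then show "\<one> \<oplus> \<ominus> e \<in> ?A F" using eR by simp
  qed
  then have "\<one> = e" using eR minus_equality[of "\<ominus> e" \<one>] by (metis a_inv_closed a_comm minus_equality minus_minus one_closed)
  then show ?thesis using e by simp
qed

section \<open>Every ideal is a direct summand\<close>

definition annihilator :: "'a set \<Rightarrow> 'a set"
  where "annihilator I = {x \<in> carrier R. \<forall>c\<in>I. c \<otimes> x = \<zero>}"

lemma ideal_annihilator:
  assumes "ideal I R" shows "ideal (annihilator I) R"
proof (rule sub_idealI)
  note i = idealD[OF assms]
  show "M.sub (annihilator I)" unfolding annihilator_def by (rule sub_annihilator) (use i in blast)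
  show "r \<otimes> x \<in> annihilator I" if "r \<in> carrier R" "x \<in> annihilator I" for r x
    using that i by (auto simp: annihilator_def m_assoc[symmetric])
qed

text \<open>Absorption is applied to the annihilator: \<open>x = x \<otimes> j\<close> with
  \<open>j\<close> in it, and the product vanishes because \<open>x\<close> lies in
  \<open>I\<close>.\<close>

lemma annihilator_Int: "ideal I R \<Longrightarrow> I \<inter> annihilator I = {\<zero>}"
proof
  assume I: "ideal I R"
  show "I \<inter> annihilator I \<subseteq> {\<zero>}"
  proof
    fix x assume x: "x \<in> I \<inter> annihilator I"
    then obtain j where "j \<in> annihilator I" "x \<otimes> j = x" using ideal_absorbs[OF ideal_annihilator[OF I]] by blast
    then show "x \<in> {\<zero>}" using x by (auto simp: annihilator_def)
  qed
  show "{\<zero>} \<subseteq> I \<inter> annihilator I" using idealD(2)[OF I] idealD(2)[OF ideal_annihilator[OF I]] by simp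
qed

text \<open>The sum is a faithful ideal: an \<open>x\<close> that it annihilates has the form
  \<open>x \<otimes> t\<close> with \<open>t\<close> annihilated by the sum, and \<open>x\<close>
  itself belongs to the annihilator of \<open>I\<close>, so the product is zero.\<close>

lemma annihilator_sum: "ideal I R \<Longrightarrow> I <+>\<^bsub>R\<^esub> annihilator I = carrier R"
proof -
  assume I: "ideal I R"
  let ?J = "I <+>\<^bsub>R\<^esub> annihilator I"
  note A = ideal_annihilator[OF I]
  have J: "ideal ?J R" by (rule add_ideals[OF I A])
  have "I \<subseteq> ?J" "annihilator I \<subseteq> ?J"
    using M.sum_upper1[OF ideal_sub[OF I] ideal_sub[OF A]] M.sum_upper2[OF ideal_sub[OF I] ideal_sub[OF A]] by simp_all
  have "\<one> \<in> ?J"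
  proof (rule faithful_ideal[OF J])
    fix x assume x: "x \<in> carrier R" "\<And>c. c \<in> ?J \<Longrightarrow> c \<otimes> x = \<zero>"
    have "x \<in> annihilator ?J" using x by (simp add: annihilator_def)
    then obtain t where t: "t \<in> annihilator ?J" "x \<otimes> t = x" using ideal_absorbs[OF ideal_annihilator[OF J]] by blast
    have "x \<in> annihilator I" using x \<open>I \<subseteq> ?J\<close> by (auto simp: annihilator_def)
    then show "x = \<zero>" using t \<open>annihilator I \<subseteq> ?J\<close> by (auto simp: annihilator_def)
  qed
  then show ?thesis using ideal.one_imp_carrier[OF J] by simp
qed


section \<open>Ideals as rings with identity\<close>

definition block_unit :: "'a set \<Rightarrow> 'a"
  where "block_unit I = (THE e. e \<in> I \<and> (\<forall>x\<in>I. e \<otimes> x = x \<and> x \<otimes> e = x))"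

lemma block_unit_eq:
  assumes I: "ideal I R" and e: "e \<in> I" "\<And>x. x \<in> I \<Longrightarrow> e \<otimes> x = x" "\<And>x. x \<in> I \<Longrightarrow> x \<otimes> e = x"
  shows "block_unit I = e"
  unfolding block_unit_def
proof (rule the_equality)
  fix f assume f: "f \<in> I \<and> (\<forall>x\<in>I. f \<otimes> x = x \<and> x \<otimes> f = x)"
  then have "f \<otimes> e = f" "f \<otimes> e = e" using e by auto
  then show "f = e" by simp
qed (use e in auto)

text \<open>The identity is the component \<open>e\<close> of \<open>\<one>\<close> in
  \<open>I\<close>. The other component \<open>f\<close> satisfies
  \<open>x \<otimes> f = \<zero>\<close> by definition, and \<open>f \<otimes> x = \<zero>\<close>
  since this product lies in both \<open>I\<close> and its annihilator.\<close>

lemma block_unit: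
  assumes I: "ideal I R"
  shows "block_unit I \<in> I" "\<And>x. x \<in> I \<Longrightarrow> block_unit I \<otimes> x = x" "\<And>x. x \<in> I \<Longrightarrow> x \<otimes> block_unit I = x"
proof -
  note A = ideal_annihilator[OF I] and i = idealD[OF I] and a = idealD[OF ideal_annihilator[OF I]]
  have "\<one> \<in> I <+>\<^bsub>RM\<^esub> annihilator I" using annihilator_sum[OF I] by simp
  then obtain e f where ef: "e \<in> I" "f \<in> annihilator I" "\<one> = e \<oplus> f" by (rule M.sum_memE) simp
  have C: "e \<in> carrier R" "f \<in> carrier R" using ef i a by auto
  have r: "x \<otimes> e = x" if x: "x \<in> I" for x
  proof -
    have xR: "x \<in> carrier R" using x i by simp
    have "x = x \<otimes> (e \<oplus> f)" using xR ef(3) by (metis r_one)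
    also have "\<dots> = x \<otimes> e \<oplus> x \<otimes> f" using xR C by (simp add: r_distr)
    also have "x \<otimes> f = \<zero>" using ef(2) x by (simp add: annihilator_def)
    finally show ?thesis using xR C by simp
  qed
  have l: "e \<otimes> x = x" if x: "x \<in> I" for x
  proof -
    have xR: "x \<in> carrier R" using x i by simp
    have "f \<otimes> x \<in> I \<inter> annihilator I" using i(6)[OF x C(2)] a(5)[OF ef(2) xR] by blast
    then have "f \<otimes> x = \<zero>" using annihilator_Int[OF I] by blast
    moreover have "x = (e \<oplus> f) \<otimes> x" using xR ef(3) by (metis l_one)
    ultimately show ?thesis using xR C by (simp add: l_distr)
  qed
  have "block_unit I = e" by (rule block_unit_eq[OF I ef(1) l r])
  then show "block_unit I \<in> I" "\<And>x. x \<in> I \<Longrightarrow> block_unit I \<otimes> x = x" "\<And>x. x \<in> I \<Longrightarrow> x \<otimes> block_unit I = x"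
    using ef l r by simp_all
qed

definition block :: "'a set \<Rightarrow> 'a ring"
  where "block I = \<lparr> carrier = I, mult = mult R, one = block_unit I, zero = \<zero>, add = add R \<rparr>"

lemma block_simps [simp]:
  "carrier (block I) = I" "x \<otimes>\<^bsub>block I\<^esub> y = x \<otimes> y" "x \<oplus>\<^bsub>block I\<^esub> y = x \<oplus> y"
  "\<zero>\<^bsub>block I\<^esub> = \<zero>" "\<one>\<^bsub>block I\<^esub> = block_unit I"
  by (simp_all add: block_def)

lemma ring_block:
  assumes I: "ideal I R" shows "ring (block I)"
proof (rule ringI)
  note i = idealD[OF I] and u = block_unit[OF I]
  show "abelian_group (block I)"
  proof (rule abelian_groupI)
    fix x assume "x \<in> carrier (block I)"
    then show "\<exists>y\<in>carrier (block I). y \<oplus>\<^bsub>block I\<^esub> x = \<zero>\<^bsub>block I\<^esub>"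
      using i by (intro bexI[of _ "\<ominus> x"]) (simp_all add: l_neg)
  qed (use i in \<open>simp_all add: add.m_ac\<close>)
  show "monoid (block I)" by (rule monoidI) (use i u in \<open>simp_all add: m_assoc\<close>)
qed (use idealD[OF I] in \<open>simp_all add: l_distr r_distr\<close>)

text \<open>Products of elements of \<open>H\<close> and \<open>H'\<close> lie in the intersection
  and vanish, so addition is a multiplicative map from the product ring.\<close>

lemma block_iso:
  assumes H: "ideal H R" and H': "ideal H' R" and J: "ideal J R"
    and dis: "H \<inter> H' = {\<zero>}" and sum: "H <+>\<^bsub>R\<^esub> H' = J"
  shows "block J \<simeq> RDirProd (block H) (block H')"
proof -
  note h = idealD[OF H] block_unit[OF H] and h' = idealD[OF H'] block_unit[OF H'] and j = idealD[OF J]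
  have HJ: "H \<subseteq> J" "H' \<subseteq> J"
    using M.sum_upper1[OF ideal_sub[OF H] ideal_sub[OF H']] M.sum_upper2[OF ideal_sub[OF H] ideal_sub[OF H']] sum by simp_all
  have z: "a \<otimes> b = \<zero>" "b \<otimes> a = \<zero>" if "a \<in> H" "b \<in> H'" for a b
  proof -
    have "a \<otimes> b \<in> H \<inter> H'" "b \<otimes> a \<in> H \<inter> H'" using that h h' by simp_all
    then show "a \<otimes> b = \<zero>" "b \<otimes> a = \<zero>" using dis by simp_all
  qed
  let ?f = "\<lambda>(a, b). a \<oplus> b"
  have mult: "(a \<oplus> b) \<otimes> (c \<oplus> d) = a \<otimes> c \<oplus> b \<otimes> d" if "a \<in> H" "b \<in> H'" "c \<in> H" "d \<in> H'" for a b c d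
    using that h(1) h'(1) z by (simp add: l_distr r_distr)
  have unit: "block_unit J = block_unit H \<oplus> block_unit H'"
  proof (rule block_unit_eq[OF J])
    show "block_unit H \<oplus> block_unit H' \<in> J"
      by (rule j(3)[OF subsetD[OF HJ(1) h(7)] subsetD[OF HJ(2) h'(7)]])
    fix x assume "x \<in> J"
    then have "x \<in> H <+>\<^bsub>RM\<^esub> H'" using sum by simp
    then obtain a b where "a \<in> H" "b \<in> H'" "x = a \<oplus> b" by (rule M.sum_memE) simp
    then show "(block_unit H \<oplus> block_unit H') \<otimes> x = x" "x \<otimes> (block_unit H \<oplus> block_unit H') = x"
      using mult h h' by simp_all
  qed
  have "?f \<in> ring_iso (RDirProd (block H) (block H')) (block J)"
  proof (rule ring_iso_memI)
    show "bij_betw ?f (carrier (RDirProd (block H) (block H'))) (carrier (block J))"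
      unfolding bij_betw_def
    proof
      show "inj_on ?f (carrier (RDirProd (block H) (block H')))"
      proof (rule inj_onI)
        fix p q assume "p \<in> carrier (RDirProd (block H) (block H'))" "q \<in> carrier (RDirProd (block H) (block H'))" "?f p = ?f q"
        then obtain a b c d where *: "p = (a, b)" "q = (c, d)" "a \<in> H" "b \<in> H'" "c \<in> H" "d \<in> H'" "a \<oplus> b = c \<oplus> d"
          by (auto simp: RDirProd_carrier)
        have C: "a \<in> carrier R" "b \<in> carrier R" "c \<in> carrier R" "d \<in> carrier R" using * h h' by simp_all
        have "a \<oplus> \<ominus> c = d \<oplus> \<ominus> b"
        proof -
          have "a \<oplus> \<ominus> c = (a \<oplus> b) \<oplus> (\<ominus> b \<oplus> \<ominus> c)" using C by (simp add: a_assoc r_neg1 r_neg2)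
          also have "\<dots> = (c \<oplus> d) \<oplus> (\<ominus> b \<oplus> \<ominus> c)" using * by simp
          also have "\<dots> = (d \<oplus> \<ominus> b) \<oplus> (c \<oplus> \<ominus> c)"
            using C by (simp only: add.m_ac a_inv_closed add.m_closed)
          finally show ?thesis using C by (simp add: r_neg)
        qed
        moreover have "a \<oplus> \<ominus> c \<in> H" "d \<oplus> \<ominus> b \<in> H'" using * h h' by simp_all
        ultimately have "a \<oplus> \<ominus> c = \<zero>" "d \<oplus> \<ominus> b = \<zero>" using dis by auto
        then have "a = c" "d = b" using C by (metis a_inv_closed minus_equality minus_minus)+
        then show "p = q" using * by simp
      qed
      show "?f ` carrier (RDirProd (block H) (block H')) = carrier (block J)"
        using sum by (force simp: RDirProd_carrier set_add_def')
    qed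
  qed (use h h' j HJ mult unit in \<open>auto simp: RDirProd_def DirProd_def monoid.defs subset_iff add.m_ac\<close>)
  then have "RDirProd (block H) (block H') \<simeq> block J" unfolding is_ring_iso_def by blast
  then show ?thesis by (rule ring_iso_sym[OF RDirProd_ring[OF ring_block[OF H] ring_block[OF H']]])
qed

lemma ring_iso_block_carrier: "R \<simeq> block (carrier R)"
proof -
  have "block_unit (carrier R) = \<one>" by (rule block_unit_eq[OF oneideal]) simp_all
  then have "id \<in> ring_iso R (block (carrier R))" by (intro ring_iso_memI) simp_all
  then show ?thesis unfolding is_ring_iso_def by blast
qed

lemma block_module: "ideal I R \<Longrightarrow> right_module (block I) (regular_module (block I))"
  by (rule right_module_regular[OF ring_block])

text \<open>For \<open>x\<close> in \<open>I\<close> one has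
  \<open>x \<otimes> r = x \<otimes> (block_unit I \<otimes> r)\<close> with the second factor in
  \<open>I\<close>, so the action of \<open>R\<close> on submodules of the block is already that of
  the block.\<close>

lemma block_sub_iff:
  assumes I: "ideal I R"
  shows "rsubmodule (block I) (regular_module (block I)) N \<longleftrightarrow> M.sub N \<and> N \<subseteq> I"
proof -
  interpret B: right_module "block I" "regular_module (block I)" by (rule block_module[OF I])
  note i = idealD[OF I] and u = block_unit[OF I]
  show ?thesis
  proof
    assume N: "B.sub N"
    note n = B.rsubmoduleD[OF N, simplified]
    have NI: "N \<subseteq> I" using B.rsubmodule_subset[OF N] by simp
    have "M.sub N"
    proof (rule M.rsubmoduleI)
      show "N \<subseteq> carrier RM" using NI i by auto
      show "x \<triangleleft>\<^bsub>RM\<^esub> r \<in> N" if x: "x \<in> N" and r: "r \<in> carrier R" for x r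
      proof -
        have xI: "x \<in> I" using x NI by blast
        have "x \<otimes> r = (x \<otimes> block_unit I) \<otimes> r" using u(3)[OF xI] by simp
        also have "\<dots> = x \<otimes> (block_unit I \<otimes> r)" using xI u(1) i(1) r by (simp add: m_assoc)
        also have "\<dots> \<in> N" using n(3)[OF x] i(5)[OF u(1) r] by simp
        finally show ?thesis by simp
      qed
    qed (use n in simp_all)
    then show "M.sub N \<and> N \<subseteq> I" using NI by simp
  next
    assume N: "M.sub N \<and> N \<subseteq> I"
    then have n: "M.sub N" by simp
    show "B.sub N"
      by (rule B.rsubmoduleI) (use N M.rsubmoduleD[OF n] i(1) in auto)
  qed
qed

lemma block_ideal:
  assumes I: "ideal I R" and N: "ideal N (block I)"
  shows "ideal N R" "N \<subseteq> I"
proof -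
  interpret B: ring "block I" by (rule ring_block[OF I])
  interpret BM: right_module "block I" "regular_module (block I)" by (rule block_module[OF I])
  note i = idealD[OF I] and u = block_unit[OF I]
  interpret N: ideal N "block I" by (rule N)
  show NI: "N \<subseteq> I" using N.a_subset by simp
  have "BM.sub N"
    by (rule BM.rsubmoduleI) (use NI N.a_closed N.zero_closed N.I_r_closed in \<open>simp_all\<close>)
  then have s: "M.sub N" using block_sub_iff[OF I] by simp
  show "ideal N R"
  proof (rule sub_idealI[OF s])
    fix r x assume r: "r \<in> carrier R" and x: "x \<in> N"
    have xI: "x \<in> I" using x NI by blast
    have "r \<otimes> x = r \<otimes> (block_unit I \<otimes> x)" using u(2)[OF xI] by simp
    also have "\<dots> = (r \<otimes> block_unit I) \<otimes> x" using xI u(1) i(1) r by (simp add: m_assoc)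
    also have "\<dots> \<in> N" using N.I_l_closed[OF x, of "r \<otimes> block_unit I"] i(6)[OF u(1) r] by simp
    finally show "r \<otimes> x \<in> N" .
  qed
qed

lemma right_noetherian_block:
  assumes I: "ideal I R"
  shows "right_noetherian_ring (block I)"
  unfolding right_noetherian_ring_def noetherian_module_def
proof (intro conjI allI impI ring_block[OF I], elim conjE)
  fix N :: "nat \<Rightarrow> 'a set"
  assume "\<forall>n. rsubmodule (block I) (regular_module (block I)) (N n)" and inc: "\<forall>n. N n \<subseteq> N (Suc n)"
  then have N: "M.sub (N n)" for n by (simp add: block_sub_iff[OF I])
  show "\<exists>k. \<forall>n\<ge>k. N n = N k"
    by (rule M.rel_noethD[OF noeth N])
      (use M.sub_zero_le[OF N] M.rsubmodule_subset[OF N] inc in simp_all)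
qed

section \<open>The socle as a semisimple artinian factor\<close>

abbreviation "soc \<equiv> socle R RM"

lemma block_covers_iff:
  assumes I: "ideal I R"
  shows "right_module.covers (block I) (regular_module (block I)) {\<zero>} V \<longleftrightarrow> M.covers {\<zero>} V \<and> V \<subseteq> I"
proof -
  interpret B: right_module "block I" "regular_module (block I)" by (rule block_module[OF I])
  have zI: "{\<zero>} \<subseteq> I" using idealD(2)[OF I] by simp
  show ?thesis
  proof (cases "V \<subseteq> I")
    case True
    then have "B.sub N \<and> {\<zero>} \<subseteq> N \<and> N \<subseteq> V \<longleftrightarrow> M.sub N \<and> {\<zero>} \<subseteq> N \<and> N \<subseteq> V" for N
      by (auto simp: block_sub_iff[OF I])
    moreover have "B.sub V \<longleftrightarrow> M.sub V" "B.sub {\<zero>} \<longleftrightarrow> M.sub {\<zero>}" using True zI by (simp_all add: block_sub_iff[OF I])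
    ultimately show ?thesis unfolding B.covers_def M.covers_def using True by simp
  qed (simp add: B.covers_def block_sub_iff[OF I])
qed

lemma block_socle:
  assumes I: "ideal I R"
  shows "right_socle (block I) =
    rmod_span (block I) (regular_module (block I)) (\<Union>{V. M.covers {\<zero>} V \<and> V \<subseteq> I})"
proof -
  interpret B: right_module "block I" "regular_module (block I)" by (rule block_module[OF I])
  show ?thesis using B.socle_eq block_covers_iff[OF I] by (simp add: right_socle_def)
qed

lemma block_socle_zero:
  assumes I: "ideal I R" and "I \<inter> soc \<subseteq> {\<zero>}"
  shows "right_socle (block I) = {\<zero>\<^bsub>block I\<^esub>}"
proof -
  interpret B: right_module "block I" "regular_module (block I)" by (rule block_module[OF I])
  have "False" if V: "M.covers {\<zero>} V" "V \<subseteq> I" for V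
  proof -
    have "V \<subseteq> soc" using M.covers_socle V(1) by simp
    then show False using assms(2) V(2) M.coversD(3,4)[OF V(1)] by blast
  qed
  then have "{V. M.covers {\<zero>} V \<and> V \<subseteq> I} = {}" by blast
  then have eq: "right_socle (block I) = rmod_span (block I) (regular_module (block I)) {}"
    unfolding block_socle[OF I] by (simp only: Union_empty)
  have "rmod_span (block I) (regular_module (block I)) {} \<subseteq> {\<zero>\<^bsub>regular_module (block I)\<^esub>}"
    by (rule B.span_least) (use B.sub_zero in simp_all)
  moreover have "{\<zero>\<^bsub>regular_module (block I)\<^esub>} \<subseteq> rmod_span (block I) (regular_module (block I)) {}"
    by (rule B.sub_zero_le[OF B.sub_span]) simp
  ultimately show ?thesis using eq by (simp add: subset_antisym)
qed

text \<open>Left multiplication by \<open>r\<close> is a homomorphism of right modules and takes a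
  simple right ideal to zero or to a simple one.\<close>

lemma ideal_socle: "ideal soc R"
proof (rule sub_idealI[OF M.sub_socle])
  fix r x assume r: "r \<in> carrier R" and x: "x \<in> soc"
  note s = M.rsubmoduleD[OF M.sub_socle, simplified] and sM = M.sub_mem[OF M.sub_socle, simplified]
  let ?W = "{x \<in> carrier R. r \<otimes> x \<in> soc}"
  have sW: "M.sub ?W"
  proof (rule M.rsubmoduleI)
    show "x \<triangleleft>\<^bsub>RM\<^esub> t \<in> ?W" if "x \<in> ?W" "t \<in> carrier R" for x t
      using that r s(3)[of "r \<otimes> x" t] by (simp add: m_assoc)
  qed (use r s in \<open>auto simp: r_distr\<close>)
  have "soc \<subseteq> ?W"
  proof (rule M.rel_ss_le[OF M.rel_ss_socle sW])
    show "{\<zero>\<^bsub>RM\<^esub>} \<subseteq> ?W" by (rule M.sub_zero_le[OF sW])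
    fix V assume V: "M.covers {\<zero>\<^bsub>RM\<^esub>} V"
    note v = M.coversD[OF V] and vD = M.rsubmoduleD[OF M.coversD(2)[OF V], simplified]
    have VR: "V \<subseteq> carrier R" using M.rsubmodule_subset[OF v(2)] by simp
    let ?rV = "(\<lambda>v. r \<otimes> v) ` V"
    have pull: "M.sub {v \<in> V. r \<otimes> v \<in> N}" if N: "M.sub N" for N
    proof (rule M.rsubmoduleI)
      note n = M.rsubmoduleD[OF N, simplified]
      show "x \<triangleleft>\<^bsub>RM\<^esub> t \<in> {v \<in> V. r \<otimes> v \<in> N}" if "x \<in> {v \<in> V. r \<otimes> v \<in> N}" "t \<in> carrier R" for x t
        using that r VR vD(3) n(3)[of "r \<otimes> x" t] by (auto simp: m_assoc subset_iff)
      show "x \<oplus>\<^bsub>RM\<^esub> y \<in> {v \<in> V. r \<otimes> v \<in> N}" if "x \<in> {v \<in> V. r \<otimes> v \<in> N}" "y \<in> {v \<in> V. r \<otimes> v \<in> N}" for x y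
        using that r VR vD(2) n(2) by (auto simp: r_distr subset_iff)
    qed (use r VR vD(1) M.rsubmoduleD(1)[OF N] in auto)
    have srV: "M.sub ?rV"
    proof (rule M.rsubmoduleI)
      show "\<zero>\<^bsub>RM\<^esub> \<in> ?rV" using vD(1) r by (auto intro!: image_eqI[of _ _ \<zero>])
      show "x \<oplus>\<^bsub>RM\<^esub> y \<in> ?rV" if xy: "x \<in> ?rV" "y \<in> ?rV" for x y
      proof -
        obtain a b where "a \<in> V" "b \<in> V" "x = r \<otimes> a" "y = r \<otimes> b" using xy by blast
        then show ?thesis using r VR vD(2) by (auto simp: r_distr subset_iff intro!: image_eqI[of _ _ "a \<oplus> b"])
      qed
      show "x \<triangleleft>\<^bsub>RM\<^esub> t \<in> ?rV" if xt: "x \<in> ?rV" "t \<in> carrier R" for x t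
      proof -
        obtain a where "a \<in> V" "x = r \<otimes> a" using xt by blast
        then show ?thesis using r VR vD(3) xt(2) by (auto simp: m_assoc subset_iff intro!: image_eqI[of _ _ "a \<otimes> t"])
      qed
    qed (use r VR in auto)
    have rV: "?rV \<subseteq> soc"
    proof (cases "?rV = {\<zero>}")
      case True
      then show ?thesis using s(1) by simp
    next
      case False
      have "M.covers {\<zero>\<^bsub>RM\<^esub>} ?rV"
      proof (rule M.coversI[OF M.sub_zero srV M.sub_zero_le[OF srV]])
        show "{\<zero>\<^bsub>RM\<^esub>} \<noteq> ?rV" using False by simp
        fix N assume N: "M.sub N" "N \<subseteq> ?rV" "N \<noteq> ?rV"
        let ?P = "{v \<in> V. r \<otimes> v \<in> N}"
        have "?P \<noteq> V" using N(2,3) by blast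
        then have "?P = {\<zero>}"
          using v(5)[OF pull[OF N(1)] M.sub_zero_le[OF pull[OF N(1)]]] by simp
        have "x = \<zero>" if x: "x \<in> N" for x
        proof -
          obtain v where "v \<in> V" "x = r \<otimes> v" using x N(2) by blast
          then have "v \<in> ?P" using x by simp
          then have "v = \<zero>" using \<open>?P = {\<zero>}\<close> by simp
          then show ?thesis using \<open>x = r \<otimes> v\<close> r by simp
        qed
        then have "N \<subseteq> {\<zero>\<^bsub>RM\<^esub>}" by (simp add: subset_iff)
        then show "N = {\<zero>\<^bsub>RM\<^esub>}" using M.sub_zero_le[OF N(1)] by (rule subset_antisym)
      qed
      then show ?thesis by (rule M.covers_socle)
    qed
    then show "V \<subseteq> ?W" using VR by blast
  qed
  then show "r \<otimes> x \<in> soc" using x by blast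
qed

lemma semisimple_artinian_block_socle: "semisimple_artinian_ring (block soc)"
proof -
  note I = ideal_socle
  interpret B: right_module "block soc" "regular_module (block soc)" by (rule block_module[OF I])
  have "right_socle (block soc) = soc"
  proof
    let ?X = "\<Union>{V. M.covers {\<zero>} V \<and> V \<subseteq> soc}"
    have s: "B.sub (right_socle (block soc))" using B.sub_socle by (simp add: right_socle_def)
    then show "right_socle (block soc) \<subseteq> soc" by (simp add: block_sub_iff[OF I])
    show "soc \<subseteq> right_socle (block soc)"
    proof (rule M.rel_ss_le[OF M.rel_ss_socle])
      show sub: "M.sub (right_socle (block soc))" using s by (simp add: block_sub_iff[OF I])
      show "{\<zero>\<^bsub>RM\<^esub>} \<subseteq> right_socle (block soc)" by (rule M.sub_zero_le[OF sub])
      fix V assume "M.covers {\<zero>\<^bsub>RM\<^esub>} V" "V \<subseteq> soc"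
      then show "V \<subseteq> right_socle (block soc)"
        unfolding block_socle[OF I] using B.span_superset[of ?X] by auto
    qed
  qed
  then have "semisimple_module (block soc) (regular_module (block soc))"
    by (simp add: semisimple_module_def right_socle_def)
  moreover have "right_artinian_ring (block soc)"
    unfolding right_artinian_ring_def artinian_module_def
  proof (intro conjI allI impI ring_block[OF I], elim conjE)
    fix N :: "nat \<Rightarrow> 'a set"
    assume "\<forall>n. rsubmodule (block soc) (regular_module (block soc)) (N n)" and dec: "\<forall>n. N (Suc n) \<subseteq> N n"
    then have N: "M.sub (N n)" "N n \<subseteq> soc" for n by (simp_all add: block_sub_iff[OF I])
    have "M.rel_noeth {\<zero>\<^bsub>RM\<^esub>} soc"
      using M.rel_noeth_mono[OF noeth order_refl M.rsubmodule_subset[OF M.sub_socle, simplified]] by simp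
    then show "\<exists>k. \<forall>n\<ge>k. N n = N k"
      by (rule M.rel_ss_noeth_artinian[OF M.rel_ss_socle])
        (use N M.sub_zero_le[OF N(1)] dec in simp_all)
  qed
  ultimately show ?thesis by (simp add: semisimple_artinian_ring_def)
qed

section \<open>Decomposition into simple rings\<close>

lemma annihilator_antimono: "I \<subseteq> J \<Longrightarrow> annihilator J \<subseteq> annihilator I"
  by (auto simp: annihilator_def)

lemma ideal_split:
  assumes H: "ideal H R" and J: "ideal J R" and "H \<subseteq> J"
  shows "H <+>\<^bsub>R\<^esub> (J \<inter> annihilator H) = J"
proof -
  have "(H <+>\<^bsub>RM\<^esub> annihilator H) \<inter> J = H <+>\<^bsub>RM\<^esub> (annihilator H \<inter> J)"
    by (rule M.modular) (use assms ideal_sub ideal_annihilator in simp_all)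
  then show ?thesis using annihilator_sum[OF H] idealD(1)[OF J] by (simp add: Int_commute Int_absorb2 subset_iff)
qed

text \<open>The complement \<open>J \<inter> annihilator H\<close> of \<open>H\<close> in
  \<open>J\<close> is contained in \<open>J \<inter> annihilator J\<close>, which is zero.\<close>

lemma ideal_eq_if_annihilator:
  assumes H: "ideal H R" and J: "ideal J R" and "H \<subseteq> J" "annihilator H \<subseteq> annihilator J"
  shows "H = J"
proof -
  have "J \<inter> annihilator H \<subseteq> {\<zero>}" using annihilator_Int[OF J] assms(4) by blast
  then have "J \<inter> annihilator H \<subseteq> H" using idealD(2)[OF H] by blast
  then have "H <+>\<^bsub>RM\<^esub> (J \<inter> annihilator H) \<subseteq> H" by (intro M.sum_least ideal_sub[OF H]) simp_all
  then show ?thesis using ideal_split[OF assms(1-3)] assms(3) by simp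
qed

text \<open>Taking annihilators reverses strict inclusions of ideals, so the ascending chain
  condition for right ideals gives a descending one for two-sided ideals.\<close>

lemma max_annihilator:
  assumes "\<F> \<noteq> {}" "\<And>J. J \<in> \<F> \<Longrightarrow> ideal J R"
  shows "\<exists>J\<in>\<F>. \<forall>J'\<in>\<F>. J' \<subseteq> J \<longrightarrow> J' = J"
proof -
  have "\<exists>N\<in>annihilator ` \<F>. \<forall>N'\<in>annihilator ` \<F>. N \<subseteq> N' \<longrightarrow> N' = N"
  proof (rule M.rel_noeth_max[OF noeth])
    fix N assume "N \<in> annihilator ` \<F>"
    then have "M.sub N" using assms(2) ideal_sub ideal_annihilator by blast
    then show "M.sub N \<and> {\<zero>} \<subseteq> N \<and> N \<subseteq> carrier R" using M.sub_zero_le[of N] M.rsubmodule_subset[of N] by simp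
  qed (use assms in simp)
  then obtain J where J: "J \<in> \<F>" and max: "\<And>J'. J' \<in> \<F> \<Longrightarrow> annihilator J \<subseteq> annihilator J' \<Longrightarrow> annihilator J' = annihilator J"
    by blast
  have "J' = J" if "J' \<in> \<F>" "J' \<subseteq> J" for J'
    by (rule ideal_eq_if_annihilator) (use assms(2) J that max[OF that(1) annihilator_antimono[OF that(2)]] in auto)
  then show ?thesis using J by blast
qed

text \<open>In a minimal counterexample \<open>J\<close> choose a minimal nonzero ideal
  \<open>H\<close>. Its block is simple, because ideals of a block are ideals of \<open>R\<close>.
  The complement of \<open>H\<close> in \<open>J\<close> is smaller than \<open>J\<close> and
  therefore a finite product already.\<close>

lemma block_product_of_simple:
  assumes "ideal J R" "J \<inter> soc \<subseteq> {\<zero>}"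
  shows "\<exists>Ts :: 'a ring list. block J \<simeq> RDirProd_list Ts \<and>
    (\<forall>T\<in>set Ts. simple_ring T \<and> right_noetherian_ring T \<and> right_socle T = {\<zero>\<^bsub>T\<^esub>})"
proof (rule ccontr)
  let ?good = "\<lambda>J. \<exists>Ts :: 'a ring list. block J \<simeq> RDirProd_list Ts \<and>
    (\<forall>T\<in>set Ts. simple_ring T \<and> right_noetherian_ring T \<and> right_socle T = {\<zero>\<^bsub>T\<^esub>})"
  let ?F = "{J. ideal J R \<and> J \<inter> soc \<subseteq> {\<zero>} \<and> \<not> ?good J}"
  assume "\<not> ?good J"
  then have "?F \<noteq> {}" using assms by blast
  then have "\<exists>J\<in>?F. \<forall>J'\<in>?F. J' \<subseteq> J \<longrightarrow> J' = J" by (rule max_annihilator) simp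
  then obtain J where JF: "J \<in> ?F" and min: "\<forall>J'\<in>?F. J' \<subseteq> J \<longrightarrow> J' = J" by (elim bexE)
  have J: "ideal J R" "J \<inter> soc \<subseteq> {\<zero>}" "\<not> ?good J" using JF by blast+
  have "J \<noteq> {\<zero>}"
  proof
    assume J0: "J = {\<zero>}"
    \<comment> \<open>The block of the zero ideal is the empty product.\<close>
    have "(\<lambda>_. []) \<in> ring_iso (block J) nil_ring"
      by (rule ring_iso_memI) (auto simp: J0 monoid.defs bij_betw_def)
    then have "block J \<simeq> RDirProd_list []" unfolding is_ring_iso_def by auto
    then show False using J(3) by (metis empty_iff empty_set)
  qed
  let ?G = "{H. ideal H R \<and> H \<subseteq> J \<and> H \<noteq> {\<zero>}}"
  have "J \<in> ?G" using J \<open>J \<noteq> {\<zero>}\<close> by simp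
  then have "?G \<noteq> {}" by blast
  then have "\<exists>H\<in>?G. \<forall>H'\<in>?G. H' \<subseteq> H \<longrightarrow> H' = H" by (rule max_annihilator) simp
  then obtain H where HG: "H \<in> ?G" and minH: "\<forall>H'\<in>?G. H' \<subseteq> H \<longrightarrow> H' = H" by (elim bexE)
  have H: "ideal H R" "H \<subseteq> J" "H \<noteq> {\<zero>}" using HG by simp_all
  have simple: "simple_ring (block H)"
    unfolding simple_ring_def
  proof (intro conjI allI impI ring_block[OF H(1)])
    fix N assume "ideal N (block H)"
    then have N: "ideal N R" "N \<subseteq> H" using block_ideal[OF H(1)] by blast+
    then show "N = {\<zero>\<^bsub>block H\<^esub>} \<or> N = carrier (block H)"
      using minH[rule_format, of N] H(2) by auto
  qed (use H in simp)
  have HS: "H \<inter> soc \<subseteq> {\<zero>}" using H(2) J(2) by blast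
  define H' where "H' = J \<inter> annihilator H"
  have H': "ideal H' R" "H' \<subseteq> J" unfolding H'_def using i_intersect[OF J(1) ideal_annihilator[OF H(1)]] by simp_all
  have dis: "H \<inter> H' = {\<zero>}" using annihilator_Int[OF H(1)] idealD(2)[OF J(1)] by (auto simp: H'_def)
  have sum: "H <+>\<^bsub>R\<^esub> H' = J" unfolding H'_def by (rule ideal_split[OF H(1) J(1) H(2)])
  have "H' \<noteq> J" using dis H(2,3) by blast
  then have "H' \<notin> ?F" using min H'(2) by blast
  then have "?good H'" using H' J(2) by blast
  then obtain Ts :: "'a ring list" where Ts: "block H' \<simeq> RDirProd_list Ts"
    "\<forall>T\<in>set Ts. simple_ring T \<and> right_noetherian_ring T \<and> right_socle T = {\<zero>\<^bsub>T\<^esub>}" by blast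
  obtain f where "f \<in> ring_iso (block H') (RDirProd_list Ts)" using Ts(1) unfolding is_ring_iso_def by blast
  from ring_iso_set_trans[OF RDirProd_iso5[OF this] RDirProd_list_iso1]
  have "RDirProd (block H) (block H') \<simeq> RDirProd_list (block H # Ts)"
    unfolding is_ring_iso_def by blast
  then have "block J \<simeq> RDirProd_list (block H # Ts)"
    using ring_iso_trans[OF block_iso[OF H(1) H'(1) J(1) dis sum]] by blast
  moreover have "\<forall>T\<in>set (block H # Ts). simple_ring T \<and> right_noetherian_ring T \<and> right_socle T = {\<zero>\<^bsub>T\<^esub>}"
    using Ts(2) simple right_noetherian_block[OF H(1)] block_socle_zero[OF H(1) HS] by simp
  ultimately show False using J(3) by blast
qed

text \<open>The two factors are the blocks of the socle and of its annihilator. The latter meets the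
  socle only in zero, as \<open>block_product_of_simple\<close> requires.\<close>

lemma ring_decomposition:
  "\<exists>(S :: 'a ring) (T :: 'a ring) (Ts :: 'a ring list).
    R \<simeq> RDirProd S T \<and> semisimple_artinian_ring S \<and> ring T \<and> T \<simeq> RDirProd_list Ts \<and>
    (\<forall>T'\<in>set Ts. simple_ring T' \<and> right_noetherian_ring T' \<and> right_socle T' = {\<zero>\<^bsub>T'\<^esub>})"
proof -
  note S = ideal_socle and A = ideal_annihilator[OF ideal_socle]
  have "R \<simeq> RDirProd (block soc) (block (annihilator soc))"
    by (rule ring_iso_trans[OF ring_iso_block_carrier block_iso[OF S A oneideal annihilator_Int[OF S] annihilator_sum[OF S]]])
  moreover obtain Ts :: "'a ring list" where "block (annihilator soc) \<simeq> RDirProd_list Ts"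
    "\<forall>T'\<in>set Ts. simple_ring T' \<and> right_noetherian_ring T' \<and> right_socle T' = {\<zero>\<^bsub>T'\<^esub>}"
    using block_product_of_simple[OF A] annihilator_Int[OF S] by blast
  ultimately show ?thesis using semisimple_artinian_block_socle ring_block[OF A] by blast
qed

end

theorem theorem18:
  fixes R :: "('a, 'r) ring_scheme"
  assumes "ring R"
  shows "(right_V_ring R \<longrightarrow>
            (\<forall>M :: ('a, 'm) rmodule.
               right_module R M \<and> finitely_generated_module R M \<and>
               projective_module R (submod M (socle R M)) \<and>
               (\<forall>Y Z. rsubmodule R M Y \<and> rsubmodule R M Z \<and> Z \<subseteq> Y \<and>
                      cyclic_module R (quotient_module (submod M Y) Z) \<longrightarrow>
                  property_star R (quotient_module (submod M Y) Z)) \<longrightarrow>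
               noetherian_module R M \<and>
               (\<exists>X T. internal_direct_sum R M X T \<and>
                      semisimple_module R (submod M X) \<and>
                      noetherian_module R (submod M T) \<and>
                      socle R (submod M T) = {\<zero>\<^bsub>M\<^esub>})))
       \<and> (right_V_ring R \<and> every_cyclic_has_star R \<longrightarrow>
            (\<exists>(S :: 'a ring) (T :: 'a ring) (Ts :: 'a ring list).
               R \<simeq> RDirProd S T \<and>
               semisimple_artinian_ring S \<and>
               ring T \<and> T \<simeq> RDirProd_list Ts \<and>
               (\<forall>T' \<in> set Ts. simple_ring T' \<and> right_noetherian_ring T' \<and>
                               right_socle T' = {\<zero>\<^bsub>T'\<^esub>})))
       \<and> (right_WV_ring R \<longrightarrow> (right_noetherian_ring R \<longleftrightarrow> every_cyclic_has_star R))"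
proof (intro conjI impI allI, goal_cases)
  case (1 M)
  interpret right_module R M using 1 by simp
  show ?case
    by (rule cyclic_subfactors_star_imp_noeth) (use 1 in simp_all)
next
  case (2 M)
  interpret right_module R M using 2 by simp
  have "noetherian_module R M"
    by (rule cyclic_subfactors_star_imp_noeth) (use 2 in simp_all)
  then show ?case using V_ring_noeth_decompose[OF 2(1)] by metis
next
  case 3
  have "right_module.simples_split_above R (regular_module R) {\<zero>\<^bsub>R\<^esub>}"
    using right_module.V_ring_simples_split[OF right_module_regular[OF assms]] 3 by blast
  moreover have "right_module.rel_noeth R (regular_module R) {\<zero>\<^bsub>R\<^esub>} (carrier R)"
    using V_ring_star_imp_noeth[OF assms refl] 3 by simp
  ultimately interpret noeth_split_ring R
    by (intro noeth_split_ring.intro noeth_split_ring_axioms.intro assms)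
  show ?case by (rule ring_decomposition)
next
  case 4
  then show ?case
    using right_noetherian_every_cyclic_has_star WV_ring_star_imp_noeth[OF assms refl] by blast
qed

end
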